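(* Let $Z\in\mathfrak k_A$. Then $L_Z\neq\mathfrak g_2$ if and only if at least one of the following six conditions holds: (i) $u=0$; (ii) $a=0$ and $d^2+v=u$; (iii) $d=-a$ and $v=u$; (iv) $a=d=0$ and $I=0$; (v) $d=3a$ and $up=3q^3$; (vi) $\delta=0$, $I=0$ and $\Theta=0$. All these equations (a complex equation counted as two real ones) have degree at most five in the six real coordinates of $Z$.
   Context: Octonions: $\mathbb O$ has real basis $1,e_1,\dots,e_7$ with $1$ the identity, $e_i^2=-1$, and multiplication given by the oriented triples $(123),(145),(176),(246),(257),(347),(365)$: for a triple $(abc)$, $e_ae_b=e_c$, $e_be_c=e_a$, $e_ce_a=e_b$, and reversing the order changes the sign. $V=\operatorname{Im}\mathbb O$. $G_2=\operatorname{Aut}(\mathbb O)$, $\mathfrak g_2=\operatorname{Der}(\mathbb O)$, acting on $V$. $D_{ij}=D_{e_i,e_j}\in\mathfrak g_2$ with $D_{a,b}(x)=[[a,b],x]-3[a,b,x]$, $[a,b]=ab-ba$, $[a,b,x]=(ab)x-a(bx)$. $H_A=\operatorname{span}\{1,e_1,e_2,e_3\}$ and $\mathfrak k_A=\{Z\in\mathfrak g_2:Z(H_A)\subseteq H_A\}=\operatorname{span}\{D_{12},D_{13},D_{23},D_{45},D_{46},D_{47}\}$ (a basis). $S\in G_2$ is the involution $S(e_1)=e_1$, $e_2\leftrightarrow e_4$, $e_3\leftrightarrow e_5$, $S(e_6)=-e_6$, $S(e_7)=-e_7$. $L_Z$ is the smallest real Lie subalgebra containing $Z$ and $SZS^{-1}$.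 Coordinates: write $Z=x_0D_{12}+x_1D_{13}+x_2D_{23}+x_3D_{45}+x_4D_{46}+x_5D_{47}$ and put $(a_1,a_2,a_3)=(2x_2-x_3,-2x_1-x_4,2x_0-x_5)$, $(b_1,b_2,b_3)=3(x_3,x_4,x_5)$, $a=a_1$, $d=b_1$, $q=a_2+ia_3\in\mathbb C$, $p=b_2+ib_3\in\mathbb C$. Let $q^\ast$ be the complex conjugate of $q$ and define the real quantities $u=|q|^2$, $v=|p|^2$, $R+iI=p(q^\ast)^3$ ($R,I$ real), $\delta=a^2+u-d^2-v$, $\Theta=u\bigl((2v+3u)a-3ud\bigr)-(a+d)R$. *)

theory Defs
  imports "HOL-Analysis.Analysis"
begin

section \<open>Octonions\<close>

text \<open>
  The index type \<^typ>\<open>8\<close> has the elements \<open>0, \<dots>, 7\<close> (with \<open>8 = 0\<close>), so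
  \<open>oe 0\<close> is the identity of the octonions and \<open>oe 1, \<dots>, oe 7\<close> are the imaginary units.
  The octonion product is \<open>\<odot>\<close>; the library's \<open>*\<close> and \<open>1\<close> on \<^typ>\<open>real ^ 8\<close> are componentwise
  and are not used.
\<close>

type_synonym oct = "real ^ 8"

definition oe :: "8 \<Rightarrow> oct" where
  "oe i = axis i 1"

definition triples :: "(8 \<times> 8 \<times> 8) set" where
  "triples = {(1,2,3), (1,4,5), (1,7,6), (2,4,6), (2,5,7), (3,4,7), (3,6,5)}"

definition oriented :: "8 \<Rightarrow> 8 \<Rightarrow> 8 \<Rightarrow> bool" where
  "oriented i j k \<longleftrightarrow> (i, j, k) \<in> triples \<or> (j, k, i) \<in> triples \<or> (k, i, j) \<in> triples"

definition unit_mult :: "8 \<Rightarrow> 8 \<Rightarrow> oct" where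
  "unit_mult i j =
     (if i = 0 then oe j
      else if j = 0 then oe i
      else if i = j then - oe 0
      else (\<Sum>k | oriented i j k. oe k) - (\<Sum>k | oriented j i k. oe k))"

definition omult :: "oct \<Rightarrow> oct \<Rightarrow> oct" (infixl "\<odot>" 70) where
  "x \<odot> y = (\<Sum>i\<in>UNIV. \<Sum>j\<in>UNIV. (x $ i * y $ j) *\<^sub>R unit_mult i j)"

definition ocomm :: "oct \<Rightarrow> oct \<Rightarrow> oct" where
  "ocomm a b = a \<odot> b - b \<odot> a"

definition oassoc :: "oct \<Rightarrow> oct \<Rightarrow> oct \<Rightarrow> oct" where
  "oassoc a b x = (a \<odot> b) \<odot> x - a \<odot> (b \<odot> x)"

lemma bilinear_omult: "bilinear (\<odot>)"
  unfolding bilinear_def omult_def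
  by (auto intro!: linearI
      simp: scaleR_left_distrib distrib_left distrib_right sum.distrib scaleR_sum_right mult_ac)

section \<open>The Lie algebra of derivations\<close>

definition g2 :: "(oct \<Rightarrow>\<^sub>L oct) set" where
  "g2 = {D. \<forall>x y. blinfun_apply D (x \<odot> y) = blinfun_apply D x \<odot> y + x \<odot> blinfun_apply D y}"

definition bracket :: "(oct \<Rightarrow>\<^sub>L oct) \<Rightarrow> (oct \<Rightarrow>\<^sub>L oct) \<Rightarrow> (oct \<Rightarrow>\<^sub>L oct)" where
  "bracket A B = (A o\<^sub>L B) - (B o\<^sub>L A)"

definition g2_subalgebra :: "(oct \<Rightarrow>\<^sub>L oct) set \<Rightarrow> bool" where
  "g2_subalgebra L \<longleftrightarrow> L \<subseteq> g2 \<and> subspace L \<and> (\<forall>A\<in>L. \<forall>B\<in>L. bracket A B \<in> L)"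

definition inner_der :: "oct \<Rightarrow> oct \<Rightarrow> (oct \<Rightarrow>\<^sub>L oct)" where
  "inner_der a b = Blinfun (\<lambda>x. ocomm (ocomm a b) x - 3 *\<^sub>R oassoc a b x)"

lemma blinfun_apply_inner_der:
  "blinfun_apply (inner_der a b) x = ocomm (ocomm a b) x - 3 *\<^sub>R oassoc a b x"
proof -
  note b = bilinear_ladd[OF bilinear_omult] bilinear_radd[OF bilinear_omult]
    bilinear_lmul[OF bilinear_omult] bilinear_rmul[OF bilinear_omult]
  have "linear (\<lambda>x. ocomm (ocomm a b) x - 3 *\<^sub>R oassoc a b x)"
    by (rule linearI) (simp_all add: ocomm_def oassoc_def b algebra_simps)
  then show ?thesis
    unfolding inner_der_def by (simp add: bounded_linear_Blinfun_apply linear_conv_bounded_linear)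
qed

definition DD :: "8 \<Rightarrow> 8 \<Rightarrow> (oct \<Rightarrow>\<^sub>L oct)" where
  "DD i j = inner_der (oe i) (oe j)"

definition H_A :: "oct set" where
  "H_A = span {oe 0, oe 1, oe 2, oe 3}"

definition k_A :: "(oct \<Rightarrow>\<^sub>L oct) set" where
  "k_A = {Z \<in> g2. blinfun_apply Z ` H_A \<subseteq> H_A}"

section \<open>The involution\<close>

definition S :: "oct \<Rightarrow> oct" where
  "S x = x$0 *\<^sub>R oe 0 + x$1 *\<^sub>R oe 1 + x$2 *\<^sub>R oe 4 + x$3 *\<^sub>R oe 5
       + x$4 *\<^sub>R oe 2 + x$5 *\<^sub>R oe 3 - x$6 *\<^sub>R oe 6 - x$7 *\<^sub>R oe 7"

definition G2 :: "(oct \<Rightarrow> oct) set" where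
  "G2 = {f. linear f \<and> bij f \<and> (\<forall>x y. f (x \<odot> y) = f x \<odot> f y)}"

lemma exhaust_8: "i = 0 \<or> i = 1 \<or> i = 2 \<or> i = 3 \<or> i = 4 \<or> i = 5 \<or> i = 6 \<or> i = 7" for i :: 8
proof (induct i)
  case (of_int z)
  then have "z = 0 \<or> z = 1 \<or> z = 2 \<or> z = 3 \<or> z = 4 \<or> z = 5 \<or> z = 6 \<or> z = 7" by auto
  then show ?case by auto
qed

lemma UNIV_8: "UNIV = {0, 1, 2, 3, 4, 5, 6, 7 :: 8}"
  using exhaust_8 by auto

lemma sum_8: "sum f (UNIV :: 8 set) = f 0 + f 1 + f 2 + f 3 + f 4 + f 5 + f 6 + f 7"
  unfolding UNIV_8 by (simp add: ac_simps)

lemma forall_8: "(\<forall>i::8. P i) \<longleftrightarrow> P 0 \<and> P 1 \<and> P 2 \<and> P 3 \<and> P 4 \<and> P 5 \<and> P 6 \<and> P 7"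
proof
  assume *: "P 0 \<and> P 1 \<and> P 2 \<and> P 3 \<and> P 4 \<and> P 5 \<and> P 6 \<and> P 7"
  show "\<forall>i. P i"
  proof
    show "P i" for i
      using exhaust_8[of i] * by auto
  qed
qed simp

lemma S_nth:
  "S x $ 0 = x $ 0" "S x $ 1 = x $ 1" "S x $ 2 = x $ 4" "S x $ 3 = x $ 5"
  "S x $ 4 = x $ 2" "S x $ 5 = x $ 3" "S x $ 6 = - x $ 6" "S x $ 7 = - x $ 7"
  by (simp_all add: S_def oe_def axis_def)

lemma linear_S: "linear S"
  by (rule linearI) (simp_all add: vec_eq_iff forall_8 S_nth)

lemma S_S: "S (S x) = x"
  by (simp add: vec_eq_iff forall_8 S_nth)

lemma Collect_oriented:
  "Collect (oriented i j) = {k. (i, j, k) \<in> triples \<or> (j, k, i) \<in> triples \<or> (k, i, j) \<in> triples}"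
  by (auto simp: oriented_def)

lemma unit_mult_table:
  "unit_mult 1 1 = - oe 0" "unit_mult 1 2 = oe 3" "unit_mult 1 3 = - oe 2" "unit_mult 1 4 = oe 5" "unit_mult 1 5 = - oe 4" "unit_mult 1 6 = - oe 7" "unit_mult 1 7 = oe 6"
  "unit_mult 2 1 = - oe 3" "unit_mult 2 2 = - oe 0" "unit_mult 2 3 = oe 1" "unit_mult 2 4 = oe 6" "unit_mult 2 5 = oe 7" "unit_mult 2 6 = - oe 4" "unit_mult 2 7 = - oe 5"
  "unit_mult 3 1 = oe 2" "unit_mult 3 2 = - oe 1" "unit_mult 3 3 = - oe 0" "unit_mult 3 4 = oe 7" "unit_mult 3 5 = - oe 6" "unit_mult 3 6 = oe 5" "unit_mult 3 7 = - oe 4"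
  "unit_mult 4 1 = - oe 5" "unit_mult 4 2 = - oe 6" "unit_mult 4 3 = - oe 7" "unit_mult 4 4 = - oe 0" "unit_mult 4 5 = oe 1" "unit_mult 4 6 = oe 2" "unit_mult 4 7 = oe 3"
  "unit_mult 5 1 = oe 4" "unit_mult 5 2 = - oe 7" "unit_mult 5 3 = oe 6" "unit_mult 5 4 = - oe 1" "unit_mult 5 5 = - oe 0" "unit_mult 5 6 = - oe 3" "unit_mult 5 7 = oe 2"
  "unit_mult 6 1 = oe 7" "unit_mult 6 2 = oe 4" "unit_mult 6 3 = - oe 5" "unit_mult 6 4 = - oe 2" "unit_mult 6 5 = oe 3" "unit_mult 6 6 = - oe 0" "unit_mult 6 7 = - oe 1"
  "unit_mult 7 1 = - oe 6" "unit_mult 7 2 = oe 5" "unit_mult 7 3 = oe 4" "unit_mult 7 4 = - oe 3" "unit_mult 7 5 = - oe 2" "unit_mult 7 6 = oe 1" "unit_mult 7 7 = - oe 0"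
  by (simp_all add: unit_mult_def Collect_oriented triples_def)

lemma omult_oe: "oe i \<odot> oe j = unit_mult i j"
proof -
  have "oe i \<odot> oe j = (\<Sum>k\<in>UNIV. \<Sum>l\<in>UNIV. if k = i then (if l = j then unit_mult k l else 0) else 0)"
    unfolding omult_def by (intro sum.cong refl) (auto simp: oe_def axis_def)
  also have "\<dots> = (\<Sum>k\<in>UNIV. if k = i then (\<Sum>l\<in>UNIV. if l = j then unit_mult k l else 0) else 0)"
    by (intro sum.cong refl) auto
  also have "\<dots> = unit_mult i j"
    by simp
  finally show ?thesis .
qed

lemma unit_mult_0: "unit_mult 0 j = oe j" "unit_mult i 0 = oe i"
  by (simp_all add: unit_mult_def)

lemma S_oe:
  "S (oe 0) = oe 0" "S (oe 1) = oe 1" "S (oe 2) = oe 4" "S (oe 3) = oe 5"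
  "S (oe 4) = oe 2" "S (oe 5) = oe 3" "S (oe 6) = - oe 6" "S (oe 7) = - oe 7"
  by (simp_all add: S_def oe_def axis_def)

lemma S_in_G2: "S \<in> G2"
proof -
  note b = bilinear_ladd[OF bilinear_omult] bilinear_radd[OF bilinear_omult]
    bilinear_lmul[OF bilinear_omult] bilinear_rmul[OF bilinear_omult]
    bilinear_lneg[OF bilinear_omult] bilinear_rneg[OF bilinear_omult]
  note l = linear_add[OF linear_S] linear_cmul[OF linear_S] linear_neg[OF linear_S]
  have "\<forall>i j. S (oe i \<odot> oe j) = S (oe i) \<odot> S (oe j)"
    unfolding forall_8 by (simp add: S_oe b l omult_oe unit_mult_0 unit_mult_table)
  then have "\<forall>x\<in>Basis. \<forall>y\<in>Basis. S (x \<odot> y) = S x \<odot> S y"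
    by (auto simp: Basis_vec_def oe_def)
  moreover have "bilinear (\<lambda>x y. S (x \<odot> y))" "bilinear (\<lambda>x y. S x \<odot> S y)"
    unfolding bilinear_def by (auto intro!: linearI simp: b l)
  ultimately have "(\<lambda>x y. S (x \<odot> y)) = (\<lambda>x y. S x \<odot> S y)"
    by (intro bilinear_eq_stdbasis) auto
  then have "S (x \<odot> y) = S x \<odot> S y" for x y
    by meson
  moreover have "bij S"
    by (rule o_bij[of S]) (auto simp: S_S)
  ultimately show ?thesis
    using linear_S by (simp add: G2_def)
qed

definition conj_S :: "(oct \<Rightarrow>\<^sub>L oct) \<Rightarrow> (oct \<Rightarrow>\<^sub>L oct)" where
  "conj_S Z = Blinfun (S \<circ> blinfun_apply Z \<circ> inv S)"

lemma blinfun_apply_conj_S: "blinfun_apply (conj_S Z) x = S (blinfun_apply Z (S x))"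
proof -
  have "inv S = S"
    by (rule inv_equality) (simp_all add: S_S)
  moreover have "linear (S \<circ> blinfun_apply Z \<circ> S)"
    by (intro linear_compose linear_S bounded_linear.linear[OF blinfun.bounded_linear_right])
  ultimately show ?thesis
    unfolding conj_S_def
    by (simp add: bounded_linear_Blinfun_apply linear_conv_bounded_linear)
qed

definition L_of :: "(oct \<Rightarrow>\<^sub>L oct) \<Rightarrow> (oct \<Rightarrow>\<^sub>L oct) set" where
  "L_of Z = g2_subalgebra hull {Z, conj_S Z}"

section \<open>Coordinates\<close>

text \<open>
  The index type \<^typ>\<open>6\<close> has the elements \<open>0, \<dots>, 5\<close>, so \<open>x $ i\<close> is the coordinate \<open>x\<^sub>i\<close>.
\<close>

definition k_A_elem :: "real ^ 6 \<Rightarrow> (oct \<Rightarrow>\<^sub>L oct)" where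
  "k_A_elem x = x$0 *\<^sub>R DD 1 2 + x$1 *\<^sub>R DD 1 3 + x$2 *\<^sub>R DD 2 3
              + x$3 *\<^sub>R DD 4 5 + x$4 *\<^sub>R DD 4 6 + x$5 *\<^sub>R DD 4 7"

text \<open>
  For \<open>Z \<in> k_A\<close> the description denotes the coordinate vector of \<open>Z\<close>, because the six derivations
  in \<open>k_A_elem\<close> form a basis of \<open>k_A\<close>.
\<close>

definition coords :: "(oct \<Rightarrow>\<^sub>L oct) \<Rightarrow> real ^ 6" where
  "coords Z = (THE x. Z = k_A_elem x)"

definition ca :: "real ^ 6 \<Rightarrow> real" where
  "ca x = 2 * x$2 - x$3"

definition cd :: "real ^ 6 \<Rightarrow> real" where
  "cd x = 3 * x$3"

definition cq :: "real ^ 6 \<Rightarrow> complex" where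
  "cq x = Complex (- 2 * x$1 - x$4) (2 * x$0 - x$5)"

definition cp :: "real ^ 6 \<Rightarrow> complex" where
  "cp x = Complex (3 * x$4) (3 * x$5)"

definition cu :: "real ^ 6 \<Rightarrow> real" where
  "cu x = (cmod (cq x))\<^sup>2"

definition cv :: "real ^ 6 \<Rightarrow> real" where
  "cv x = (cmod (cp x))\<^sup>2"

definition cR :: "real ^ 6 \<Rightarrow> real" where
  "cR x = Re (cp x * cnj (cq x) ^ 3)"

definition cI :: "real ^ 6 \<Rightarrow> real" where
  "cI x = Im (cp x * cnj (cq x) ^ 3)"

definition cdelta :: "real ^ 6 \<Rightarrow> real" where
  "cdelta x = (ca x)\<^sup>2 + cu x - (cd x)\<^sup>2 - cv x"

definition cTheta :: "real ^ 6 \<Rightarrow> real" where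
  "cTheta x = cu x * ((2 * cv x + 3 * cu x) * ca x - 3 * cu x * cd x) - (ca x + cd x) * cR x"

text \<open>Polynomial functions of total degree at most \<open>n\<close>; \<open>c \<alpha>\<close> is the coefficient of
  the monomial with exponents \<open>\<alpha>\<close>.\<close>

definition poly_fun_degree_le :: "nat \<Rightarrow> (real ^ 'n \<Rightarrow> real) \<Rightarrow> bool" where
  "poly_fun_degree_le n f \<longleftrightarrow>
     (\<exists>c :: ('n \<Rightarrow> nat) \<Rightarrow> real. \<forall>x.
        f x = (\<Sum>\<alpha> | (\<Sum>i\<in>UNIV. \<alpha> i) \<le> n. c \<alpha> * (\<Prod>i\<in>UNIV. x $ i ^ \<alpha> i)))"

lemma finite_exponents: "finite {\<alpha> :: 'n::finite \<Rightarrow> nat. (\<Sum>i\<in>UNIV. \<alpha> i) \<le> n}"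
proof (rule finite_subset)
  show "{\<alpha> :: 'n \<Rightarrow> nat. (\<Sum>i\<in>UNIV. \<alpha> i) \<le> n} \<subseteq> (UNIV :: 'n set) \<rightarrow>\<^sub>E {..n}"
  proof
    fix \<alpha> :: "'n \<Rightarrow> nat"
    assume "\<alpha> \<in> {\<alpha>. (\<Sum>i\<in>UNIV. \<alpha> i) \<le> n}"
    then have "\<alpha> i \<le> n" for i
      using member_le_sum[of i UNIV \<alpha>] by simp
    then show "\<alpha> \<in> UNIV \<rightarrow>\<^sub>E {..n}"
      by (simp add: PiE_def extensional_def)
  qed
  show "finite ((UNIV :: 'n set) \<rightarrow>\<^sub>E {..n})"
    by (intro finite_PiE) auto
qed

end

theory Submission
  imports Defs
begin

text \<open>
  Let \<open>L\<close> be a proper subalgebra of \<open>g\<^sub>2\<close>. If \<open>L\<close> contains two linearly independent commuting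
  elements, then it contains a Cartan subalgebra, which is the standard one in a suitable octonion
  basis; the root planes contained in \<open>L\<close> then show that \<open>L\<close> kills a nonzero vector of \<open>V\<close> or preserves
  an associative 3-plane. If \<open>L\<close> has no such pair, then \<open>dim L \<le> 3\<close>.

  For \<open>L = L_of Z\<close> the first alternative amounts to \<open>Z k = 0\<close> and \<open>Z (S k) = \<lambda> (k \<times> S k)\<close> for some
  nonzero \<open>k \<in> V\<close> and some real \<open>\<lambda>\<close>; conversely the span of \<open>k\<close>, \<open>S k\<close>, \<open>k \<times> S k\<close> is then invariant.
  Eliminating \<open>k\<close> and \<open>\<lambda>\<close> for \<open>Z \<in> k_A\<close> gives conditions (i)-(vi). If \<open>dim L \<le> 3\<close>, then
  \<open>[Z, [Z, S Z S]]\<close> is a combination of \<open>Z\<close> and \<open>S Z S\<close>, which for \<open>q \<noteq> 0\<close> only happens in case (iv).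
\<close>

section \<open>Skew and self-adjoint operators, Lie algebras of rank one\<close>

text \<open>The maximal proper subalgebras of \<open>g2\<close> are of type su(3), so(4) and
  principal so(3). The first two fix a vector of V or preserve an associative plane, but the
  principal so(3) acts irreducibly on V, so invariant subspaces alone cannot detect every proper L.
  The split by rank isolates this case, and the double bracket tests it by a linear relation,
  without any classification.

  A second obstacle is that an associative plane preserved by L is not known to be stable under S.
  Its intersection or sum with its S-image is stable, and the vector k is found there or in the
  orthogonal complement.

  The elimination is governed by one complex number, \<rho> = p cnj(q) / q^2. Measuring the
  coordinates of k in powers of q and cnj(q) removes the phase of q, and all equations then involve
  only a, d, u and \<rho>. Since v = |\<rho>|^2 u and R + iI = u^2 \<rho>, the equation I = 0 says
  that \<rho> is real, and u p = 3 q^3 says that \<rho> = 3.\<close>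

lemma self_adjoint_eigenvector:
  fixes f :: "'a::euclidean_space \<Rightarrow> 'a"
  assumes f: "linear f" and N: "subspace N" "N \<noteq> {0}"
    and inv: "\<And>x. x \<in> N \<Longrightarrow> f x \<in> N"
    and adj: "\<And>x y. x \<in> N \<Longrightarrow> y \<in> N \<Longrightarrow> f x \<bullet> y = x \<bullet> f y"
  shows "\<exists>x m. x \<in> N \<and> norm x = 1 \<and> f x = m *\<^sub>R x \<and> (\<forall>y\<in>N. m * (y \<bullet> y) \<le> f y \<bullet> y)"
proof -
  let ?K = "N \<inter> sphere 0 1"
  obtain z where z: "z \<in> N" "z \<noteq> 0"
    using N subspace_0[OF N(1)] by auto
  have "z /\<^sub>R norm z \<in> ?K"
    using z N(1) by (auto simp: subspace_scale)
  then have "?K \<noteq> {}" by blast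
  moreover have "compact ?K"
    using closed_subspace[OF N(1)] by (simp add: closed_Int_compact)
  moreover have "continuous_on ?K (\<lambda>y. f y \<bullet> y)"
    using f by (intro continuous_on_inner continuous_on_id linear_continuous_on) (simp add: linear_conv_bounded_linear)
  \<comment> \<open>The minimiser of the Rayleigh quotient on \<open>N\<close>. The lower bound kept
    in the conclusion is what later singles out minimal frequencies.\<close>
  ultimately obtain x where x: "x \<in> ?K" and min: "\<And>y. y \<in> ?K \<Longrightarrow> f x \<bullet> x \<le> f y \<bullet> y"
    using continuous_attains_inf[of ?K "\<lambda>y. f y \<bullet> y"] by blast
  define m where "m = f x \<bullet> x"
  have xN: "x \<in> N" and x1: "norm x = 1" "x \<bullet> x = 1"
    using x by (auto simp: norm_eq_1)
  have le: "m * (y \<bullet> y) \<le> f y \<bullet> y" if "y \<in> N" for y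
  proof (cases "y = 0")
    case True
    then show ?thesis by simp
  next
    case False
    have "y /\<^sub>R norm y \<in> ?K"
      using that False N(1) by (auto simp: subspace_scale)
    from min[OF this] have "m \<le> (f y \<bullet> y) / (norm y)\<^sup>2"
      by (simp add: m_def linear_cmul[OF f] power2_eq_square divide_inverse mult_ac)
    then show ?thesis
      using False by (simp add: pos_le_divide_eq dot_square_norm)
  qed
  \<comment> \<open>The defect of the eigenvalue equation serves as direction of variation: at
    \<open>x + t *\<^sub>R y\<close> the nonnegative form
    \<open>f z \<bullet> z - m * (z \<bullet> z)\<close> has the linear term
    \<open>2 * t * (y \<bullet> y)\<close>, so a small negative \<open>t\<close> gives a
    contradiction unless \<open>y = 0\<close>.\<close>
  define y where "y = f x - m *\<^sub>R x"
  have yN: "y \<in> N"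
    unfolding y_def using xN inv N(1) by (simp add: subspace_diff subspace_scale)
  have "0 \<le> 2 * t * (y \<bullet> y) + t\<^sup>2 * (f y \<bullet> y - m * (y \<bullet> y))" for t :: real
  proof -
    have "x + t *\<^sub>R y \<in> N"
      using xN yN N(1) by (simp add: subspace_add subspace_scale)
    from le[OF this]
    have "0 \<le> (f x \<bullet> x - m * (x \<bullet> x)) + t * (f x \<bullet> y + f y \<bullet> x - 2 * m * (x \<bullet> y))
        + t\<^sup>2 * (f y \<bullet> y - m * (y \<bullet> y))"
      by (simp add: linear_add[OF f] linear_cmul[OF f] algebra_simps power2_eq_square inner_commute)
    moreover have "f x \<bullet> x - m * (x \<bullet> x) = 0"
      by (simp add: m_def x1)
    moreover have "f x \<bullet> y + f y \<bullet> x - 2 * m * (x \<bullet> y) = 2 * (y \<bullet> y)"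
      using adj[OF yN xN] by (simp add: y_def inner_commute algebra_simps)
    ultimately show ?thesis by simp
  qed
  note quad = this
  have "y \<bullet> y = 0"
  proof (rule ccontr)
    assume "y \<bullet> y \<noteq> 0"
    then have pos: "0 < y \<bullet> y" by (simp add: less_le)
    define C where "C = f y \<bullet> y - m * (y \<bullet> y)"
    have C: "0 \<le> C" using le[OF yN] by (simp add: C_def)
    \<comment> \<open>With this \<open>t\<close> the size of \<open>t * C\<close> is at most
      \<open>y \<bullet> y\<close>, so the quadratic term cannot outweigh the linear one; the 1
      covers \<open>C = 0\<close>.\<close>
    define t where "t = - (y \<bullet> y) / (C + 1)"
    have "0 \<le> t * (2 * (y \<bullet> y) + t * C)"
      using quad[of t] by (simp add: C_def algebra_simps power2_eq_square)
    moreover have "t < 0" using pos C by (simp add: t_def divide_neg_pos)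
    moreover have "2 * (y \<bullet> y) + t * C > 0"
    proof -
      have "(y \<bullet> y) * C / (C + 1) \<le> y \<bullet> y"
        using pos C by (simp add: divide_le_eq mult_left_mono)
      moreover have "t * C = - ((y \<bullet> y) * C / (C + 1))" by (simp add: t_def)
      ultimately show ?thesis using pos by linarith
    qed
    ultimately show False by (simp add: zero_le_mult_iff)
  qed
  then have "f x = m *\<^sub>R x" by (simp add: y_def)
  with xN x1 le show ?thesis by blast
qed

section \<open>Kernels of skew operators in odd dimension\<close>

lemma skew_swap:
  fixes f :: "'a::real_inner \<Rightarrow> 'a"
  assumes f: "linear f" and N: "subspace N"
    and skew: "\<And>x. x \<in> N \<Longrightarrow> f x \<bullet> x = 0" and xy: "x \<in> N" "y \<in> N"
  shows "f x \<bullet> y = - (x \<bullet> f y)"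
proof -
  have "f (x + y) \<bullet> (x + y) = 0" "f x \<bullet> x = 0" "f y \<bullet> y = 0"
    using skew xy N by (auto simp: subspace_add)
  then show ?thesis
    by (simp add: linear_add[OF f] inner_add_left inner_add_right inner_commute)
qed

lemma dim_orthogonal_pair:
  fixes x y :: "'a::euclidean_space"
  assumes N: "subspace N" and xy: "x \<in> N" "y \<in> N" "x \<noteq> 0" "y \<noteq> 0" "x \<bullet> y = 0"
  shows "dim {z \<in> N. z \<bullet> x = 0 \<and> z \<bullet> y = 0} + 2 = dim N"
proof -
  have "dim {z \<in> N. \<forall>a \<in> span {x, y}. orthogonal a z} + dim (span {x, y}) = dim N"
    using N xy span_minimal[of "{x, y}" N] by (intro dim_subspace_orthogonal_to_vectors) auto
  moreover have "{z \<in> N. \<forall>a \<in> span {x, y}. orthogonal a z} = {z \<in> N. z \<bullet> x = 0 \<and> z \<bullet> y = 0}"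
  proof -
    have "(\<forall>a \<in> span {x, y}. orthogonal a z) \<longleftrightarrow> z \<bullet> x = 0 \<and> z \<bullet> y = 0" for z
    proof
      assume "\<forall>a \<in> span {x, y}. orthogonal a z"
      then show "z \<bullet> x = 0 \<and> z \<bullet> y = 0"
        by (simp add: span_base orthogonal_def inner_commute)
    next
      assume "z \<bullet> x = 0 \<and> z \<bullet> y = 0"
      then show "\<forall>a \<in> span {x, y}. orthogonal a z"
        using orthogonal_to_span[of _ "{x, y}" z] by (auto simp: orthogonal_def inner_commute)
    qed
    then show ?thesis by auto
  qed
  moreover have "dim (span {x, y}) = 2"
  proof -
    have "x \<noteq> y" using xy by auto
    moreover have "independent {x, y}"
      using xy by (intro pairwise_orthogonal_independent) (auto simp: pairwise_def orthogonal_def inner_commute)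
    ultimately show ?thesis by (simp add: dim_eq_card_independent)
  qed
  ultimately show ?thesis by simp
qed

text \<open>The square of a skew operator is self-adjoint. An eigenvector \<open>x\<close> of it
  with \<open>f x \<noteq> 0\<close> spans an invariant plane with \<open>f x\<close>; passing to
  the orthogonal complement lowers the dimension by 2 and keeps its parity.\<close>

lemma skew_odd_kernel:
  fixes f :: "'a::euclidean_space \<Rightarrow> 'a"
  assumes f: "linear f" and N: "subspace N" and inv: "\<And>x. x \<in> N \<Longrightarrow> f x \<in> N"
    and skew: "\<And>x. x \<in> N \<Longrightarrow> f x \<bullet> x = 0" and odd: "odd (dim N)"
  shows "\<exists>x\<in>N. x \<noteq> 0 \<and> f x = 0"
  using N inv skew odd
proof (induction "dim N" arbitrary: N rule: less_induct)
  case less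
  note N = less.prems(1) and inv = less.prems(2) and skew = less.prems(3)
  note sw = skew_swap[OF f N skew]
  have N0: "N \<noteq> {0}" using less.prems(4) by auto
  have "linear (\<lambda>x. f (f x))"
    using linear_compose[OF f f] by (simp add: o_def)
  moreover have "f (f x) \<bullet> y = x \<bullet> f (f y)" if "x \<in> N" "y \<in> N" for x y
    using sw[of "f x" y] sw[of x "f y"] that inv by simp
  ultimately have "\<exists>x m. x \<in> N \<and> norm x = 1 \<and> f (f x) = m *\<^sub>R x
      \<and> (\<forall>y\<in>N. m * (y \<bullet> y) \<le> f (f y) \<bullet> y)"
    using N N0 inv by (intro self_adjoint_eigenvector) auto
  then obtain x m where x: "x \<in> N" "norm x = 1" "f (f x) = m *\<^sub>R x"
    by blast
  then have x0: "x \<noteq> 0" by auto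
  show ?case
  proof (cases "f x = 0")
    case True
    then show ?thesis using x x0 by auto
  next
    case False
    let ?M = "{z \<in> N. z \<bullet> x = 0 \<and> z \<bullet> f x = 0}"
    have dim: "dim ?M + 2 = dim N"
      using x x0 False N inv skew by (intro dim_orthogonal_pair) (auto simp: inner_commute)
    have "\<exists>z\<in>?M. z \<noteq> 0 \<and> f z = 0"
    proof (rule less.hyps)
      show "dim ?M < dim N" using dim by simp
      show "subspace ?M"
        using N by (auto simp: subspace_def inner_add_left)
      show "f z \<in> ?M" if "z \<in> ?M" for z
        using that sw[of z x] sw[of z "f x"] x inv by auto
      show "f z \<bullet> z = 0" if "z \<in> ?M" for z
        using that skew by auto
      show "odd (dim ?M)" using dim less.prems(4) by presburger
    qed
    then show ?thesis by auto
  qed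
qed

text \<open>The complement of the kernel of \<open>f\<close> has even dimension, since
  \<open>f\<close> is injective there. Hence the kernel of \<open>f\<close> has odd dimension, and
  \<open>g\<close> preserves it.\<close>

lemma commuting_skew_odd_kernel:
  fixes f g :: "'a::euclidean_space \<Rightarrow> 'a"
  assumes f: "linear f" and g: "linear g" and N: "subspace N"
    and inv: "\<And>x. x \<in> N \<Longrightarrow> f x \<in> N" "\<And>x. x \<in> N \<Longrightarrow> g x \<in> N"
    and skew: "\<And>x. x \<in> N \<Longrightarrow> f x \<bullet> x = 0" "\<And>x. x \<in> N \<Longrightarrow> g x \<bullet> x = 0"
    and comm: "\<And>x. x \<in> N \<Longrightarrow> f (g x) = g (f x)" and odd: "odd (dim N)"
  shows "\<exists>x\<in>N. x \<noteq> 0 \<and> f x = 0 \<and> g x = 0"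
proof -
  let ?K = "{x \<in> N. f x = 0}" and ?M = "{z \<in> N. \<forall>a\<in>{x \<in> N. f x = 0}. orthogonal a z}"
  note sw = skew_swap[OF f N skew(1)]
  have K: "subspace ?K"
    using N by (auto simp: subspace_def linear_0[OF f] linear_add[OF f] linear_cmul[OF f])
  have dim: "dim ?M + dim ?K = dim N"
    using K N by (intro dim_subspace_orthogonal_to_vectors) auto
  have M: "subspace ?M"
    using N by (auto simp: subspace_def orthogonal_def inner_add_right)
  have "even (dim ?M)"
  proof (rule ccontr)
    assume "odd (dim ?M)"
    moreover have "f z \<in> ?M" if "z \<in> ?M" for z
      using that inv sw by (auto simp: orthogonal_def) (metis inner_zero_left neg_equal_0_iff_equal)
    ultimately obtain z where z: "z \<in> ?M" "z \<noteq> 0" "f z = 0"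
      using skew_odd_kernel[OF f M] skew by blast
    then have "orthogonal z z" by auto
    then show False using z by (simp add: orthogonal_self)
  qed
  then have "odd (dim ?K)" using dim odd by presburger
  moreover have "g x \<in> ?K" if "x \<in> ?K" for x
    using that inv comm[of x] by (auto simp: linear_0[OF g])
  ultimately have "\<exists>x\<in>?K. x \<noteq> 0 \<and> g x = 0"
    using skew_odd_kernel[OF g K] skew by blast
  then show ?thesis by auto
qed

section \<open>Lie algebras of rank one with an invariant inner product\<close>

text \<open>
  An eigenvector pair \<open>X, Y\<close> of \<open>ad H\<close> of minimal frequency spans a copy of \<open>so(3)\<close> with \<open>H\<close>. In the
  complement, a weight vector \<open>P + \<i> Q\<close> of minimal positive weight is killed by the lowering operator,
  which is impossible in a unitary representation.
\<close>

lemma lie_rank_one_dim_le_3: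
  fixes br :: "'a::euclidean_space \<Rightarrow> 'a \<Rightarrow> 'a"
  assumes bil: "bilinear br" and L: "subspace L"
    and closed: "\<And>x y. x \<in> L \<Longrightarrow> y \<in> L \<Longrightarrow> br x y \<in> L"
    and alt: "\<And>x. x \<in> L \<Longrightarrow> br x x = 0"
    and jac: "\<And>x y z. x \<in> L \<Longrightarrow> y \<in> L \<Longrightarrow> z \<in> L \<Longrightarrow> br x (br y z) = br (br x y) z + br y (br x z)"
    and inv: "\<And>x y z. x \<in> L \<Longrightarrow> y \<in> L \<Longrightarrow> z \<in> L \<Longrightarrow> br x y \<bullet> z = - (y \<bullet> br x z)"
    and rank: "\<And>x y. x \<in> L \<Longrightarrow> y \<in> L \<Longrightarrow> x \<noteq> 0 \<Longrightarrow> br x y = 0 \<Longrightarrow> \<exists>c. y = c *\<^sub>R x"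
  shows "dim L \<le> 3"
proof (rule ccontr)
  assume dL: "\<not> dim L \<le> 3"
  note b = bilinear_ladd[OF bil] bilinear_radd[OF bil] bilinear_lmul[OF bil] bilinear_rmul[OF bil]
    bilinear_lneg[OF bil] bilinear_rneg[OF bil] bilinear_lsub[OF bil] bilinear_rsub[OF bil]
    bilinear_lzero[OF bil] bilinear_rzero[OF bil]
  have anti: "br x y = - br y x" if "x \<in> L" "y \<in> L" for x y
  proof -
    have "br (x + y) (x + y) = 0" "br x x = 0" "br y y = 0"
      using that L by (auto intro!: alt simp: subspace_add)
    then show ?thesis by (simp add: b add_eq_0_iff add.commute)
  qed
  note sub = subspace_add[OF L] subspace_diff[OF L] subspace_scale[OF L] subspace_neg[OF L]
  \<comment> \<open>The assumption \<open>dim L > 3\<close> enters only here: any three elements of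
    \<open>L\<close> leave a nonzero vector of \<open>L\<close> orthogonal to them.\<close>
  have big: "\<exists>z\<in>L. z \<noteq> 0 \<and> (\<forall>a\<in>A. z \<bullet> a = 0)" if A: "A \<subseteq> L" "finite A" "card A \<le> 3" for A
  proof -
    have "dim {z \<in> L. \<forall>a \<in> span A. orthogonal a z} + dim (span A) = dim L"
      using A L span_minimal[of A L] by (intro dim_subspace_orthogonal_to_vectors) auto
    moreover have "dim (span A) \<le> card A"
      using A by (simp add: dim_le_card')
    ultimately have "dim {z \<in> L. \<forall>a \<in> span A. orthogonal a z} > 0"
      using A dL by linarith
    then have "dim {z \<in> L. \<forall>a \<in> span A. orthogonal a z} \<noteq> 0" by (rule gr_implies_not0)
    then have "\<not> {z \<in> L. \<forall>a \<in> span A. orthogonal a z} \<subseteq> {0}"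
      unfolding dim_eq_0 .
    then obtain z where "z \<in> L" "z \<noteq> 0" "\<forall>a \<in> span A. orthogonal a z" by blast
    then show ?thesis by (intro bexI[of _ z]) (auto simp: orthogonal_def inner_commute span_base)
  qed
  obtain H where H: "H \<in> L" "H \<noteq> 0" using big[of "{}"] by auto
  \<comment> \<open>Minus the square of \<open>ad H\<close> is self-adjoint and nonnegative on
    \<open>L\<close> by invariance, and by rank one its kernel in \<open>L\<close> is the line of
    \<open>H\<close>. Its eigenvalues on the complement are squares of positive frequencies.\<close>
  let ?A = "\<lambda>y. - br H (br H y)"
  have lin: "linear ?A"
    by (rule linearI) (simp_all add: b)
  have adj: "?A x \<bullet> y = x \<bullet> ?A y" if "x \<in> L" "y \<in> L" for x y
    using inv[of H "br H x" y] inv[of H x "br H y"] that H closed by simp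
  have A_pos: "?A y \<bullet> y = br H y \<bullet> br H y" if "y \<in> L" for y
    using inv[of H "br H y" y] that H closed by simp
  define N0 where "N0 = {y \<in> L. y \<bullet> H = 0}"
  have "subspace N0" using L by (auto simp: N0_def subspace_def inner_add_left)
  moreover have "N0 \<noteq> {0}" using big[of "{H}"] H by (auto simp: N0_def)
  moreover have "?A y \<in> N0" if "y \<in> N0" for y
    using that H closed sub inv[of H "br H y" H] alt[OF H(1)] by (auto simp: N0_def b)
  moreover have "?A x \<bullet> y = x \<bullet> ?A y" if "x \<in> N0" "y \<in> N0" for x y
    using that by (intro adj) (auto simp: N0_def)
  ultimately have "\<exists>x m. x \<in> N0 \<and> norm x = 1 \<and> ?A x = m *\<^sub>R x
      \<and> (\<forall>y\<in>N0. m * (y \<bullet> y) \<le> ?A y \<bullet> y)"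
    by (rule self_adjoint_eigenvector[OF lin])
  then obtain X m where X: "X \<in> N0" "norm X = 1" "?A X = m *\<^sub>R X"
    and Xmin: "\<And>y. y \<in> N0 \<Longrightarrow> m * (y \<bullet> y) \<le> ?A y \<bullet> y"
    by blast
  have XL: "X \<in> L" "X \<bullet> H = 0" "X \<bullet> X = 1" using X by (auto simp: N0_def norm_eq_1)
  have nz: "br H y \<noteq> 0" if y: "y \<in> L" "y \<bullet> H = 0" "y \<noteq> 0" for y
  proof
    assume "br H y = 0"
    then obtain c where "y = c *\<^sub>R H" using rank[OF H(1) y(1) H(2)] by auto
    then show False using y H by auto
  qed
  have m_eq: "m = br H X \<bullet> br H X"
    using A_pos[OF XL(1)] X XL by simp
  have "X \<noteq> 0" using X by auto
  then have m0: "m > 0" unfolding m_eq using nz[of X] XL by simp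
  define \<mu> where "\<mu> = sqrt m"
  have \<mu>: "\<mu> > 0" "\<mu> * \<mu> = m" using m0 by (auto simp: \<mu>_def)
  define Y where "Y = br H X /\<^sub>R \<mu>"
  have HX: "br H X = \<mu> *\<^sub>R Y" using \<mu> by (simp add: Y_def)
  have HY: "br H Y = - (\<mu> *\<^sub>R X)"
  proof -
    have "br H (br H X) = - (m *\<^sub>R X)" using X(3) by (metis minus_minus)
    moreover have "inverse \<mu> * m = \<mu>" using \<mu> by (simp add: field_simps)
    ultimately show ?thesis by (simp add: Y_def b)
  qed
  have YL: "Y \<in> L" using XL H closed sub by (simp add: Y_def)
  \<comment> \<open>\<open>ad H\<close> rotates the plane of \<open>X\<close> and \<open>Y\<close>,
    so it kills their bracket; rank one makes the bracket a multiple of \<open>H\<close>, and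
    invariance makes the factor \<open>c\<close> positive.\<close>
  have "br H (br X Y) = 0"
    by (simp add: jac[OF H(1) XL(1) YL] HX HY b alt XL YL)
  then obtain c where XY: "br X Y = c *\<^sub>R H"
    using rank[of H "br X Y"] H XL YL closed by auto
  have YY: "Y \<bullet> Y = 1"
    using m_eq \<mu> m0 by (simp add: HX)
  have "c * (H \<bullet> H) = \<mu>"
  proof -
    have "br X Y \<bullet> H = - (Y \<bullet> br X H)" using inv XL YL H by simp
    also have "br X H = - br H X" using anti[OF XL(1) H(1)] .
    finally show ?thesis by (simp add: XY HX YY)
  qed
  then have c: "c > 0"
    using \<mu>(1) H(2) zero_less_mult_pos2[of c "H \<bullet> H"] by simp
  have XH: "br X H = - (\<mu> *\<^sub>R Y)" and YH: "br Y H = \<mu> *\<^sub>R X" and YX: "br Y X = - (c *\<^sub>R H)"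
    using anti[OF XL(1) H(1)] anti[OF YL H(1)] anti[OF YL XL(1)] by (simp_all add: HX HY XY)
  \<comment> \<open>The span of \<open>H\<close>, \<open>X\<close>, \<open>Y\<close> is a
    subalgebra, so its orthogonal complement is a representation of it.\<close>
  define N where "N = {y \<in> L. y \<bullet> H = 0 \<and> y \<bullet> X = 0 \<and> y \<bullet> Y = 0}"
  have NL: "N \<subseteq> L" by (auto simp: N_def)
  have Nsub: "subspace N" using L by (auto simp: N_def subspace_def inner_add_left)
  have N_H: "br H y \<in> N" if "y \<in> N" for y
    using that inv[of H y H] inv[of H y X] inv[of H y Y] H XL YL closed alt[OF H(1)]
    by (auto simp: N_def HX HY)
  have N_X: "br X y \<in> N" if "y \<in> N" for y
    using that inv[of X y H] inv[of X y X] inv[of X y Y] H XL YL closed alt[OF XL(1)]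
    by (auto simp: N_def XY XH)
  have N_Y: "br Y y \<in> N" if "y \<in> N" for y
    using that inv[of Y y H] inv[of Y y X] inv[of Y y Y] H XL YL closed alt[OF YL(1)]
    by (auto simp: N_def YX YH)
  have "card {H, X, Y} \<le> 3" by (simp add: card_insert_le_m1)
  then have "N \<noteq> {0}" using big[of "{H, X, Y}"] H XL YL by (auto simp: N_def)
  moreover have "?A y \<in> N" if "y \<in> N" for y
    using that N_H subspace_neg[OF Nsub] by simp
  moreover have "?A x \<bullet> y = x \<bullet> ?A y" if "x \<in> N" "y \<in> N" for x y
    using that NL by (intro adj) auto
  ultimately have "\<exists>x m. x \<in> N \<and> norm x = 1 \<and> ?A x = m *\<^sub>R x
      \<and> (\<forall>y\<in>N. m * (y \<bullet> y) \<le> ?A y \<bullet> y)"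
    by (rule self_adjoint_eigenvector[OF lin Nsub])
  then obtain P k where P: "P \<in> N" "norm P = 1" "?A P = k *\<^sub>R P"
    and Pmin: "\<And>y. y \<in> N \<Longrightarrow> k * (y \<bullet> y) \<le> ?A y \<bullet> y"
    by blast
  have PL: "P \<in> L" "P \<bullet> H = 0" "P \<bullet> P = 1" using P by (auto simp: N_def norm_eq_1)
  have "m * (P \<bullet> P) \<le> ?A P \<bullet> P" using P by (intro Xmin) (auto simp: N_def N0_def)
  then have mk: "m \<le> k" using P PL by simp
  define w where "w = sqrt k"
  have w: "w \<ge> \<mu>" "w * w = k" "w > 0"
    using mk m0 by (auto simp: w_def \<mu>_def)
  define Q where "Q = br H P /\<^sub>R w"
  have HP: "br H P = w *\<^sub>R Q" using w by (simp add: Q_def)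
  have HQ: "br H Q = - (w *\<^sub>R P)"
  proof -
    have "br H (br H P) = - (k *\<^sub>R P)" using P(3) by (metis minus_minus)
    moreover have "inverse w * k = w" using w by (simp add: field_simps)
    ultimately show ?thesis by (simp add: Q_def b)
  qed
  have QN: "Q \<in> N" using N_H[OF P(1)] subspace_scale[OF Nsub] by (simp add: Q_def)
  then have QL: "Q \<in> L" using NL by auto
  have "Q \<noteq> 0" using nz[OF PL(1,2)] PL(3) HP by (metis inner_zero_left scaleR_zero_right zero_neq_one)
  \<comment> \<open>\<open>P' + \<i> Q'\<close> is the bracket of \<open>X - \<i> Y\<close> with
    \<open>P + \<i> Q\<close>. The first factor shifts the frequency \<open>w\<close> to
    \<open>w - \<mu>\<close>, which lies below the minimum on \<open>N\<close>, so the bracket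
    vanishes.\<close>
  define P' where "P' = br X P + br Y Q"
  define Q' where "Q' = br X Q - br Y P"
  have N': "P' \<in> N" "Q' \<in> N"
    using N_X N_Y P QN subspace_add[OF Nsub] subspace_diff[OF Nsub] by (auto simp: P'_def Q'_def)
  have HP': "br H P' = (w - \<mu>) *\<^sub>R Q'"
    by (simp add: P'_def Q'_def b jac H XL YL PL QL HX HY HP HQ algebra_simps)
  have HQ': "br H Q' = - ((w - \<mu>) *\<^sub>R P')"
    by (simp add: P'_def Q'_def b jac H XL YL PL QL HX HY HP HQ algebra_simps)
  have vanish: "y = 0" if y: "y \<in> N" "?A y = (w - \<mu>)\<^sup>2 *\<^sub>R y" for y
  proof (rule ccontr)
    assume "y \<noteq> 0"
    then have "k \<le> (w - \<mu>)\<^sup>2" using Pmin[OF y(1)] y(2) by simp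
    moreover have "(w - \<mu>)\<^sup>2 < w\<^sup>2" using w \<mu> by (intro power_strict_mono) auto
    ultimately show False using w by (simp add: power2_eq_square)
  qed
  have "P' = 0" "Q' = 0"
    by (rule vanish, simp_all add: N' HP' HQ' b power2_eq_square)+
  then have e: "br X P = - br Y Q" "br Y P = br X Q"
    by (auto simp: P'_def Q'_def eq_neg_iff_add_eq_0)
  \<comment> \<open>On \<open>Q\<close> the sum of the squares of \<open>ad X\<close> and
    \<open>ad Y\<close> is thus multiplication by \<open>c * w > 0\<close>, whereas squares of skew
    operators are nonpositive.\<close>
  have "br X (br Y P) = br (br X Y) P + br Y (br X P)" by (rule jac[OF XL(1) YL PL(1)])
  then have "br X (br X Q) + br Y (br Y Q) = (c * w) *\<^sub>R Q"
    by (simp add: e XY HP b)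
  then have "br X (br X Q) \<bullet> Q + br Y (br Y Q) \<bullet> Q = c * w * (Q \<bullet> Q)"
    by (metis inner_add_left inner_scaleR_left)
  moreover have "br X (br X Q) \<bullet> Q = - (br X Q \<bullet> br X Q)" "br Y (br Y Q) \<bullet> Q = - (br Y Q \<bullet> br Y Q)"
    using inv[of X "br X Q" Q] inv[of Y "br Y Q" Q] XL YL QL closed by auto
  moreover have "c * w * (Q \<bullet> Q) > 0" using c w \<open>Q \<noteq> 0\<close> by simp
  ultimately show False
    using inner_ge_zero[of "br X Q"] inner_ge_zero[of "br Y Q"] by linarith
qed

lemma commuting_self_adjoint_eigenvector:
  fixes f g :: "'a::euclidean_space \<Rightarrow> 'a"
  assumes f: "linear f" and g: "linear g" and N: "subspace N" "N \<noteq> {0}"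
    and inv: "\<And>x. x \<in> N \<Longrightarrow> f x \<in> N" "\<And>x. x \<in> N \<Longrightarrow> g x \<in> N"
    and adj: "\<And>x y. x \<in> N \<Longrightarrow> y \<in> N \<Longrightarrow> f x \<bullet> y = x \<bullet> f y"
      "\<And>x y. x \<in> N \<Longrightarrow> y \<in> N \<Longrightarrow> g x \<bullet> y = x \<bullet> g y"
    and comm: "\<And>x. x \<in> N \<Longrightarrow> f (g x) = g (f x)"
  shows "\<exists>x m n. x \<in> N \<and> norm x = 1 \<and> f x = m *\<^sub>R x \<and> g x = n *\<^sub>R x"
proof -
  have "\<exists>x m. x \<in> N \<and> norm x = 1 \<and> f x = m *\<^sub>R x \<and> (\<forall>y\<in>N. m * (y \<bullet> y) \<le> f y \<bullet> y)"
    by (rule self_adjoint_eigenvector[OF f N inv(1) adj(1)])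
  then obtain x m where x: "x \<in> N" "norm x = 1" "f x = m *\<^sub>R x" by blast
  let ?M = "{y \<in> N. f y = m *\<^sub>R y}"
  have M: "subspace ?M"
    using N(1) by (auto simp: subspace_def linear_0[OF f] linear_add[OF f] linear_cmul[OF f] algebra_simps)
  have "x \<in> ?M" "x \<noteq> 0" using x by auto
  then have M0: "?M \<noteq> {0}" by blast
  have "g y \<in> ?M" if "y \<in> ?M" for y
    using that inv(2) comm[of y] by (simp add: linear_cmul[OF g])
  then have "\<exists>x n. x \<in> ?M \<and> norm x = 1 \<and> g x = n *\<^sub>R x \<and> (\<forall>y\<in>?M. n * (y \<bullet> y) \<le> g y \<bullet> y)"
    by (intro self_adjoint_eigenvector[OF g M M0]) (use adj in auto)
  then show ?thesis by blast
qed

text \<open>If \<open>x\<close> and \<open>y\<close> do not commute, then by invariance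
  \<open>w = br x y\<close> is orthogonal to both, so the three form a basis of \<open>L\<close>,
  whose dimension is at most 3. As \<open>br x w\<close> is orthogonal to \<open>w\<close>, it has
  no \<open>w\<close>-component. This turns rank one into an equation that can be tested on two
  generators.\<close>

lemma lie_rank_one_double_bracket:
  fixes br :: "'a::euclidean_space \<Rightarrow> 'a \<Rightarrow> 'a"
  assumes bil: "bilinear br" and L: "subspace L"
    and closed: "\<And>x y. x \<in> L \<Longrightarrow> y \<in> L \<Longrightarrow> br x y \<in> L"
    and alt: "\<And>x. x \<in> L \<Longrightarrow> br x x = 0"
    and jac: "\<And>x y z. x \<in> L \<Longrightarrow> y \<in> L \<Longrightarrow> z \<in> L \<Longrightarrow> br x (br y z) = br (br x y) z + br y (br x z)"
    and inv: "\<And>x y z. x \<in> L \<Longrightarrow> y \<in> L \<Longrightarrow> z \<in> L \<Longrightarrow> br x y \<bullet> z = - (y \<bullet> br x z)"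
    and rank: "\<And>x y. x \<in> L \<Longrightarrow> y \<in> L \<Longrightarrow> x \<noteq> 0 \<Longrightarrow> br x y = 0 \<Longrightarrow> \<exists>c. y = c *\<^sub>R x"
    and xy: "x \<in> L" "y \<in> L"
  shows "\<exists>\<alpha> \<beta>. br x (br x y) = \<alpha> *\<^sub>R x + \<beta> *\<^sub>R y"
proof (cases "br x y = 0")
  case True
  then show ?thesis by (intro exI[of _ 0]) (simp add: bilinear_rzero[OF bil])
next
  case False
  define w where "w = br x y"
  have w: "w \<in> L" "w \<noteq> 0" using closed xy False by (auto simp: w_def)
  have wx: "w \<bullet> x = 0" using inv[OF xy(1,2,1)] alt[OF xy(1)] by (simp add: w_def)
  have wy: "w \<bullet> y = 0" using inv[OF xy(1,2,2)] by (simp add: w_def inner_commute)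
  have "x \<noteq> 0" using False bilinear_lzero[OF bil] by auto
  moreover have "y \<notin> span {x}"
    using False alt[OF xy(1)] bilinear_rmul[OF bil] by (auto simp: span_singleton)
  moreover have "w \<notin> span {y, x}"
  proof
    assume "w \<in> span {y, x}"
    then have "orthogonal w w"
      by (rule orthogonal_to_span) (use wx wy in \<open>auto simp: orthogonal_def\<close>)
    then show False using w by (simp add: orthogonal_self)
  qed
  moreover have "br x w \<in> span {w, y, x}"
  proof (rule ccontr)
    assume n: "br x w \<notin> span {w, y, x}"
    with calculation have ind: "independent {br x w, w, y, x}"
      by (simp add: independent_insert)
    moreover have "card {br x w, w, y, x} = 4"
      using \<open>y \<notin> span {x}\<close> \<open>w \<notin> span {y, x}\<close> n
      by (auto simp: card_insert_if span_base)
    moreover have "{br x w, w, y, x} \<subseteq> L" using closed xy w by auto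
    ultimately have "4 \<le> dim L"
      by (metis dim_eq_card_independent dim_subset)
    moreover have "dim L \<le> 3"
      by (rule lie_rank_one_dim_le_3[OF bil L closed alt jac inv rank])
    ultimately show False by simp
  qed
  ultimately obtain \<gamma> \<beta> \<alpha> where e: "br x w = \<gamma> *\<^sub>R w + \<beta> *\<^sub>R y + \<alpha> *\<^sub>R x"
    by (auto simp: span_insert algebra_simps)
  have "br x w \<bullet> w = 0" using inv[OF xy(1) w(1) w(1)] by (simp add: inner_commute)
  then have "\<gamma> = 0" using w wx wy by (simp add: e inner_add_left inner_commute[of x w] inner_commute[of y w])
  then show ?thesis using e by (auto simp: w_def add.commute)
qed

section \<open>Octonions\<close>

lemma omult_nth:
  "(x \<odot> y) $ 0 = x$0*y$0 - x$1*y$1 - x$2*y$2 - x$3*y$3 - x$4*y$4 - x$5*y$5 - x$6*y$6 - x$7*y$7"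
  "(x \<odot> y) $ 1 = x$0*y$1 + x$1*y$0 + x$2*y$3 - x$3*y$2 + x$4*y$5 - x$5*y$4 + x$7*y$6 - x$6*y$7"
  "(x \<odot> y) $ 2 = x$0*y$2 + x$2*y$0 + x$3*y$1 - x$1*y$3 + x$4*y$6 - x$6*y$4 + x$5*y$7 - x$7*y$5"
  "(x \<odot> y) $ 3 = x$0*y$3 + x$3*y$0 + x$1*y$2 - x$2*y$1 + x$4*y$7 - x$7*y$4 + x$6*y$5 - x$5*y$6"
  "(x \<odot> y) $ 4 = x$0*y$4 + x$4*y$0 + x$5*y$1 - x$1*y$5 + x$6*y$2 - x$2*y$6 + x$7*y$3 - x$3*y$7"
  "(x \<odot> y) $ 5 = x$0*y$5 + x$5*y$0 + x$1*y$4 - x$4*y$1 + x$7*y$2 - x$2*y$7 + x$3*y$6 - x$6*y$3"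
  "(x \<odot> y) $ 6 = x$0*y$6 + x$6*y$0 + x$1*y$7 - x$7*y$1 + x$2*y$4 - x$4*y$2 + x$5*y$3 - x$3*y$5"
  "(x \<odot> y) $ 7 = x$0*y$7 + x$7*y$0 + x$6*y$1 - x$1*y$6 + x$2*y$5 - x$5*y$2 + x$3*y$4 - x$4*y$3"
  unfolding omult_def sum_8
  by (simp_all only: sum_component unit_mult_0 unit_mult_table)
     (simp_all add: oe_def axis_def unit_mult_0)

lemmas omult_bilinear =
  bilinear_ladd[OF bilinear_omult] bilinear_radd[OF bilinear_omult]
  bilinear_lmul[OF bilinear_omult] bilinear_rmul[OF bilinear_omult]
  bilinear_lneg[OF bilinear_omult] bilinear_rneg[OF bilinear_omult]
  bilinear_lsub[OF bilinear_omult] bilinear_rsub[OF bilinear_omult]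
  bilinear_lzero[OF bilinear_omult] bilinear_rzero[OF bilinear_omult]

lemma oct_eq_iff: "(x :: oct) = y \<longleftrightarrow> x$0 = y$0 \<and> x$1 = y$1 \<and> x$2 = y$2 \<and> x$3 = y$3
    \<and> x$4 = y$4 \<and> x$5 = y$5 \<and> x$6 = y$6 \<and> x$7 = y$7"
  by (simp add: vec_eq_iff forall_8)

lemma oct_inner: "(x :: oct) \<bullet> y = x$0*y$0 + x$1*y$1 + x$2*y$2 + x$3*y$3 + x$4*y$4 + x$5*y$5
    + x$6*y$6 + x$7*y$7"
  by (simp add: inner_vec_def sum_8)

lemma oe_nth [simp]: "oe i $ j = (if i = j then 1 else 0)"
  by (auto simp: oe_def axis_def)

lemma omult_one [simp]: "oe 0 \<odot> x = x" "x \<odot> oe 0 = x"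
  by (simp_all add: oct_eq_iff omult_nth)

lemma oct_eq_sum:
  "(x :: oct) = x$0 *\<^sub>R oe 0 + x$1 *\<^sub>R oe 1 + x$2 *\<^sub>R oe 2 + x$3 *\<^sub>R oe 3
     + x$4 *\<^sub>R oe 4 + x$5 *\<^sub>R oe 5 + x$6 *\<^sub>R oe 6 + x$7 *\<^sub>R oe 7"
  by (simp add: oct_eq_iff)

lemma imag_anticommute:
  assumes "x$0 = 0" "y$0 = 0" "x \<bullet> y = 0"
  shows "y \<odot> x = - (x \<odot> y)"
  using assms by (simp add: oct_eq_iff omult_nth oct_inner algebra_simps)

text \<open>The polarised alternative law; with its right-handed twin it replaces associativity in
  \<open>adapted_automorphism\<close>.\<close>

lemma imag_left_alternative:
  assumes "x$0 = 0" "y$0 = 0"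
  shows "x \<odot> (y \<odot> z) + y \<odot> (x \<odot> z) = (- 2 * (x \<bullet> y)) *\<^sub>R z"
  using assms by (simp add: oct_eq_iff omult_nth oct_inner algebra_simps)

lemma imag_right_alternative:
  assumes "x$0 = 0" "y$0 = 0"
  shows "(z \<odot> x) \<odot> y + (z \<odot> y) \<odot> x = (- 2 * (x \<bullet> y)) *\<^sub>R z"
  using assms by (simp add: oct_eq_iff omult_nth oct_inner algebra_simps)

lemma imag_square: "x$0 = 0 \<Longrightarrow> x \<odot> x = - (x \<bullet> x) *\<^sub>R oe 0"
  by (simp add: oct_eq_iff omult_nth oct_inner algebra_simps)

lemma imag_omult_adjoint:
  assumes "x$0 = 0"
  shows "(x \<odot> y) \<bullet> z = - (y \<bullet> (x \<odot> z))" "(y \<odot> x) \<bullet> z = - (y \<bullet> (z \<odot> x))"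
  using assms by (simp_all add: omult_nth oct_inner algebra_simps)

lemma imag_omult_twice:
  assumes "x$0 = 0"
  shows "x \<odot> (x \<odot> z) = - (x \<bullet> x) *\<^sub>R z" "(z \<odot> x) \<odot> x = - (x \<bullet> x) *\<^sub>R z"
proof -
  have "x \<odot> (x \<odot> z) = (1/2) *\<^sub>R (x \<odot> (x \<odot> z) + x \<odot> (x \<odot> z))" by simp
  also have "\<dots> = - (x \<bullet> x) *\<^sub>R z"
    unfolding imag_left_alternative[OF assms assms] by simp
  finally show "x \<odot> (x \<odot> z) = - (x \<bullet> x) *\<^sub>R z" .
  have "(z \<odot> x) \<odot> x = (1/2) *\<^sub>R ((z \<odot> x) \<odot> x + (z \<odot> x) \<odot> x)" by simp
  also have "\<dots> = - (x \<bullet> x) *\<^sub>R z"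
    unfolding imag_right_alternative[OF assms assms] by simp
  finally show "(z \<odot> x) \<odot> x = - (x \<bullet> x) *\<^sub>R z" .
qed

lemma inner_omult:
  assumes "x$0 = 0"
  shows "(x \<odot> y) \<bullet> (x \<odot> z) = (x \<bullet> x) * (y \<bullet> z)" "(y \<odot> x) \<bullet> (z \<odot> x) = (x \<bullet> x) * (y \<bullet> z)"
  by (simp_all add: imag_omult_adjoint[OF assms] imag_omult_twice[OF assms])

lemma imag_omult_orthogonal:
  assumes "x$0 = 0" "y$0 = 0"
  shows "(x \<odot> y) \<bullet> x = 0" "(x \<odot> y) \<bullet> y = 0"
  using assms by (simp_all add: omult_nth oct_inner algebra_simps)

lemma imag_omult_real_part: "x$0 = 0 \<Longrightarrow> (x \<odot> y)$0 = - (x \<bullet> y)"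
  by (simp add: omult_nth oct_inner)

lemma oct_bilinear_eqI:
  fixes F G :: "oct \<Rightarrow> oct \<Rightarrow> 'b::real_vector"
  assumes "bilinear F" "bilinear G" "\<forall>i j. F (oe i) (oe j) = G (oe i) (oe j)"
  shows "F = G"
  using assms by (intro bilinear_eq_stdbasis) (auto simp: Basis_vec_def oe_def)

text \<open>Such a triple generates the octonions, and the alternative laws force the standard
  multiplication table on the seven units built from it. Mapping the standard units to these is
  therefore multiplicative.\<close>

lemma adapted_automorphism:
  assumes im: "f1$0 = 0" "f2$0 = 0" "f4$0 = 0"
    and nrm: "f1 \<bullet> f1 = 1" "f2 \<bullet> f2 = 1" "f4 \<bullet> f4 = 1"
    and ort: "f1 \<bullet> f2 = 0" "f1 \<bullet> f4 = 0" "f2 \<bullet> f4 = 0" "(f1 \<odot> f2) \<bullet> f4 = 0"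
  shows "\<exists>g. linear g \<and> (\<forall>x y. g (x \<odot> y) = g x \<odot> g y) \<and> (\<forall>x y. g x \<bullet> g y = x \<bullet> y)
    \<and> g (oe 1) = f1 \<and> g (oe 2) = f2 \<and> g (oe 4) = f4"
proof -
  \<comment> \<open>The remaining units follow the oriented triples (123), (145), (246) and
    (347).\<close>
  define f3 f5 f6 where "f3 = f1 \<odot> f2" and "f5 = f1 \<odot> f4" and "f6 = f2 \<odot> f4"
  define f7 where "f7 = f3 \<odot> f4"
  note fd = f3_def f5_def f6_def f7_def
  have o34: "f3 \<bullet> f4 = 0" using ort by (simp add: f3_def)
  have im': "f3$0 = 0" "f5$0 = 0" "f6$0 = 0" "f7$0 = 0"
    using im ort o34 by (simp_all add: fd imag_omult_real_part)
  have nrm': "f3 \<bullet> f3 = 1" "f5 \<bullet> f5 = 1" "f6 \<bullet> f6 = 1" "f7 \<bullet> f7 = 1"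
    using nrm by (simp_all add: fd inner_omult im o34)
  note im = im im' and nrm = nrm nrm'
  have la: "x \<odot> (y \<odot> z) = - (y \<odot> (x \<odot> z))" if "x$0 = 0" "y$0 = 0" "x \<bullet> y = 0" for x y z
    using imag_left_alternative[of x y z] that by (simp add: add_eq_0_iff2)
  have ra: "(z \<odot> x) \<odot> y = - ((z \<odot> y) \<odot> x)" if "x$0 = 0" "y$0 = 0" "x \<bullet> y = 0" for x y z
    using imag_right_alternative[of x y z] that by (simp add: add_eq_0_iff2)
  have ll: "x \<odot> (x \<odot> z) = - z" and rr: "(z \<odot> x) \<odot> x = - z" if "x$0 = 0" "x \<bullet> x = 1" for x z
    using imag_omult_twice[of x z] that by simp_all
  have sq: "f1 \<odot> f1 = - oe 0" "f2 \<odot> f2 = - oe 0" "f3 \<odot> f3 = - oe 0" "f4 \<odot> f4 = - oe 0"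
    "f5 \<odot> f5 = - oe 0" "f6 \<odot> f6 = - oe 0" "f7 \<odot> f7 = - oe 0"
    using im nrm by (simp_all add: imag_square)
  \<comment> \<open>The facts \<open>oij\<close> and \<open>pij\<close> are the orthogonality and
    the product of \<open>fi\<close> and \<open>fj\<close>. Each product needs one alternative law
    or the anticommutation of orthogonal imaginary elements, which is why orthogonality is
    established alongside.\<close>
  have o13: "f1 \<bullet> f3 = 0" and o23: "f2 \<bullet> f3 = 0" and o15: "f1 \<bullet> f5 = 0" and o45: "f4 \<bullet> f5 = 0"
    and o26: "f2 \<bullet> f6 = 0" and o46: "f4 \<bullet> f6 = 0" and o37: "f3 \<bullet> f7 = 0" and o47: "f4 \<bullet> f7 = 0"
    using im imag_omult_orthogonal by (simp_all add: fd inner_commute)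
  have p12: "f1 \<odot> f2 = f3" and p14: "f1 \<odot> f4 = f5" and p24: "f2 \<odot> f4 = f6" and p34: "f3 \<odot> f4 = f7"
    by (simp_all add: fd)
  have p21: "f2 \<odot> f1 = - f3" using imag_anticommute[of f1 f2] im ort p12 by simp
  have p13: "f1 \<odot> f3 = - f2" using ll[of f1 f2] im nrm p12 by simp
  have p31: "f3 \<odot> f1 = f2" using imag_anticommute[of f1 f3] im o13 p13 by simp
  have p32: "f3 \<odot> f2 = - f1" using rr[of f2 f1] im nrm p12 by simp
  have p23: "f2 \<odot> f3 = f1" using imag_anticommute[of f3 f2] im o23 p32 by (simp add: inner_commute)
  have o25: "f2 \<bullet> f5 = 0" using imag_omult_adjoint(1)[of f1 f4 f2] im o34 p12
    by (simp add: f5_def inner_commute)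
  have o16: "f1 \<bullet> f6 = 0" using imag_omult_adjoint(1)[of f2 f4 f1] im o34 p21
    by (simp add: f6_def inner_commute)
  have o17: "f1 \<bullet> f7 = 0" using imag_omult_adjoint(1)[of f3 f4 f1] im ort p31
    by (simp add: f7_def inner_commute)
  have o27: "f2 \<bullet> f7 = 0" using imag_omult_adjoint(1)[of f3 f4 f2] im ort p32
    by (simp add: f7_def inner_commute)
  have o35: "f3 \<bullet> f5 = 0" using inner_omult(1)[of f1 f2 f4] im ort by (simp add: fd)
  have o36: "f3 \<bullet> f6 = 0" using inner_omult(1)[of f2 f1 f4] im ort p21 by (simp add: f6_def)
  have o56: "f5 \<bullet> f6 = 0" using inner_omult(2)[of f4 f1 f2] im ort by (simp add: fd)
  have o57: "f5 \<bullet> f7 = 0" using inner_omult(2)[of f4 f1 f3] im o13 by (simp add: f5_def f7_def)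
  have o67: "f6 \<bullet> f7 = 0" using inner_omult(2)[of f4 f2 f3] im o23 by (simp add: f6_def f7_def)
  have p15: "f1 \<odot> f5 = - f4" using ll[of f1 f4] im nrm p14 by simp
  have p26: "f2 \<odot> f6 = - f4" using ll[of f2 f4] im nrm p24 by simp
  have p37: "f3 \<odot> f7 = - f4" using ll[of f3 f4] im nrm p34 by simp
  have p54: "f5 \<odot> f4 = - f1" using rr[of f4 f1] im nrm p14 by simp
  have p64: "f6 \<odot> f4 = - f2" using rr[of f4 f2] im nrm p24 by simp
  have p74: "f7 \<odot> f4 = - f3" using rr[of f4 f3] im nrm p34 by simp
  have p52: "f5 \<odot> f2 = - f7" using ra[of f4 f2 f1] im ort p12 p14 p34 by (simp add: inner_commute)
  have p25: "f2 \<odot> f5 = f7" using imag_anticommute[of f5 f2] im o25 p52 by (simp add: inner_commute)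
  have p16: "f1 \<odot> f6 = - f7" using la[of f1 f2 f4] im ort p24 p14 p25 by simp
  have p17: "f1 \<odot> f7 = f6" using ll[of f1 f6] im nrm p16 by (simp add: omult_bilinear)
  have p27: "f2 \<odot> f7 = - f5" using ll[of f2 f5] im nrm p25 by simp
  have p35: "f3 \<odot> f5 = - f6" using la[of f3 f1 f4] im o13 p14 p34 p17 by (simp add: inner_commute)
  have p36: "f3 \<odot> f6 = f5" using la[of f3 f2 f4] im o23 p24 p34 p27 by (simp add: inner_commute)
  have neg: "y \<odot> x = - (x \<odot> y)" if "x$0 = 0" "y$0 = 0" "x \<bullet> y = 0" for x y
    using imag_anticommute that by blast
  have p41: "f4 \<odot> f1 = - f5" using neg[of f1 f4] im ort p14 by simp
  have p42: "f4 \<odot> f2 = - f6" using neg[of f2 f4] im ort p24 by simp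
  have p43: "f4 \<odot> f3 = - f7" using neg[of f3 f4] im o34 p34 by simp
  have p45: "f4 \<odot> f5 = f1" using neg[of f5 f4] im o45 p54 by (simp add: inner_commute)
  have p46: "f4 \<odot> f6 = f2" using neg[of f6 f4] im o46 p64 by (simp add: inner_commute)
  have p47: "f4 \<odot> f7 = f3" using neg[of f7 f4] im o47 p74 by (simp add: inner_commute)
  have p51: "f5 \<odot> f1 = f4" using neg[of f1 f5] im o15 p15 by simp
  have p53: "f5 \<odot> f3 = f6" using neg[of f3 f5] im o35 p35 by simp
  have p56: "f5 \<odot> f6 = - f3" using la[of f5 f2 f4] im o25 p24 p54 p21
    by (simp add: inner_commute omult_bilinear)
  have p57: "f5 \<odot> f7 = f2" using la[of f5 f3 f4] im o35 p34 p54 p31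
    by (simp add: inner_commute omult_bilinear)
  have p61: "f6 \<odot> f1 = f7" using neg[of f1 f6] im o16 p16 by simp
  have p62: "f6 \<odot> f2 = f4" using neg[of f2 f6] im o26 p26 by simp
  have p63: "f6 \<odot> f3 = - f5" using neg[of f3 f6] im o36 p36 by simp
  have p65: "f6 \<odot> f5 = f3" using neg[of f5 f6] im o56 p56 by simp
  have p67: "f6 \<odot> f7 = - f1" using la[of f6 f3 f4] im o36 p34 p64 p32
    by (simp add: inner_commute omult_bilinear)
  have p71: "f7 \<odot> f1 = - f6" using neg[of f1 f7] im o17 p17 by simp
  have p72: "f7 \<odot> f2 = f5" using neg[of f2 f7] im o27 p27 by simp
  have p73: "f7 \<odot> f3 = f4" using neg[of f3 f7] im o37 p37 by simp
  have p75: "f7 \<odot> f5 = - f2" using neg[of f5 f7] im o57 p57 by simp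
  have p76: "f7 \<odot> f6 = f1" using neg[of f6 f7] im o67 p67 by simp
  note tab = sq p12 p13 p14 p15 p16 p17 p21 p23 p24 p25 p26 p27 p31 p32 p34 p35 p36 p37
    p41 p42 p43 p45 p46 p47 p51 p52 p53 p54 p56 p57 p61 p62 p63 p64 p65 p67 p71 p72 p73 p74 p75 p76
  define g where "g x = x$0 *\<^sub>R oe 0 + x$1 *\<^sub>R f1 + x$2 *\<^sub>R f2 + x$3 *\<^sub>R f3
     + x$4 *\<^sub>R f4 + x$5 *\<^sub>R f5 + x$6 *\<^sub>R f6 + x$7 *\<^sub>R f7" for x :: oct
  have lin: "linear g"
    by (rule linearI) (simp_all add: g_def algebra_simps)
  note l = linear_add[OF lin] linear_cmul[OF lin] linear_neg[OF lin]
  have g_oe: "g (oe 0) = oe 0" "g (oe 1) = f1" "g (oe 2) = f2" "g (oe 3) = f3" "g (oe 4) = f4"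
    "g (oe 5) = f5" "g (oe 6) = f6" "g (oe 7) = f7"
    by (simp_all add: g_def)
  have "(\<lambda>x y. g (x \<odot> y)) = (\<lambda>x y. g x \<odot> g y)"
  proof (rule oct_bilinear_eqI)
    show "bilinear (\<lambda>x y. g (x \<odot> y))" "bilinear (\<lambda>x y. g x \<odot> g y)"
      unfolding bilinear_def by (auto intro!: linearI simp: l omult_bilinear)
    show "\<forall>i j. g (oe i \<odot> oe j) = g (oe i) \<odot> g (oe j)"
      unfolding forall_8 by (simp add: omult_oe unit_mult_0 unit_mult_table l g_oe tab)
  qed
  moreover have "(\<lambda>x y. g x \<bullet> g y) = (\<lambda>x y. x \<bullet> y)"
  proof (rule oct_bilinear_eqI)
    show "bilinear (\<lambda>x y. g x \<bullet> g y)" "bilinear (\<lambda>x y :: oct. x \<bullet> y)"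
      unfolding bilinear_def by (auto intro!: linearI simp: l inner_add_left inner_add_right)
    have i0: "oe 0 \<bullet> z = z $ 0" "z \<bullet> oe 0 = z $ 0" for z :: oct
      by (simp_all add: oct_inner)
    note oo = ort(1-3) o34 o13 o23 o15 o45 o26 o46 o37 o47 o25 o16 o17 o27 o35 o36 o56 o57 o67
    show "\<forall>i j. g (oe i) \<bullet> g (oe j) = oe i \<bullet> oe j"
      unfolding forall_8 g_oe using oo oo[THEN trans[OF inner_commute]]
      by (simp add: i0 im nrm oct_inner[of "oe _" "oe _"])
  qed
  ultimately have "g (x \<odot> y) = g x \<odot> g y" "g x \<bullet> g y = x \<bullet> y" for x y
    by meson+
  with lin g_oe show ?thesis
    by (intro exI[of _ g]) simp
qed

section \<open>Coordinates on the derivation algebra\<close>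

text \<open>The sign at \<open>oe 7\<close> is due to the triple (176):
  \<open>oe 1 \<odot> oe 6 = - oe 7\<close>, so left multiplication by \<open>oe 1\<close> acts as
  \<open>\<i>\<close> on all three complex coordinates.\<close>

definition vv :: "real \<Rightarrow> complex \<Rightarrow> complex \<Rightarrow> complex \<Rightarrow> oct" where
  "vv r w1 w2 w3 = r *\<^sub>R oe 1 + Re w1 *\<^sub>R oe 2 + Im w1 *\<^sub>R oe 3 + Re w2 *\<^sub>R oe 4 + Im w2 *\<^sub>R oe 5
     + Re w3 *\<^sub>R oe 6 - Im w3 *\<^sub>R oe 7"

lemma vv_nth [simp]:
  "vv r w1 w2 w3 $ 0 = 0" "vv r w1 w2 w3 $ 1 = r" "vv r w1 w2 w3 $ 2 = Re w1"
  "vv r w1 w2 w3 $ 3 = Im w1" "vv r w1 w2 w3 $ 4 = Re w2" "vv r w1 w2 w3 $ 5 = Im w2"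
  "vv r w1 w2 w3 $ 6 = Re w3" "vv r w1 w2 w3 $ 7 = - Im w3"
  by (simp_all add: vv_def)

lemma imag_eq_vv:
  "x$0 = 0 \<Longrightarrow> x = vv (x$1) (Complex (x$2) (x$3)) (Complex (x$4) (x$5)) (Complex (x$6) (- x$7))"
  by (simp add: oct_eq_iff)

lemma vv_eq_iff [simp]:
  "vv r w1 w2 w3 = vv r' w1' w2' w3' \<longleftrightarrow> r = r' \<and> w1 = w1' \<and> w2 = w2' \<and> w3 = w3'"
  by (auto simp: oct_eq_iff complex_eq_iff)

lemma vv_eq_0_iff [simp]: "vv r w1 w2 w3 = 0 \<longleftrightarrow> r = 0 \<and> w1 = 0 \<and> w2 = 0 \<and> w3 = 0"
  by (auto simp: oct_eq_iff complex_eq_iff)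

lemma vv_linear:
  "vv r w1 w2 w3 + vv r' w1' w2' w3' = vv (r + r') (w1 + w1') (w2 + w2') (w3 + w3')"
  "vv r w1 w2 w3 - vv r' w1' w2' w3' = vv (r - r') (w1 - w1') (w2 - w2') (w3 - w3')"
  "c *\<^sub>R vv r w1 w2 w3 = vv (c * r) (c * w1) (c * w2) (c * w3)"
  "- vv r w1 w2 w3 = vv (- r) (- w1) (- w2) (- w3)"
  by (simp_all add: oct_eq_iff)

lemma S_vv: "S (vv r w1 w2 w3) = vv r w2 w1 (- w3)"
  by (simp add: oct_eq_iff S_nth)

lemma oe_eq_vv: "oe 1 = vv 1 0 0 0" "oe 2 = vv 0 1 0 0" "oe 3 = vv 0 \<i> 0 0" "oe 4 = vv 0 0 1 0"
  "oe 5 = vv 0 0 \<i> 0" "oe 6 = vv 0 0 0 1" "oe 7 = vv 0 0 0 (- \<i>)"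
  by (simp_all add: oct_eq_iff)

text \<open>The product on the real line plus complex 3-space consists of the Hermitian form and the
  conjugate of the complex cross product; both are preserved by the group SU(3) fixing
  \<open>oe 1\<close>.\<close>

lemma omult_vv:
  "vv r w1 w2 w3 \<odot> vv r' w1' w2' w3' =
    - (r * r' + Re (cnj w1 * w1' + cnj w2 * w2' + cnj w3 * w3')) *\<^sub>R oe 0
    + vv (Im (cnj w1 * w1' + cnj w2 * w2' + cnj w3 * w3'))
       (\<i> * (r * w1' - r' * w1) + cnj (w2 * w3' - w3 * w2'))
       (\<i> * (r * w2' - r' * w2) + cnj (w3 * w1' - w1 * w3'))
       (\<i> * (r * w3' - r' * w3) + cnj (w1 * w2' - w2 * w1'))"
  by (simp add: oct_eq_iff omult_nth algebra_simps)

text \<open>The factor 1/2 is forced by the Leibniz rule for \<open>oe 1 \<odot> w\<close>: with an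
  unknown factor \<kappa> in front of \<open>\<i> * cnj\<close> of the cross product of z and w, the
  conjugate-linear terms give \<kappa> = 1 - \<kappa>.\<close>

definition der_fun ::
    "real \<Rightarrow> real \<Rightarrow> complex \<Rightarrow> complex \<Rightarrow> complex \<Rightarrow> complex \<Rightarrow> complex \<Rightarrow> complex
      \<Rightarrow> real \<Rightarrow> complex \<Rightarrow> complex \<Rightarrow> complex \<Rightarrow> oct" where
  "der_fun s t A B C z1 z2 z3 r w1 w2 w3 =
     vv (- Re (cnj z1 * w1 + cnj z2 * w2 + cnj z3 * w3))
        (r * z1 + \<i> * s * w1 - cnj A * w2 - cnj B * w3 + \<i> / 2 * cnj (z2 * w3 - z3 * w2))
        (r * z2 + A * w1 + \<i> * t * w2 - cnj C * w3 + \<i> / 2 * cnj (z3 * w1 - z1 * w3))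
        (r * z3 + B * w1 + C * w2 - \<i> * (s + t) * w3 + \<i> / 2 * cnj (z1 * w2 - z2 * w1))"

text \<open>
  Left multiplication by \<open>oe 1\<close> makes the span of \<open>oe 2, \<dots>, oe 7\<close> a complex vector space with basis
  \<open>oe 2, oe 4, oe 6\<close>, and \<open>g\<^sub>2 = su(3) \<oplus> \<complex>\<^sup>3\<close>. In \<open>der s t A B C z1 z2 z3\<close> the skew-Hermitian
  matrix has diagonal \<open>\<i>s, \<i>t, -\<i>(s+t)\<close> and subdiagonal entries \<open>A\<close> (21), \<open>B\<close> (31), \<open>C\<close> (32);
  the vector \<open>(z1, z2, z3)\<close> is the image of \<open>oe 1\<close>.
\<close>

definition der ::
    "real \<Rightarrow> real \<Rightarrow> complex \<Rightarrow> complex \<Rightarrow> complex \<Rightarrow> complex \<Rightarrow> complex \<Rightarrow> complex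
      \<Rightarrow> (oct \<Rightarrow>\<^sub>L oct)" where
  "der s t A B C z1 z2 z3 = Blinfun (\<lambda>x. der_fun s t A B C z1 z2 z3 (x$1) (Complex (x$2) (x$3))
     (Complex (x$4) (x$5)) (Complex (x$6) (- x$7)))"

lemma der_apply:
  "blinfun_apply (der s t A B C z1 z2 z3) x = der_fun s t A B C z1 z2 z3 (x$1) (Complex (x$2) (x$3))
     (Complex (x$4) (x$5)) (Complex (x$6) (- x$7))"
proof -
  have "linear (\<lambda>x :: oct. der_fun s t A B C z1 z2 z3 (x$1) (Complex (x$2) (x$3))
     (Complex (x$4) (x$5)) (Complex (x$6) (- x$7)))"
    by (rule linearI)
       (simp_all add: der_fun_def oct_eq_iff algebra_simps add_divide_distrib diff_divide_distrib)
  then show ?thesis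
    unfolding der_def by (simp add: bounded_linear_Blinfun_apply linear_conv_bounded_linear)
qed

lemma der_vv:
  "blinfun_apply (der s t A B C z1 z2 z3) (vv r w1 w2 w3) = der_fun s t A B C z1 z2 z3 r w1 w2 w3"
  by (simp add: der_apply)

lemma der_oe0 [simp]: "blinfun_apply (der s t A B C z1 z2 z3) (oe 0) = 0"
  by (simp add: der_apply der_fun_def complex_eq_iff)

section \<open>Derivations are skew and have fourteen real parameters\<close>

lemma g2_D: "X \<in> g2 \<Longrightarrow> blinfun_apply X (x \<odot> y) = blinfun_apply X x \<odot> y + x \<odot> blinfun_apply X y"
  by (simp add: g2_def)

lemma der_in_g2: "der s t A B C z1 z2 z3 \<in> g2"
proof -
  let ?X = "blinfun_apply (der s t A B C z1 z2 z3)"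
  have "(\<lambda>x y. ?X (x \<odot> y)) = (\<lambda>x y. ?X x \<odot> y + x \<odot> ?X y)"
  proof (rule oct_bilinear_eqI)
    show "bilinear (\<lambda>x y. ?X (x \<odot> y))" "bilinear (\<lambda>x y. ?X x \<odot> y + x \<odot> ?X y)"
      unfolding bilinear_def
      by (auto intro!: linearI simp: omult_bilinear blinfun.bilinear_simps algebra_simps)
    show "\<forall>i j. ?X (oe i \<odot> oe j) = ?X (oe i) \<odot> oe j + oe i \<odot> ?X (oe j)"
      unfolding forall_8 omult_oe unit_mult_0 unit_mult_table blinfun.minus_right der_oe0 omult_one
      by (simp only: oe_eq_vv der_vv der_fun_def omult_vv vv_linear omult_bilinear)
         (simp add: oct_eq_iff)
  qed
  then show ?thesis
    unfolding g2_def by (auto dest: fun_cong)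
qed

lemma g2_one: "X \<in> g2 \<Longrightarrow> blinfun_apply X (oe 0) = 0"
  using g2_D[of X "oe 0" "oe 0"] by simp

text \<open>Both facts come from applying \<open>X\<close> to \<open>y \<odot> y\<close>, a multiple
  of \<open>oe 0\<close>, for imaginary \<open>y\<close>: the imaginary part of the result says that
  \<open>X y\<close> has no real part, the real part says that \<open>X y\<close> is orthogonal to
  \<open>y\<close>.\<close>

lemma g2_imag:
  assumes X: "X \<in> g2"
  shows "blinfun_apply X x $ 0 = 0" and g2_skew: "blinfun_apply X x \<bullet> x = 0"
proof -
  have *: "blinfun_apply X y $ 0 = 0 \<and> blinfun_apply X y \<bullet> y = 0" if y: "y$0 = 0" for y
  proof (cases "y = 0")
    case False
    have "blinfun_apply X (y \<odot> y) = 0"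
      using g2_one[OF X] by (simp add: imag_square[OF y] blinfun.bilinear_simps)
    then have e: "blinfun_apply X y \<odot> y + y \<odot> blinfun_apply X y = 0"
      using g2_D[OF X, of y y] by simp
    from e y have "blinfun_apply X y $ 0 *\<^sub>R y = 0"
      unfolding oct_eq_iff by (simp add: omult_nth algebra_simps)
    then have "blinfun_apply X y $ 0 = 0" using False by simp
    moreover from e have "(blinfun_apply X y \<odot> y + y \<odot> blinfun_apply X y) $ 0 = 0" by simp
    then have "blinfun_apply X y \<bullet> y = 0"
      using y by (simp add: omult_nth oct_inner algebra_simps)
    ultimately show ?thesis by simp
  qed (simp add: blinfun.zero_right)
  let ?y = "x - x$0 *\<^sub>R oe 0"
  have "?y $ 0 = 0" by simp
  from *[OF this] have "blinfun_apply X x $ 0 = 0" "blinfun_apply X x \<bullet> ?y = 0"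
    by (simp_all add: blinfun.bilinear_simps g2_one[OF X])
  then show "blinfun_apply X x $ 0 = 0" "blinfun_apply X x \<bullet> x = 0"
    by (simp_all add: oct_inner)
qed

lemma g2_adjoint: "X \<in> g2 \<Longrightarrow> blinfun_apply X x \<bullet> y = - (x \<bullet> blinfun_apply X y)"
  using skew_swap[of "blinfun_apply X" UNIV x y] g2_skew
  by (simp add: bounded_linear.linear blinfun.bounded_linear_right)

text \<open>The three units generate the octonions. Identities between derivations, such as
  \<open>bracket_der\<close>, reduce to three evaluations in this way.\<close>

lemma g2_eqI:
  assumes X: "X \<in> g2" and Y: "Y \<in> g2"
    and e: "blinfun_apply X (oe 1) = blinfun_apply Y (oe 1)"
      "blinfun_apply X (oe 2) = blinfun_apply Y (oe 2)"
      "blinfun_apply X (oe 4) = blinfun_apply Y (oe 4)"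
  shows "X = Y"
proof -
  have mult: "blinfun_apply X (x \<odot> y) = blinfun_apply Y (x \<odot> y)"
    if "blinfun_apply X x = blinfun_apply Y x" "blinfun_apply X y = blinfun_apply Y y" for x y
    using that by (simp add: g2_D[OF X] g2_D[OF Y])
  have p: "oe 3 = oe 1 \<odot> oe 2" "oe 5 = oe 1 \<odot> oe 4" "oe 6 = oe 2 \<odot> oe 4" "oe 7 = oe 3 \<odot> oe 4"
    by (simp_all add: omult_oe unit_mult_table)
  have e3: "blinfun_apply X (oe 3) = blinfun_apply Y (oe 3)"
    unfolding p(1) by (intro mult e)
  have e': "blinfun_apply X (oe 5) = blinfun_apply Y (oe 5)"
      "blinfun_apply X (oe 6) = blinfun_apply Y (oe 6)"
      "blinfun_apply X (oe 7) = blinfun_apply Y (oe 7)"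
    unfolding p(2-4) by (intro mult e e3)+
  show ?thesis
  proof (rule blinfun_eqI)
    fix x :: oct
    show "blinfun_apply X x = blinfun_apply Y x"
      by (subst (1 2) oct_eq_sum[of x])
         (simp only: blinfun.bilinear_simps e e' e3 g2_one[OF X] g2_one[OF Y])
  qed
qed

text \<open>The parameters are read off from the images of \<open>oe 1\<close>, \<open>oe 2\<close>,
  \<open>oe 4\<close>; in \<open>A\<close>, \<open>B\<close>, \<open>C\<close> the conjugate-linear
  term of \<open>der_fun\<close> is subtracted.\<close>

lemma g2_cases:
  assumes X: "X \<in> g2"
  obtains s t A B C z1 z2 z3 where "X = der s t A B C z1 z2 z3"
proof -
  let ?X = "blinfun_apply X"
  define z1 z2 z3 where "z1 = Complex (?X (oe 1) $ 2) (?X (oe 1) $ 3)"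
    and "z2 = Complex (?X (oe 1) $ 4) (?X (oe 1) $ 5)" and "z3 = Complex (?X (oe 1) $ 6) (- ?X (oe 1) $ 7)"
  define s t where "s = ?X (oe 2) $ 3" and "t = ?X (oe 4) $ 5"
  define A B C where "A = Complex (?X (oe 2) $ 4) (?X (oe 2) $ 5) - \<i> / 2 * cnj z3"
    and "B = Complex (?X (oe 2) $ 6) (- ?X (oe 2) $ 7) + \<i> / 2 * cnj z2"
    and "C = Complex (?X (oe 4) $ 6) (- ?X (oe 4) $ 7) - \<i> / 2 * cnj z1"
  have ent: "x \<bullet> oe i = x $ i" for x :: oct and i
    by (simp add: oe_def inner_axis)
  have sk: "?X (oe j) $ i = - (?X (oe i) $ j)" for i j
    using g2_adjoint[OF X, of "oe j" "oe i"] by (simp add: ent inner_commute[of "oe j"])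
  have diag: "?X (oe i) $ i = 0" for i using sk[of i i] by simp
  \<comment> \<open>The one entry that skewness does not provide comes from the Leibniz rule for
    \<open>oe 3 = oe 1 \<odot> oe 2\<close>.\<close>
  have "?X (oe 3) = ?X (oe 1) \<odot> oe 2 + oe 1 \<odot> ?X (oe 2)"
    using g2_D[OF X, of "oe 1" "oe 2"] by (simp add: omult_oe unit_mult_table)
  then have "?X (oe 3) $ 4 = (?X (oe 1) \<odot> oe 2 + oe 1 \<odot> ?X (oe 2)) $ 4" by simp
  then have e34: "?X (oe 4) $ 3 = - ?X (oe 1) $ 6 + ?X (oe 2) $ 5"
    using sk[of 3 4] by (simp add: omult_nth)
  have "X = der s t A B C z1 z2 z3"
  proof (rule g2_eqI[OF X der_in_g2])
    have im: "?X x $ 0 = 0" for x using g2_imag[OF X] by simp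
    show "?X (oe 1) = blinfun_apply (der s t A B C z1 z2 z3) (oe 1)"
      by (simp add: oct_eq_iff oe_eq_vv(1) der_vv der_fun_def)
         (simp add: im diag z1_def z2_def z3_def flip: oe_eq_vv)
    show "?X (oe 2) = blinfun_apply (der s t A B C z1 z2 z3) (oe 2)"
      by (simp add: oct_eq_iff oe_eq_vv(2) der_vv der_fun_def)
         (simp add: im diag z1_def z2_def z3_def A_def B_def s_def sk[of 2 1] flip: oe_eq_vv)
    show "?X (oe 4) = blinfun_apply (der s t A B C z1 z2 z3) (oe 4)"
      by (simp add: oct_eq_iff oe_eq_vv(4) der_vv der_fun_def)
         (simp add: im diag z1_def z2_def z3_def A_def B_def C_def t_def sk[of 4 1] sk[of 4 2] e34
           flip: oe_eq_vv)
  qed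
  then show ?thesis using that by blast
qed

lemma der_eq_iff [simp]:
  "der s t A B C z1 z2 z3 = der s' t' A' B' C' z1' z2' z3' \<longleftrightarrow>
     s = s' \<and> t = t' \<and> A = A' \<and> B = B' \<and> C = C' \<and> z1 = z1' \<and> z2 = z2' \<and> z3 = z3'"
  (is "?X = ?Y \<longleftrightarrow> _")
proof
  assume eq: "?X = ?Y"
  then have "blinfun_apply ?X (vv 1 0 0 0) = blinfun_apply ?Y (vv 1 0 0 0)" by simp
  then have z: "z1 = z1' \<and> z2 = z2' \<and> z3 = z3'" by (simp add: der_vv der_fun_def)
  from eq have "blinfun_apply ?X (vv 0 1 0 0) = blinfun_apply ?Y (vv 0 1 0 0)"
    "blinfun_apply ?X (vv 0 0 1 0) = blinfun_apply ?Y (vv 0 0 1 0)" by simp_all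
  then have "s = s' \<and> t = t' \<and> A = A' \<and> B = B' \<and> C = C'"
    unfolding der_vv der_fun_def vv_eq_iff using z by simp
  with z show "s = s' \<and> t = t' \<and> A = A' \<and> B = B' \<and> C = C' \<and> z1 = z1' \<and> z2 = z2' \<and> z3 = z3'"
    by simp
qed auto

lemma subspace_g2: "subspace g2"
  by (auto simp: subspace_def g2_def blinfun.bilinear_simps omult_bilinear algebra_simps)

lemma bracket_in_g2:
  assumes X: "X \<in> g2" and Y: "Y \<in> g2"
  shows "bracket X Y \<in> g2"
proof -
  have "blinfun_apply (bracket X Y) (x \<odot> y) =
      blinfun_apply (bracket X Y) x \<odot> y + x \<odot> blinfun_apply (bracket X Y) y" for x y
    by (simp add: bracket_def blinfun.bilinear_simps g2_D[OF X] g2_D[OF Y] omult_bilinear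
        algebra_simps)
  then show ?thesis by (simp add: g2_def)
qed

lemma bracket_apply:
  "blinfun_apply (bracket X Y) x = blinfun_apply X (blinfun_apply Y x) - blinfun_apply Y (blinfun_apply X x)"
  by (simp add: bracket_def blinfun.bilinear_simps)

lemma der_linear:
  "der s t A B C z1 z2 z3 + der s' t' A' B' C' z1' z2' z3' =
     der (s + s') (t + t') (A + A') (B + B') (C + C') (z1 + z1') (z2 + z2') (z3 + z3')"
  "c *\<^sub>R der s t A B C z1 z2 z3 =
     der (c * s) (c * t) (c * A) (c * B) (c * C) (c * z1) (c * z2) (c * z3)"
  by (rule g2_eqI; simp add: subspace_add[OF subspace_g2] subspace_scale[OF subspace_g2] der_in_g2
      oe_eq_vv blinfun.bilinear_simps der_vv der_fun_def vv_linear algebra_simps)+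

lemma der_eq_0_iff [simp]:
  "der s t A B C z1 z2 z3 = 0 \<longleftrightarrow>
     s = 0 \<and> t = 0 \<and> A = 0 \<and> B = 0 \<and> C = 0 \<and> z1 = 0 \<and> z2 = 0 \<and> z3 = 0"
proof -
  have "der 0 0 0 0 0 0 0 0 = 0"
    using der_linear(2)[of 0 0 0 0 0 0 0 0 0] by simp
  then show ?thesis using der_eq_iff[of s t A B C z1 z2 z3 0 0 0 0 0 0 0 0] by simp
qed

text \<open>The bracket of two vectors z, z' has an su(3)-part, with the factors 3/4, 3/2 and 1/2,
  and also a vector part, the conjugate cross product: the decomposition is reductive but not
  symmetric.\<close>

lemma bracket_der:
  "bracket (der s t A B C z1 z2 z3) (der s' t' A' B' C' z1' z2' z3') =
   der
    (2 * Im (A * cnj A') + 2 * Im (B * cnj B') + 3/2 * Im (z1' * cnj z1)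
       - 1/2 * Im (z1' * cnj z1 + z2' * cnj z2 + z3' * cnj z3))
    (2 * Im (A' * cnj A) + 2 * Im (C * cnj C') + 3/2 * Im (z2' * cnj z2)
       - 1/2 * Im (z1' * cnj z1 + z2' * cnj z2 + z3' * cnj z3))
    (\<i> * (s' - t') * A - \<i> * (s - t) * A' - cnj C * B' + cnj C' * B + 3/4 * (z2' * cnj z1 - z2 * cnj z1'))
    (\<i> * (2 * s' + t') * B - \<i> * (2 * s + t) * B' + C * A' - C' * A + 3/4 * (z3' * cnj z1 - z3 * cnj z1'))
    (\<i> * (s' + 2 * t') * C - \<i> * (s + 2 * t) * C' - B * cnj A' + B' * cnj A
       + 3/4 * (z3' * cnj z2 - z3 * cnj z2'))
    (\<i> * s * z1' - cnj A * z2' - cnj B * z3' - (\<i> * s' * z1 - cnj A' * z2 - cnj B' * z3)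
       + \<i> * cnj (z2 * z3' - z3 * z2'))
    (A * z1' + \<i> * t * z2' - cnj C * z3' - (A' * z1 + \<i> * t' * z2 - cnj C' * z3)
       + \<i> * cnj (z3 * z1' - z1 * z3'))
    (B * z1' + C * z2' - \<i> * (s + t) * z3' - (B' * z1 + C' * z2 - \<i> * (s' + t') * z3)
       + \<i> * cnj (z1 * z2' - z2 * z1'))"
  by (rule g2_eqI; (intro bracket_in_g2 der_in_g2)?)
     (simp_all add: oe_eq_vv bracket_apply der_vv der_fun_def vv_linear complex_eq_iff field_simps)

lemma conj_S_in_g2:
  assumes X: "X \<in> g2"
  shows "conj_S X \<in> g2"
proof -
  have m: "S (x \<odot> y) = S x \<odot> S y" for x y
    using S_in_G2 by (simp add: G2_def)
  show ?thesis
    by (simp add: g2_def blinfun_apply_conj_S m g2_D[OF X] linear_add[OF linear_S] S_S)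
qed

text \<open>\<open>S\<close> fixes \<open>oe 1\<close> and acts on the complex coordinates by the
  SU(3)-matrix that exchanges the first two and negates the third, so conjugation only permutes the
  parameters up to sign and conjugation.\<close>

lemma conj_S_der:
  "conj_S (der s t A B C z1 z2 z3) = der t s (- cnj A) (- C) (- B) z2 z1 (- z3)"
  by (rule g2_eqI)
     (simp_all add: conj_S_in_g2 der_in_g2 blinfun_apply_conj_S oe_eq_vv S_vv der_vv der_fun_def algebra_simps)

section \<open>Subalgebras of the derivation algebra\<close>

lemma g2_subalgebraD:
  assumes "g2_subalgebra L"
  shows "X \<in> L \<Longrightarrow> X \<in> g2" "subspace L" "X \<in> L \<Longrightarrow> Y \<in> L \<Longrightarrow> bracket X Y \<in> L"
  using assms by (auto simp: g2_subalgebra_def)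

text \<open>These are the imaginary parts of quaternion subalgebras. Closure is required for
  orthogonal pairs only, because other products have a real part.\<close>

definition assoc_plane :: "oct set \<Rightarrow> bool" where
  "assoc_plane P \<longleftrightarrow> subspace P \<and> dim P = 3 \<and> (\<forall>x\<in>P. x$0 = 0)
     \<and> (\<forall>x\<in>P. \<forall>y\<in>P. x \<bullet> y = 0 \<longrightarrow> x \<odot> y \<in> P)"

lemma inner_vv:
  "vv r w1 w2 w3 \<bullet> vv r' w1' w2' w3' = r * r' + Re (cnj w1 * w1' + cnj w2 * w2' + cnj w3 * w3')"
  by (simp add: oct_inner)

lemma omult_vv_orthogonal:
  assumes "vv r w1 w2 w3 \<bullet> vv r' w1' w2' w3' = 0"
  shows "vv r w1 w2 w3 \<odot> vv r' w1' w2' w3' =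
    vv (Im (cnj w1 * w1' + cnj w2 * w2' + cnj w3 * w3'))
       (\<i> * (r * w1' - r' * w1) + cnj (w2 * w3' - w3 * w2'))
       (\<i> * (r * w2' - r' * w2) + cnj (w3 * w1' - w1 * w3'))
       (\<i> * (r * w3' - r' * w3) + cnj (w1 * w2' - w2 * w1'))"
  using assms unfolding omult_vv inner_vv by simp

lemma assoc_plane_coordinate:
  "assoc_plane (range (\<lambda>(r, w). vv r w 0 0))" (is "assoc_plane ?P1")
  "assoc_plane (range (\<lambda>(r, w). vv r 0 w 0))" (is "assoc_plane ?P2")
  "assoc_plane (range (\<lambda>(r, w). vv r 0 0 w))" (is "assoc_plane ?P3")
proof -
  have plane: "assoc_plane (range (\<lambda>(r, w). f r w))"
    if "linear (\<lambda>(r, w). f r w)" "inj (\<lambda>(r, w). f r w)" "\<And>r w. f r w $ 0 = 0"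
      "\<And>r w r' w'. f r w \<bullet> f r' w' = 0 \<Longrightarrow> f r w \<odot> f r' w' \<in> range (\<lambda>(r, w). f r w)"
    for f :: "real \<Rightarrow> complex \<Rightarrow> oct"
    using that dim_image_eq[of "\<lambda>(r, w). f r w" UNIV]
    by (auto simp: assoc_plane_def linear_subspace_image dim_UNIV)
  show "assoc_plane ?P1"
  proof (rule plane[of "\<lambda>r w. vv r w 0 0"])
    show "linear (\<lambda>(r, w). vv r w 0 0)"
      by (rule linearI) (auto simp: vv_linear scaleR_conv_of_real[where 'a = complex])
    show "inj (\<lambda>(r, w). vv r w 0 0)"
      by (auto intro!: injI)
    show "vv r w 0 0 \<odot> vv r' w' 0 0 \<in> range (\<lambda>(r, w). vv r w 0 0)"
      if "vv r w 0 0 \<bullet> vv r' w' 0 0 = 0" for r w r' w'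
      unfolding omult_vv_orthogonal[OF that] by (simp add: image_iff)
  qed auto
  show "assoc_plane ?P2"
  proof (rule plane[of "\<lambda>r w. vv r 0 w 0"])
    show "linear (\<lambda>(r, w). vv r 0 w 0)"
      by (rule linearI) (auto simp: vv_linear scaleR_conv_of_real[where 'a = complex])
    show "inj (\<lambda>(r, w). vv r 0 w 0)"
      by (auto intro!: injI)
    show "vv r 0 w 0 \<odot> vv r' 0 w' 0 \<in> range (\<lambda>(r, w). vv r 0 w 0)"
      if "vv r 0 w 0 \<bullet> vv r' 0 w' 0 = 0" for r w r' w'
      unfolding omult_vv_orthogonal[OF that] by (simp add: image_iff)
  qed auto
  show "assoc_plane ?P3"
  proof (rule plane[of "\<lambda>r w. vv r 0 0 w"])
    show "linear (\<lambda>(r, w). vv r 0 0 w)"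
      by (rule linearI) (auto simp: vv_linear scaleR_conv_of_real[where 'a = complex])
    show "inj (\<lambda>(r, w). vv r 0 0 w)"
      by (auto intro!: injI)
    show "vv r 0 0 w \<odot> vv r' 0 0 w' \<in> range (\<lambda>(r, w). vv r 0 0 w)"
      if "vv r 0 0 w \<bullet> vv r' 0 0 w' = 0" for r w r' w'
      unfolding omult_vv_orthogonal[OF that] by (simp add: image_iff)
  qed auto
qed

lemma der_diff:
  "der s t A B C z1 z2 z3 - der s' t' A' B' C' z1' z2' z3' =
     der (s - s') (t - t') (A - A') (B - B') (C - C') (z1 - z1') (z2 - z2') (z3 - z3')"
proof -
  have "- der s' t' A' B' C' z1' z2' z3' = der (- s') (- t') (- A') (- B') (- C') (- z1') (- z2') (- z3')"
    using der_linear(2)[of "-1" s' t' A' B' C' z1' z2' z3'] by simp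
  then show ?thesis
    unfolding diff_conv_add_uminus by (simp only: der_linear)
qed

section \<open>Subalgebras that contain the diagonal torus\<close>

lemma torus_bracket:
  "bracket (der s t 0 0 0 0 0 0) (der s' t' A B C z1 z2 z3) =
     der 0 0 (- \<i> * (s - t) * A) (- \<i> * (2 * s + t) * B) (- \<i> * (s + 2 * t) * C)
       (\<i> * s * z1) (\<i> * t * z2) (- \<i> * (s + t) * z3)"
  by (simp add: bracket_der)

text \<open>The parameters \<open>z1\<close>, \<open>z2\<close>, \<open>z3\<close> span the short
  root planes and \<open>A\<close>, \<open>B\<close>, \<open>C\<close> the long ones. Two short
  planes in \<open>L\<close> produce the third, and all three produce the long ones. Without short
  planes \<open>L\<close> lies in su(3) and kills \<open>oe 1\<close>; with exactly one, it
  preserves that complex coordinate line together with \<open>oe 1\<close>.\<close>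

lemma subalgebra_containing_torus:
  assumes L: "g2_subalgebra L" and torus: "\<And>s t. der s t 0 0 0 0 0 0 \<in> L"
  shows "L = g2 \<or> (\<forall>X\<in>L. blinfun_apply X (oe 1) = 0)
    \<or> (\<exists>P. assoc_plane P \<and> (\<forall>X\<in>L. \<forall>x\<in>P. blinfun_apply X x \<in> P))"
proof -
  note sub = subspace_add[OF g2_subalgebraD(2)[OF L]] subspace_scale[OF g2_subalgebraD(2)[OF L]]
    subspace_diff[OF g2_subalgebraD(2)[OF L]]
  note br = g2_subalgebraD(3)[OF L]
  have ad: "bracket (der s t 0 0 0 0 0 0) X \<in> L" if "X \<in> L" for s t X
    using br torus that by blast
  have plane: "\<exists>(a::real) (b::real). w = a * z + b * (\<i> * z)" if "z \<noteq> 0" for w z :: complex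
  proof (intro exI)
    have "w = (w / z) * z" using that by simp
    also have "\<dots> = Re (w / z) * z + Im (w / z) * (\<i> * z)"
      by (metis (no_types, opaque_lifting) complex_eq distrib_right mult.assoc mult.commute)
    finally show "w = Re (w / z) * z + Im (w / z) * (\<i> * z)" .
  qed
  have S1: "der 0 0 0 0 0 w 0 0 \<in> L" if X: "der s t A B C z1 z2 z3 \<in> L" and z: "z1 \<noteq> 0"
    for s t A B C z1 z2 z3 w
  proof -
    \<comment> \<open>Each of the five torus elements is annihilated by one of the other five roots,
      so only the \<open>z1\<close>-component survives, multiplied by \<open>-2\<close> times the
      fifth power of \<open>\<i>\<close>.\<close>
    have e: "der 0 0 0 0 0 (- 2 * \<i> * z1) 0 0 \<in> L"
      using ad[OF ad[OF ad[OF ad[OF ad[OF X]]]], of 1 "-1" 1 0 "-2" 1 1 "-2" 1 1]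
      by (simp add: torus_bracket mult_ac)
    from ad[OF e, of 1 0] have e': "der 0 0 0 0 0 (2 * z1) 0 0 \<in> L"
      by (simp add: torus_bracket mult_ac)
    obtain a b :: real where w: "w = a * (- 2 * \<i> * z1) + b * (\<i> * (- 2 * \<i> * z1))"
      using plane[of "- 2 * \<i> * z1" w] z by auto
    show ?thesis
      using sub(1)[OF sub(2)[OF e, of a] sub(2)[OF e', of "b"]] by (simp add: der_linear w mult_ac)
  qed
  have S2: "der 0 0 0 0 0 0 w 0 \<in> L" if X: "der s t A B C z1 z2 z3 \<in> L" and z: "z2 \<noteq> 0"
    for s t A B C z1 z2 z3 w
  proof -
    have e: "der 0 0 0 0 0 0 (- 2 * \<i> * z2) 0 \<in> L"
      using ad[OF ad[OF ad[OF ad[OF ad[OF X]]]], of "-1" 1 0 1 1 "-2" "-2" 1 1 1]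
      by (simp add: torus_bracket mult_ac)
    from ad[OF e, of 0 1] have e': "der 0 0 0 0 0 0 (2 * z2) 0 \<in> L"
      by (simp add: torus_bracket mult_ac)
    obtain a b :: real where w: "w = a * (- 2 * \<i> * z2) + b * (\<i> * (- 2 * \<i> * z2))"
      using plane[of "- 2 * \<i> * z2" w] z by auto
    show ?thesis
      using sub(1)[OF sub(2)[OF e, of a] sub(2)[OF e', of "b"]] by (simp add: der_linear w mult_ac)
  qed
  have S3: "der 0 0 0 0 0 0 0 w \<in> L" if X: "der s t A B C z1 z2 z3 \<in> L" and z: "z3 \<noteq> 0"
    for s t A B C z1 z2 z3 w
  proof -
    have e: "der 0 0 0 0 0 0 0 (- 2 * \<i> * z3) \<in> L"
      using ad[OF ad[OF ad[OF ad[OF ad[OF X]]]], of 1 0 0 1 1 "-2" "-2" 1 1 1]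
      by (simp add: torus_bracket mult_ac)
    from ad[OF e, of 0 1] have e': "der 0 0 0 0 0 0 0 (- 2 * z3) \<in> L"
      by (simp add: torus_bracket mult_ac)
    obtain a b :: real where w: "w = a * (- 2 * \<i> * z3) + b * (\<i> * (- 2 * \<i> * z3))"
      using plane[of "- 2 * \<i> * z3" w] z by auto
    show ?thesis
      using sub(1)[OF sub(2)[OF e, of a] sub(2)[OF e', of "-b"]] by (simp add: der_linear w mult_ac)
  qed
  let ?a1 = "\<forall>w. der 0 0 0 0 0 w 0 0 \<in> L" and ?a2 = "\<forall>w. der 0 0 0 0 0 0 w 0 \<in> L"
    and ?a3 = "\<forall>w. der 0 0 0 0 0 0 0 w \<in> L"
  have N1: "z1 = 0" if X: "der s t A B C z1 z2 z3 \<in> L" and n: "\<not> ?a1" for s t A B C z1 z2 z3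
  proof (rule ccontr)
    assume "z1 \<noteq> 0"
    then show False using S1[OF X] n by blast
  qed
  have N2: "z2 = 0" if X: "der s t A B C z1 z2 z3 \<in> L" and n: "\<not> ?a2" for s t A B C z1 z2 z3
  proof (rule ccontr)
    assume "z2 \<noteq> 0"
    then show False using S2[OF X] n by blast
  qed
  have N3: "z3 = 0" if X: "der s t A B C z1 z2 z3 \<in> L" and n: "\<not> ?a3" for s t A B C z1 z2 z3
  proof (rule ccontr)
    assume "z3 \<noteq> 0"
    then show False using S3[OF X] n by blast
  qed
  \<comment> \<open>The three short roots sum to zero, so the bracket of two of their planes has a
    nonzero component in the third.\<close>
  have a12: "?a3" if "?a1" "?a2"
    using S3[of _ _ _ _ _ _ _ "\<i>"] br[OF that(1)[rule_format, of 1] that(2)[rule_format, of 1]]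
    by (auto simp: bracket_der)
  have a13: "?a2" if "?a1" "?a3"
    using S2[of _ _ _ _ _ _ "-\<i>"] br[OF that(1)[rule_format, of 1] that(2)[rule_format, of 1]]
    by (auto simp: bracket_der)
  have a23: "?a1" if "?a2" "?a3"
    using S1[of _ _ _ _ _ "\<i>"] br[OF that(1)[rule_format, of 1] that(2)[rule_format, of 1]]
    by (auto simp: bracket_der)
  consider (all) "?a1" "?a2" "?a3" | (none) "\<not> ?a1" "\<not> ?a2" "\<not> ?a3"
    | (one) "?a1" "\<not> ?a2" "\<not> ?a3" | (two) "\<not> ?a1" "?a2" "\<not> ?a3" | (three) "\<not> ?a1" "\<not> ?a2" "?a3"
    using a12 a13 a23 by blast
  then show ?thesis
  proof cases
    case all
    \<comment> \<open>The 4/3 cancels the factor 3/4 of \<open>bracket_der\<close>; the short-root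
      component of the bracket is subtracted.\<close>
    have A: "der 0 0 w 0 0 0 0 0 \<in> L" for w
      using sub(3)[OF br[OF all(1)[rule_format, of 1] all(2)[rule_format, of "4/3 * w"]]
          all(3)[rule_format, of "\<i> * cnj (4/3 * w)"]]
      by (simp add: bracket_der der_diff)
    have B: "der 0 0 0 w 0 0 0 0 \<in> L" for w
      using sub(3)[OF br[OF all(1)[rule_format, of 1] all(3)[rule_format, of "4/3 * w"]]
          all(2)[rule_format, of "- \<i> * cnj (4/3 * w)"]]
      by (simp add: bracket_der der_diff)
    have C: "der 0 0 0 0 w 0 0 0 \<in> L" for w
      using sub(3)[OF br[OF all(2)[rule_format, of 1] all(3)[rule_format, of "4/3 * w"]]
          all(1)[rule_format, of "\<i> * cnj (4/3 * w)"]]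
      by (simp add: bracket_der der_diff)
    have "X \<in> L" if XL: "X \<in> g2" for X
    proof -
      obtain s t A B C z1 z2 z3 where X: "X = der s t A B C z1 z2 z3"
        using g2_cases[OF XL] by blast
      have "X = der s t 0 0 0 0 0 0 + der 0 0 A 0 0 0 0 0 + der 0 0 0 B 0 0 0 0 + der 0 0 0 0 C 0 0 0
          + der 0 0 0 0 0 z1 0 0 + der 0 0 0 0 0 0 z2 0 + der 0 0 0 0 0 0 0 z3"
        by (simp add: X der_linear)
      also have "\<dots> \<in> L" by (intro sub torus A B C all[rule_format])
      finally show ?thesis .
    qed
    then show ?thesis using g2_subalgebraD(1)[OF L] by blast
  next
    case none
    have "blinfun_apply X (oe 1) = 0" if XL: "X \<in> L" for X
    proof -
      obtain s t A B C z1 z2 z3 where X: "X = der s t A B C z1 z2 z3"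
        using g2_cases[OF g2_subalgebraD(1)[OF L XL]] by blast
      have "z1 = 0" "z2 = 0" "z3 = 0"
        using N1[OF XL[unfolded X] none(1)] N2[OF XL[unfolded X] none(2)] N3[OF XL[unfolded X] none(3)] .
      then show ?thesis by (simp add: X oe_eq_vv der_vv der_fun_def)
    qed
    then show ?thesis by blast
  next
    case one
    have "blinfun_apply X (vv r w 0 0) \<in> range (\<lambda>(r, w). vv r w 0 0)" if XL: "X \<in> L" for X r w
    proof -
      obtain s t A B C z1 z2 z3 where X: "X = der s t A B C z1 z2 z3"
        using g2_cases[OF g2_subalgebraD(1)[OF L XL]] by blast
      have z: "z2 = 0" "z3 = 0"
        using N2[OF XL[unfolded X] one(2)] N3[OF XL[unfolded X] one(3)] .
      \<comment> \<open>This bracket has \<open>z2\<close>-component \<open>A\<close> and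
        \<open>z3\<close>-component \<open>B\<close>, and \<open>L\<close> contains no elements with
        such components.\<close>
      have e: "bracket X (der 0 0 0 0 0 1 0 0) \<in> L" using br XL one by blast
      have "A = 0" "B = 0"
        using N2[OF e[unfolded X z bracket_der] one(2)] N3[OF e[unfolded X z bracket_der] one(3)] by simp_all
      then show ?thesis by (auto simp: X z der_vv der_fun_def image_iff)
    qed
    then show ?thesis using assoc_plane_coordinate(1) by (intro disjI2) fastforce
  next
    case two
    have "blinfun_apply X (vv r 0 w 0) \<in> range (\<lambda>(r, w). vv r 0 w 0)" if XL: "X \<in> L" for X r w
    proof -
      obtain s t A B C z1 z2 z3 where X: "X = der s t A B C z1 z2 z3"
        using g2_cases[OF g2_subalgebraD(1)[OF L XL]] by blast
      have z: "z1 = 0" "z3 = 0"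
        using N1[OF XL[unfolded X] two(1)] N3[OF XL[unfolded X] two(3)] .
      have e: "bracket X (der 0 0 0 0 0 0 1 0) \<in> L" using br XL two by blast
      have "A = 0" "C = 0"
        using N1[OF e[unfolded X z bracket_der] two(1)] N3[OF e[unfolded X z bracket_der] two(3)] by simp_all
      then show ?thesis by (auto simp: X z der_vv der_fun_def image_iff)
    qed
    then show ?thesis using assoc_plane_coordinate(2) by (intro disjI2) fastforce
  next
    case three
    have "blinfun_apply X (vv r 0 0 w) \<in> range (\<lambda>(r, w). vv r 0 0 w)" if XL: "X \<in> L" for X r w
    proof -
      obtain s t A B C z1 z2 z3 where X: "X = der s t A B C z1 z2 z3"
        using g2_cases[OF g2_subalgebraD(1)[OF L XL]] by blast
      have z: "z1 = 0" "z2 = 0"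
        using N1[OF XL[unfolded X] three(1)] N2[OF XL[unfolded X] three(2)] .
      have e: "bracket X (der 0 0 0 0 0 0 0 1) \<in> L" using br XL three by blast
      have "B = 0" "C = 0"
        using N1[OF e[unfolded X z bracket_der] three(1)] N2[OF e[unfolded X z bracket_der] three(2)] by simp_all
      then show ?thesis by (auto simp: X z der_vv der_fun_def image_iff)
    qed
    then show ?thesis using assoc_plane_coordinate(3) by (intro disjI2) fastforce
  qed
qed

section \<open>Rank one subalgebras of \<open>g2\<close>\<close>

lemma matrix_inner_mult:
  fixes A B C :: "real^'n^'n"
  shows "(A ** B) \<bullet> C = B \<bullet> (transpose A ** C)" "(B ** A) \<bullet> C = B \<bullet> (C ** transpose A)"
proof -
  have "(A ** B) \<bullet> C = (\<Sum>i\<in>UNIV. \<Sum>j\<in>UNIV. \<Sum>k\<in>UNIV. A$i$k * B$k$j * C$i$j)"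
    by (simp add: inner_vec_def matrix_matrix_mult_def sum_distrib_right)
  also have "\<dots> = (\<Sum>i\<in>UNIV. \<Sum>k\<in>UNIV. \<Sum>j\<in>UNIV. A$i$k * B$k$j * C$i$j)"
    by (intro sum.cong refl sum.swap)
  also have "\<dots> = (\<Sum>k\<in>UNIV. \<Sum>i\<in>UNIV. \<Sum>j\<in>UNIV. A$i$k * B$k$j * C$i$j)"
    by (rule sum.swap)
  also have "\<dots> = (\<Sum>k\<in>UNIV. \<Sum>j\<in>UNIV. \<Sum>i\<in>UNIV. A$i$k * B$k$j * C$i$j)"
    by (intro sum.cong refl sum.swap)
  also have "\<dots> = B \<bullet> (transpose A ** C)"
    by (simp add: inner_vec_def matrix_matrix_mult_def transpose_def sum_distrib_left mult_ac)
  finally show "(A ** B) \<bullet> C = B \<bullet> (transpose A ** C)" .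
  have "(B ** A) \<bullet> C = (\<Sum>i\<in>UNIV. \<Sum>j\<in>UNIV. \<Sum>k\<in>UNIV. B$i$k * A$k$j * C$i$j)"
    by (simp add: inner_vec_def matrix_matrix_mult_def sum_distrib_right)
  also have "\<dots> = (\<Sum>i\<in>UNIV. \<Sum>k\<in>UNIV. \<Sum>j\<in>UNIV. B$i$k * A$k$j * C$i$j)"
    by (intro sum.cong refl sum.swap)
  also have "\<dots> = B \<bullet> (C ** transpose A)"
    by (simp add: inner_vec_def matrix_matrix_mult_def transpose_def sum_distrib_left mult_ac)
  finally show "(B ** A) \<bullet> C = B \<bullet> (C ** transpose A)" .
qed

text \<open>The abstract statement asks for an invariant inner product. Matrices carry the Frobenius
  product, which is invariant under bracketing with derivations since these are skew.\<close>

lemma g2_rank_one_double_bracket: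
  assumes L: "g2_subalgebra L"
    and rank: "\<And>X Y. X \<in> L \<Longrightarrow> Y \<in> L \<Longrightarrow> X \<noteq> 0 \<Longrightarrow> bracket X Y = 0 \<Longrightarrow> \<exists>c. Y = c *\<^sub>R X"
    and XY: "X \<in> L" "Y \<in> L"
  shows "\<exists>\<alpha> \<beta>. bracket X (bracket X Y) = \<alpha> *\<^sub>R X + \<beta> *\<^sub>R Y"
proof -
  define mt where "mt X = matrix (blinfun_apply X)" for X :: "oct \<Rightarrow>\<^sub>L oct"
  define br where "br A B = A ** B - B ** A" for A B :: "real^8^8"
  have lin: "linear (blinfun_apply X)" for X :: "oct \<Rightarrow>\<^sub>L oct"
    by (simp add: bounded_linear.linear blinfun.bounded_linear_right)
  have mt_nth: "mt X $ i $ j = blinfun_apply X (oe j) $ i" for X i j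
    by (simp add: mt_def matrix_def oe_def)
  have mt_lin: "linear mt"
    by (rule linearI) (simp_all add: vec_eq_iff mt_nth blinfun.bilinear_simps)
  have mt_inj: "mt X = mt Y \<longleftrightarrow> X = Y" for X Y
  proof
    assume "mt X = mt Y"
    then have "blinfun_apply X = blinfun_apply Y"
      unfolding mt_def using lin by (metis matrix_vector_mul)
    then show "X = Y" by (simp add: blinfun_apply_inject)
  qed simp
  have mt_br: "mt (bracket X Y) = br (mt X) (mt Y)" for X Y
  proof -
    have "mt (X o\<^sub>L Y) = mt X ** mt Y" for X Y
    proof -
      have "blinfun_apply (X o\<^sub>L Y) = blinfun_apply X \<circ> blinfun_apply Y" by auto
      then show ?thesis by (simp add: mt_def matrix_compose lin)
    qed
    then show ?thesis
      by (simp add: bracket_def br_def linear_diff[OF mt_lin])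
  qed
  have skew: "transpose (mt X) = - mt X" if "X \<in> L" for X
  proof -
    have *: "blinfun_apply X (oe i) $ j = - blinfun_apply X (oe j) $ i" for i j
      using g2_adjoint[OF g2_subalgebraD(1)[OF L that], of "oe i" "oe j"]
      by (simp add: oe_def inner_axis inner_axis')
    show ?thesis
      unfolding vec_eq_iff by (intro allI) (simp add: transpose_def mt_nth, rule *)
  qed
  have mneg: "(- A) ** B = - (A ** B)" "B ** (- A) = - (B ** A)" for A B :: "real^8^8"
    by (simp_all add: vec_eq_iff matrix_matrix_mult_def sum_negf)
  have msub: "(A - B) ** C = A ** C - B ** C" "C ** (A - B) = C ** A - C ** B" for A B C :: "real^8^8"
    by (simp_all add: vec_eq_iff matrix_matrix_mult_def sum_subtractf algebra_simps)
  have "\<exists>\<alpha> \<beta>. br (mt X) (br (mt X) (mt Y)) = \<alpha> *\<^sub>R mt X + \<beta> *\<^sub>R mt Y"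
  proof (rule lie_rank_one_double_bracket[where L = "mt ` L"])
    show "bilinear br"
      unfolding bilinear_def br_def
      by (auto intro!: linearI simp: vec_eq_iff matrix_matrix_mult_def sum.distrib
          sum_distrib_left algebra_simps)
    show "subspace (mt ` L)"
      by (rule linear_subspace_image[OF mt_lin g2_subalgebraD(2)[OF L]])
    show "br x y \<in> mt ` L" if "x \<in> mt ` L" "y \<in> mt ` L" for x y
      using that g2_subalgebraD(3)[OF L] by (auto simp flip: mt_br)
    show "br x x = 0" for x by (simp add: br_def)
    show "br x (br y z) = br (br x y) z + br y (br x z)" for x y z
      by (simp add: br_def msub matrix_mul_assoc)
    show "br x y \<bullet> z = - (y \<bullet> br x z)" if x: "x \<in> mt ` L" for x y z
    proof -
      obtain A where A: "x = mt A" "A \<in> L" using x by blast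
      show ?thesis
        by (simp add: A br_def inner_diff_left inner_diff_right matrix_inner_mult(1)[where A = "mt A"]
            matrix_inner_mult(2)[where A = "mt A"] skew mneg)
    qed
    show "\<exists>c. y = c *\<^sub>R x" if xy: "x \<in> mt ` L" "y \<in> mt ` L" "x \<noteq> 0" "br x y = 0" for x y
    proof -
      obtain X Y where X: "x = mt X" "X \<in> L" and Y: "y = mt Y" "Y \<in> L" using xy by auto
      have "mt 0 = 0" by (rule linear_0[OF mt_lin])
      then have "X \<noteq> 0" "bracket X Y = 0"
        using xy(3,4) mt_inj[of "bracket X Y" 0] by (auto simp: X Y mt_br)
      then obtain c where "Y = c *\<^sub>R X" using rank X Y by blast
      then show ?thesis by (auto simp: X Y linear_cmul[OF mt_lin])
    qed
    show "mt X \<in> mt ` L" "mt Y \<in> mt ` L" using XY by auto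
  qed
  then obtain \<alpha> \<beta> where "br (mt X) (br (mt X) (mt Y)) = \<alpha> *\<^sub>R mt X + \<beta> *\<^sub>R mt Y" by blast
  then have "mt (bracket X (bracket X Y)) = mt (\<alpha> *\<^sub>R X + \<beta> *\<^sub>R Y)"
    by (simp add: mt_br linear_add[OF mt_lin] linear_cmul[OF mt_lin])
  then show ?thesis by (auto simp: mt_inj)
qed

section \<open>Conjugation by automorphisms and commuting derivations\<close>

definition oct_aut :: "(oct \<Rightarrow> oct) \<Rightarrow> bool" where
  "oct_aut g \<longleftrightarrow> linear g \<and> (\<forall>x y. g (x \<odot> y) = g x \<odot> g y) \<and> (\<forall>x y. g x \<bullet> g y = x \<bullet> y)"

lemma oct_aut_inverse:
  assumes g: "oct_aut g"
  shows "g (inv g x) = x" "inv g (g x) = x" "oct_aut (inv g)"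
proof -
  have lin: "linear g" and inn: "\<And>x y. g x \<bullet> g y = x \<bullet> y" and mult: "\<And>x y. g (x \<odot> y) = g x \<odot> g y"
    using g by (auto simp: oct_aut_def)
  have "inj g"
  proof (rule injI)
    fix x y assume "g x = g y"
    then have "g (x - y) \<bullet> g (x - y) = 0" by (simp add: linear_diff[OF lin])
    then show "x = y" by (simp add: inn)
  qed
  then have surj: "surj g" using linear_injective_imp_surjective[OF lin] by simp
  show gi: "g (inv g x) = x" for x by (rule surj_f_inv_f[OF surj])
  show ig: "inv g (g x) = x" for x by (rule inv_f_f[OF \<open>inj g\<close>])
  have eq: "inv g x = y \<longleftrightarrow> x = g y" for x y using gi ig by metis
  have "linear (inv g)"
    by (rule linearI) (simp_all add: eq linear_add[OF lin] linear_cmul[OF lin] gi)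
  moreover have "inv g x \<bullet> inv g y = x \<bullet> y" for x y
    using inn[of "inv g x" "inv g y"] by (simp add: gi)
  ultimately show "oct_aut (inv g)"
    by (simp add: oct_aut_def eq mult gi)
qed

lemma oct_aut_one:
  assumes g: "oct_aut g"
  shows "g (oe 0) = oe 0" "g x $ 0 = x $ 0"
proof -
  have "g (oe 0 \<odot> inv g (oe 0)) = g (oe 0) \<odot> g (inv g (oe 0))"
    using g by (simp only: oct_aut_def)
  then show o: "g (oe 0) = oe 0" by (simp add: oct_aut_inverse[OF g])
  have ent: "x $ 0 = x \<bullet> oe 0" for x :: oct by (simp add: oct_inner)
  have "g x \<bullet> g (oe 0) = x \<bullet> oe 0" using g by (simp add: oct_aut_def)
  then show "g x $ 0 = x $ 0" by (simp add: o ent)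
qed

definition conj_aut :: "(oct \<Rightarrow> oct) \<Rightarrow> (oct \<Rightarrow>\<^sub>L oct) \<Rightarrow> (oct \<Rightarrow>\<^sub>L oct)" where
  "conj_aut g X = Blinfun (\<lambda>x. g (blinfun_apply X (inv g x)))"

lemma conj_aut_apply:
  assumes g: "oct_aut g"
  shows "blinfun_apply (conj_aut g X) x = g (blinfun_apply X (inv g x))"
proof -
  have "linear g" "linear (inv g)" "linear (blinfun_apply X)"
    using g oct_aut_inverse(3)[OF g]
    by (auto simp: oct_aut_def bounded_linear.linear blinfun.bounded_linear_right)
  then have "linear (\<lambda>x. g (blinfun_apply X (inv g x)))"
    by (auto intro!: linearI simp: linear_add linear_cmul)
  then show ?thesis
    unfolding conj_aut_def by (simp add: bounded_linear_Blinfun_apply linear_conv_bounded_linear)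
qed

lemma conj_aut_in_g2:
  assumes g: "oct_aut g" and X: "X \<in> g2"
  shows "conj_aut g X \<in> g2"
  using g oct_aut_inverse(3)[OF g]
  by (simp add: g2_def conj_aut_apply[OF g] oct_aut_def g2_D[OF X] linear_add oct_aut_inverse[OF g])

lemma adapted_oct_aut:
  assumes "f1$0 = 0" "f2$0 = 0" "f4$0 = 0" "f1 \<bullet> f1 = 1" "f2 \<bullet> f2 = 1" "f4 \<bullet> f4 = 1"
    "f1 \<bullet> f2 = 0" "f1 \<bullet> f4 = 0" "f2 \<bullet> f4 = 0" "(f1 \<odot> f2) \<bullet> f4 = 0"
  obtains g where "oct_aut g" "g (oe 1) = f1" "g (oe 2) = f2" "g (oe 4) = f4"
  using adapted_automorphism[OF assms] unfolding oct_aut_def by blast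

lemma exists_orthogonal:
  fixes A :: "oct set"
  assumes "finite A" "card A < 8"
  shows "\<exists>x. x \<noteq> 0 \<and> (\<forall>a\<in>A. x \<bullet> a = 0)"
proof -
  have "dim A < DIM(oct)" using dim_le_card'[OF assms(1)] assms(2) by simp
  then obtain x where "x \<noteq> 0" "\<And>y. y \<in> span A \<Longrightarrow> orthogonal x y"
    using orthogonal_to_subspace_exists by blast
  then show ?thesis by (auto simp: orthogonal_def span_base)
qed

lemma dim_imag: "dim {x :: oct. x$0 = 0} = 7"
proof -
  have "{x :: oct. x$0 = 0} = {x. oe 0 \<bullet> x = 0}" by (simp add: oct_inner)
  moreover have "oe 0 \<noteq> 0" by (simp add: oct_eq_iff)
  ultimately show ?thesis by (simp add: dim_hyperplane)
qed

lemma subspace_imag: "subspace {x :: oct. x$0 = 0}"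
  by (auto simp: subspace_def)

lemma linear_blinfun_apply: "linear (blinfun_apply X)"
  by (simp add: bounded_linear.linear blinfun.bounded_linear_right)

text \<open>Since V has dimension 7, \<open>X\<close> and \<open>Y\<close> have a common null vector
  \<open>f1\<close>. Both are complex linear for the complex structure given by \<open>f1\<close> on
  its complement, and simultaneous diagonalisation there yields an adapted triple.\<close>

lemma commuting_g2_adapted:
  assumes X: "X \<in> g2" and Y: "Y \<in> g2" and comm: "bracket X Y = 0"
  obtains g s t s' t' where "oct_aut g"
    "conj_aut (inv g) X = der s t 0 0 0 0 0 0" "conj_aut (inv g) Y = der s' t' 0 0 0 0 0 0"
proof -
  let ?X = "blinfun_apply X" and ?Y = "blinfun_apply Y"
  have XY: "?X (?Y x) = ?Y (?X x)" for x
    using bracket_apply[of X Y x] comm by simp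
  have "\<exists>x\<in>{x. x$0 = 0}. x \<noteq> 0 \<and> ?X x = 0 \<and> ?Y x = 0"
    by (rule commuting_skew_odd_kernel[OF linear_blinfun_apply linear_blinfun_apply subspace_imag])
      (auto simp: g2_imag[OF X] g2_imag[OF Y] g2_skew[OF X] g2_skew[OF Y] XY dim_imag)
  then obtain k where k: "k$0 = 0" "k \<noteq> 0" "?X k = 0" "?Y k = 0" by blast
  define f1 where "f1 = k /\<^sub>R norm k"
  have f1: "f1$0 = 0" "f1 \<bullet> f1 = 1" "?X f1 = 0" "?Y f1 = 0"
    using k by (auto simp: f1_def blinfun.scaleR_right dot_square_norm power2_eq_square)
  have ll: "f1 \<odot> (f1 \<odot> x) = - x" for x
    using imag_omult_twice(1)[OF f1(1)] f1(2) by simp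
  have Xf: "?X (f1 \<odot> x) = f1 \<odot> ?X x" "?Y (f1 \<odot> x) = f1 \<odot> ?Y x" for x
    using g2_D[OF X, of f1 x] g2_D[OF Y, of f1 x] f1 by (simp_all add: omult_bilinear)
  \<comment> \<open>\<open>X\<close> is skew and commutes with left multiplication by
    \<open>f1\<close>, which is skew too; the composite is therefore self-adjoint and has real
    eigenvectors.\<close>
  define a b where "a x = f1 \<odot> ?X x" and "b x = f1 \<odot> ?Y x" for x
  have lin: "linear a" "linear b"
    by (auto intro!: linearI simp: a_def b_def blinfun.bilinear_simps omult_bilinear)
  have adj: "a x \<bullet> y = x \<bullet> a y" "b x \<bullet> y = x \<bullet> b y" for x y
    using imag_omult_adjoint(1)[OF f1(1), of "?X x" y] imag_omult_adjoint(1)[OF f1(1), of "?Y x" y]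
      g2_adjoint[OF X, of x "f1 \<odot> y"] g2_adjoint[OF Y, of x "f1 \<odot> y"]
    by (simp_all add: a_def b_def Xf)
  have ab: "a (b x) = b (a x)" for x by (simp add: a_def b_def Xf XY)
  have eig: "?X x = (- m) *\<^sub>R (f1 \<odot> x)" if "a x = m *\<^sub>R x" for x m
  proof -
    have "f1 \<odot> a x = m *\<^sub>R (f1 \<odot> x)" using that by (simp add: omult_bilinear)
    then show ?thesis by (simp add: a_def ll minus_equation_iff[of "?X x"])
  qed
  have eig': "?Y x = (- m) *\<^sub>R (f1 \<odot> x)" if "b x = m *\<^sub>R x" for x m
  proof -
    have "f1 \<odot> b x = m *\<^sub>R (f1 \<odot> x)" using that by (simp add: omult_bilinear)
    then show ?thesis by (simp add: b_def ll minus_equation_iff[of "?Y x"])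
  qed
  have J: "a (f1 \<odot> x) = f1 \<odot> a x" "b (f1 \<odot> x) = f1 \<odot> b x" for x
    by (simp_all add: a_def b_def Xf)
  have ab0: "a f1 = 0" "b f1 = 0" by (simp_all add: a_def b_def f1 omult_bilinear)
  have ab1: "a x $ 0 = 0" "a x \<bullet> f1 = 0" "b x $ 0 = 0" "b x \<bullet> f1 = 0" if "x$0 = 0" for x
  proof -
    have "f1 \<bullet> ?X x = 0" "f1 \<bullet> ?Y x = 0"
      using g2_adjoint[OF X, of f1 x] g2_adjoint[OF Y, of f1 x] f1 by simp_all
    then show "a x $ 0 = 0" "b x $ 0 = 0"
      by (simp_all add: a_def b_def imag_omult_real_part f1)
    show "a x \<bullet> f1 = 0" "b x \<bullet> f1 = 0"
      using g2_imag[OF X] g2_imag[OF Y] f1 by (simp_all add: a_def b_def imag_omult_orthogonal)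
  qed
  let ?W = "{x. x$0 = 0 \<and> x \<bullet> f1 = 0}"
  have "\<exists>x. x \<noteq> 0 \<and> (\<forall>c\<in>{oe 0, f1}. x \<bullet> c = 0)"
    by (rule exists_orthogonal) (auto simp: card_insert_if)
  then have "?W \<noteq> {0}" by (auto simp: oct_inner[of _ "oe 0"])
  then have "\<exists>x m n. x \<in> ?W \<and> norm x = 1 \<and> a x = m *\<^sub>R x \<and> b x = n *\<^sub>R x"
    by (intro commuting_self_adjoint_eigenvector[OF lin])
       (auto simp: ab0 ab1 adj ab subspace_def inner_add_left)
  then obtain f2 m n where f2: "f2$0 = 0" "f2 \<bullet> f1 = 0" "f2 \<bullet> f2 = 1" "a f2 = m *\<^sub>R f2" "b f2 = n *\<^sub>R f2"
    by (auto simp: norm_eq_1)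
  \<comment> \<open>The complement of the complex line through \<open>f2\<close>. It is invariant
    because \<open>a\<close> and \<open>b\<close> commute with left multiplication by
    \<open>f1\<close>.\<close>
  let ?U = "{x. x$0 = 0 \<and> x \<bullet> f1 = 0 \<and> x \<bullet> f2 = 0 \<and> x \<bullet> (f1 \<odot> f2) = 0}"
  have "\<exists>x. x \<noteq> 0 \<and> (\<forall>c\<in>{oe 0, f1, f2, f1 \<odot> f2}. x \<bullet> c = 0)"
    by (rule exists_orthogonal) (auto simp: card_insert_if)
  then have U0: "?U \<noteq> {0}" by (auto simp: oct_inner[of _ "oe 0"])
  have "a x \<in> ?U \<and> b x \<in> ?U" if "x \<in> ?U" for x
    using that ab1[of x] by (simp add: adj[of x] J f2 omult_bilinear)
  then have "\<exists>x m n. x \<in> ?U \<and> norm x = 1 \<and> a x = m *\<^sub>R x \<and> b x = n *\<^sub>R x"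
    by (intro commuting_self_adjoint_eigenvector[OF lin _ U0])
       (auto simp: adj ab subspace_def inner_add_left)
  then obtain f4 m' n' where f4: "f4$0 = 0" "f4 \<bullet> f1 = 0" "f4 \<bullet> f2 = 0" "f4 \<bullet> (f1 \<odot> f2) = 0"
      "f4 \<bullet> f4 = 1" "a f4 = m' *\<^sub>R f4" "b f4 = n' *\<^sub>R f4"
    by (auto simp: norm_eq_1)
  obtain g where g: "oct_aut g" "g (oe 1) = f1" "g (oe 2) = f2" "g (oe 4) = f4"
    using adapted_oct_aut[of f1 f2 f4] f1 f2 f4 by (auto simp: inner_commute)
  note h = oct_aut_inverse(3)[OF g(1)]
  have hh: "inv (inv g) = g"
    by (rule inv_equality) (simp_all add: oct_aut_inverse[OF g(1)])
  have h_f: "inv g f1 = oe 1" "inv g f2 = oe 2" "inv g f4 = oe 4"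
    using oct_aut_inverse(2)[OF g(1)] g by metis+
  have h_lin: "inv g (c *\<^sub>R x) = c *\<^sub>R inv g x" "inv g 0 = 0" "inv g (- x) = - inv g x"
    "inv g (x \<odot> y) = inv g x \<odot> inv g y" for c x y
    using h by (auto simp: oct_aut_def linear_cmul linear_0 linear_neg)
  have "conj_aut (inv g) X = der (- m) (- m') 0 0 0 0 0 0"
    by (rule g2_eqI[OF conj_aut_in_g2[OF h X] der_in_g2])
       (simp_all add: conj_aut_apply[OF h] hh g f1 eig[OF f2(4)] eig[OF f4(6)] h_lin h_f omult_oe unit_mult_table,
        simp_all add: oe_eq_vv der_vv der_fun_def vv_linear)
  moreover have "conj_aut (inv g) Y = der (- n) (- n') 0 0 0 0 0 0"
    by (rule g2_eqI[OF conj_aut_in_g2[OF h Y] der_in_g2])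
       (simp_all add: conj_aut_apply[OF h] hh g f1 eig'[OF f2(5)] eig'[OF f4(7)] h_lin h_f omult_oe unit_mult_table,
        simp_all add: oe_eq_vv der_vv der_fun_def vv_linear)
  ultimately show ?thesis using that g(1) by blast
qed

lemma conj_aut_linear:
  assumes g: "oct_aut g"
  shows "conj_aut g (X + Y) = conj_aut g X + conj_aut g Y" "conj_aut g (c *\<^sub>R X) = c *\<^sub>R conj_aut g X"
    "conj_aut g (bracket X Y) = bracket (conj_aut g X) (conj_aut g Y)"
    "conj_aut (inv g) (conj_aut g X) = X"
proof -
  have "linear g" using g by (simp add: oct_aut_def)
  note l = linear_add[OF this] linear_cmul[OF this] linear_diff[OF this]
  show "conj_aut g (X + Y) = conj_aut g X + conj_aut g Y" "conj_aut g (c *\<^sub>R X) = c *\<^sub>R conj_aut g X"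
    "conj_aut g (bracket X Y) = bracket (conj_aut g X) (conj_aut g Y)"
    by (rule blinfun_eqI; simp add: conj_aut_apply[OF g] blinfun.bilinear_simps bracket_apply l
        oct_aut_inverse[OF g])+
  have hh: "inv (inv g) = g"
    by (rule inv_equality) (simp_all add: oct_aut_inverse[OF g])
  show "conj_aut (inv g) (conj_aut g X) = X"
    by (rule blinfun_eqI) (simp add: conj_aut_apply[OF oct_aut_inverse(3)[OF g]] conj_aut_apply[OF g] hh
        oct_aut_inverse[OF g])
qed

text \<open>Conjugation makes \<open>X\<close> and \<open>Y\<close> diagonal, and being independent
  they span the whole torus. The three alternatives are then carried back by
  \<open>g\<close>.\<close>

lemma rank_two_subalgebra:
  assumes L: "g2_subalgebra L" and XY: "X \<in> L" "Y \<in> L" "bracket X Y = 0" "X \<noteq> 0" "\<And>c. Y \<noteq> c *\<^sub>R X"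
  shows "L = g2 \<or> (\<exists>f. f \<noteq> 0 \<and> f$0 = 0 \<and> (\<forall>X\<in>L. blinfun_apply X f = 0))
    \<or> (\<exists>P. assoc_plane P \<and> (\<forall>X\<in>L. \<forall>x\<in>P. blinfun_apply X x \<in> P))"
proof -
  note g2 = g2_subalgebraD(1)[OF L]
  obtain g s t s' t' where g: "oct_aut g"
    and cX: "conj_aut (inv g) X = der s t 0 0 0 0 0 0" and cY: "conj_aut (inv g) Y = der s' t' 0 0 0 0 0 0"
    using commuting_g2_adapted[OF g2 g2] XY by metis
  define h where "h = inv g"
  have h: "oct_aut h" unfolding h_def by (rule oct_aut_inverse(3)[OF g])
  have hh: "inv h = g"
    unfolding h_def by (rule inv_equality) (simp_all add: oct_aut_inverse[OF g])
  note cX = cX[folded h_def] and cY = cY[folded h_def]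
  note cl = conj_aut_linear[OF h] and cg = conj_aut_linear(4)[OF h, unfolded hh]
  let ?L = "conj_aut h ` L"
  note sub = subspace_add[OF g2_subalgebraD(2)[OF L]] subspace_scale[OF g2_subalgebraD(2)[OF L]]
  have zero: "conj_aut h 0 = 0" using cl(2)[of 0 0] by simp
  have L': "g2_subalgebra ?L"
    unfolding g2_subalgebra_def subspace_def
  proof (intro conjI ballI allI)
    show "?L \<subseteq> g2" using conj_aut_in_g2[OF h g2] by auto
    show "0 \<in> ?L" using zero subspace_0[OF g2_subalgebraD(2)[OF L]] by (metis image_eqI)
    show "A + B \<in> ?L" if "A \<in> ?L" "B \<in> ?L" for A B
      using that sub by (auto simp flip: cl)
    show "c *\<^sub>R A \<in> ?L" if "A \<in> ?L" for A c
      using that sub by (auto simp flip: cl)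
    show "bracket A B \<in> ?L" if "A \<in> ?L" "B \<in> ?L" for A B
      using that g2_subalgebraD(3)[OF L] by (auto simp flip: cl)
  qed
  have st0: "s \<noteq> 0 \<or> t \<noteq> 0"
  proof (rule ccontr)
    assume "\<not> (s \<noteq> 0 \<or> t \<noteq> 0)"
    then have "conj_aut h X = 0" using cX by simp
    then show False using cg[of X] conj_aut_linear(2)[OF g, of 0 0] XY(4) by simp
  qed
  have det: "s * t' - t * s' \<noteq> 0"
  proof
    assume d: "s * t' - t * s' = 0"
    define c where "c = (if s \<noteq> 0 then s' / s else t' / t)"
    have "s' = c * s" "t' = c * t"
      using d st0 by (auto simp: c_def field_simps)
    then have "conj_aut h Y = conj_aut h (c *\<^sub>R X)"
      by (simp add: cX cY cl der_linear)
    then have "Y = c *\<^sub>R X" using cg by metis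
    then show False using XY(5) by blast
  qed
  \<comment> \<open>Cramer's rule for the coefficients.\<close>
  have torus: "der p q 0 0 0 0 0 0 \<in> ?L" for p q
  proof -
    let ?d = "s * t' - t * s'"
    have "(p * t' - q * s') / ?d * s + (s * q - t * p) / ?d * s' = p * ?d / ?d"
      "(p * t' - q * s') / ?d * t + (s * q - t * p) / ?d * t' = q * ?d / ?d"
      unfolding times_divide_eq_left add_divide_distrib[symmetric] by (simp_all add: algebra_simps)
    then have e: "(p * t' - q * s') / ?d * s + (s * q - t * p) / ?d * s' = p"
      "(p * t' - q * s') / ?d * t + (s * q - t * p) / ?d * t' = q"
      using det by simp_all
    have "der p q 0 0 0 0 0 0 =
        ((p * t' - q * s') / ?d) *\<^sub>R conj_aut h X + ((s * q - t * p) / ?d) *\<^sub>R conj_aut h Y"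
      unfolding cX cY der_linear using e by simp
    also have "\<dots> \<in> ?L"
      using XY L' by (intro subspace_add subspace_scale g2_subalgebraD(2)) auto
    finally show ?thesis .
  qed
  have ap: "blinfun_apply A (g x) = g (blinfun_apply (conj_aut h A) x)" for A x
    by (simp add: conj_aut_apply[OF h] hh) (simp add: h_def oct_aut_inverse[OF g])
  consider (full) "?L = g2" | (fixed) "\<forall>A\<in>?L. blinfun_apply A (oe 1) = 0"
    | (plane) P where "assoc_plane P" "\<forall>A\<in>?L. \<forall>x\<in>P. blinfun_apply A x \<in> P"
    using subalgebra_containing_torus[OF L' torus] by blast
  then show ?thesis
  proof cases
    case full
    have "A \<in> L" if A: "A \<in> g2" for A
    proof -
      have "conj_aut h A \<in> ?L" using conj_aut_in_g2[OF h A] full by simp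
      then show ?thesis using cg by (metis imageE)
    qed
    then show ?thesis using g2 by blast
  next
    case fixed
    have g0: "g 0 = 0" using g by (simp add: oct_aut_def linear_0)
    have "g (oe 1) \<bullet> g (oe 1) = 1" using g by (simp add: oct_aut_def) (simp add: oct_inner)
    then have "g (oe 1) \<noteq> 0" by auto
    moreover have "g (oe 1) $ 0 = 0" by (simp add: oct_aut_one(2)[OF g])
    moreover have "blinfun_apply A (g (oe 1)) = 0" if "A \<in> L" for A
      using fixed that by (simp add: ap g0)
    ultimately show ?thesis by blast
  next
    case plane
    have lin: "linear g" and inj: "inj g" and mult: "\<And>x y. g (x \<odot> y) = g x \<odot> g y"
      and inn: "\<And>x y. g x \<bullet> g y = x \<bullet> y"
      using g inj_on_inverseI[of UNIV "inv g" g] oct_aut_inverse(2)[OF g] by (auto simp: oct_aut_def)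
    have "assoc_plane (g ` P)"
      unfolding assoc_plane_def
      using plane(1) dim_image_eq[OF lin, of P] inj_on_subset[OF inj, of "span P"]
      by (auto simp: assoc_plane_def linear_subspace_image[OF lin] oct_aut_one(2)[OF g] inn simp flip: mult)
    moreover have "\<forall>A\<in>L. \<forall>x\<in>g ` P. blinfun_apply A x \<in> g ` P"
      using plane(2) by (auto simp: ap)
    ultimately show ?thesis by blast
  qed
qed

section \<open>The vector equation\<close>

lemma S_inner: "S x \<bullet> S y = x \<bullet> y" "S x \<bullet> y = x \<bullet> S y"
  by (simp_all add: oct_inner S_nth)

lemma S_omult: "S (x \<odot> y) = S x \<odot> S y"
  using S_in_G2 by (simp add: G2_def)

lemma S_real_part: "S x $ 0 = x $ 0"
  by (rule S_nth)

lemma S_oe0: "S (oe 0) = oe 0"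
  by (rule S_oe)

lemma g2_subalgebra_g2: "g2_subalgebra g2"
  by (simp add: g2_subalgebra_def subspace_g2 bracket_in_g2)

lemma L_of_subalgebra:
  assumes Z: "Z \<in> g2"
  shows "g2_subalgebra (L_of Z)" "Z \<in> L_of Z" "conj_S Z \<in> L_of Z"
    "\<And>A. g2_subalgebra A \<Longrightarrow> Z \<in> A \<Longrightarrow> conj_S Z \<in> A \<Longrightarrow> L_of Z \<subseteq> A"
proof -
  have "\<Inter>T \<subseteq> g2" if "g2 \<in> T" for T :: "(oct \<Rightarrow>\<^sub>L oct) set set"
    using that by blast
  moreover have "g2 \<in> {t. g2_subalgebra t \<and> {Z, conj_S Z} \<subseteq> t}"
    using Z conj_S_in_g2 g2_subalgebra_g2 by auto
  ultimately show "g2_subalgebra (L_of Z)"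
    unfolding L_of_def hull_def g2_subalgebra_def[of "\<Inter>_"]
    by (intro conjI subspace_Inter) (auto simp: g2_subalgebra_def)
  show "Z \<in> L_of Z" "conj_S Z \<in> L_of Z"
    by (auto simp: L_of_def hull_inc)
  show "L_of Z \<subseteq> A" if "g2_subalgebra A" "Z \<in> A" "conj_S Z \<in> A" for A
    unfolding L_of_def using that by (intro hull_minimal) auto
qed

text \<open>The bracketed vector is the cross product of \<open>k\<close> and \<open>S k\<close>,
  that is, their product without its real part. If \<open>k\<close> and \<open>S k\<close> are
  dependent it vanishes, and \<open>k\<close> and \<open>S k\<close> are both killed by
  \<open>Z\<close>.\<close>

definition kernel_plane :: "(oct \<Rightarrow>\<^sub>L oct) \<Rightarrow> bool" where
  "kernel_plane Z \<longleftrightarrow> (\<exists>k l. k \<noteq> 0 \<and> k$0 = 0 \<and> blinfun_apply Z k = 0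
     \<and> blinfun_apply Z (S k) = l *\<^sub>R (k \<odot> S k + (k \<bullet> S k) *\<^sub>R oe 0))"

text \<open>The span of \<open>k\<close>, \<open>S k\<close> and their cross product is stable under
  \<open>Z\<close> and \<open>S\<close>, so \<open>L_of Z\<close> lies in its stabiliser. That
  stabiliser is proper, because some derivation moves \<open>k\<close> out of the span.\<close>

lemma kernel_plane_proper:
  assumes Z: "Z \<in> g2" and K: "kernel_plane Z"
  shows "L_of Z \<noteq> g2"
proof
  assume full: "L_of Z = g2"
  obtain k l where k: "k \<noteq> 0" "k$0 = 0" "blinfun_apply Z k = 0"
    "blinfun_apply Z (S k) = l *\<^sub>R (k \<odot> S k + (k \<bullet> S k) *\<^sub>R oe 0)"
    using K unfolding kernel_plane_def by blast
  define e where "e = k \<odot> S k + (k \<bullet> S k) *\<^sub>R oe 0"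
  let ?B = "{k, S k, e}"
  let ?P = "span ?B"
  have kk: "k \<odot> (k \<odot> x) = - (k \<bullet> k) *\<^sub>R x" for x
    by (rule imag_omult_twice(1)[OF k(2)])
  have Ze: "blinfun_apply Z e = l *\<^sub>R (k \<odot> e)"
    using g2_D[OF Z, of k "S k"] k
    by (simp add: e_def blinfun.bilinear_simps g2_one[OF Z] omult_bilinear)
  have ke: "k \<odot> e = - (k \<bullet> k) *\<^sub>R S k + (k \<bullet> S k) *\<^sub>R k"
    by (simp add: e_def omult_bilinear kk)
  \<comment> \<open>\<open>S\<close> exchanges the two factors of the cross product.\<close>
  have Se: "S e = - e"
    using k(2) by (simp add: e_def linear_add[OF linear_S] linear_cmul[OF linear_S] S_omult S_S S_oe0)
      (simp add: oct_eq_iff omult_nth oct_inner S_nth algebra_simps)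
  have Sp: "S x \<in> ?P" if "x \<in> ?P" for x
  proof -
    have "S ` ?B \<subseteq> ?P"
      by (auto simp: S_S Se span_base intro!: span_neg)
    then have "S ` ?P \<subseteq> ?P"
      by (metis linear_S linear_span_image span_minimal subspace_span)
    then show ?thesis using that by blast
  qed
  have Zp: "blinfun_apply Z x \<in> ?P" if "x \<in> ?P" for x
  proof -
    have "blinfun_apply Z ` ?B \<subseteq> ?P"
      using k(3,4) by (auto simp: Ze ke span_base span_zero e_def[symmetric] intro!: span_scale span_add span_neg span_diff)
    then have "blinfun_apply Z ` ?P \<subseteq> ?P"
      by (metis linear_blinfun_apply linear_span_image span_minimal subspace_span)
    then show ?thesis using that by blast
  qed
  define A where "A = {X \<in> g2. \<forall>x\<in>?P. blinfun_apply X x \<in> ?P}"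
  have "g2_subalgebra A"
    unfolding g2_subalgebra_def
    by (auto simp: A_def subspace_def blinfun.bilinear_simps bracket_apply bracket_in_g2
        subspace_0[OF subspace_g2] subspace_add[OF subspace_g2] subspace_scale[OF subspace_g2]
        intro: span_zero span_add span_scale span_diff)
  moreover have "Z \<in> A" using Z Zp by (simp add: A_def)
  moreover have "conj_S Z \<in> A"
    using conj_S_in_g2[OF Z] Zp Sp by (simp add: A_def blinfun_apply_conj_S)
  ultimately have sub: "g2 \<subseteq> A" using L_of_subalgebra(4)[OF Z] full by blast
  have "\<exists>x. x \<noteq> 0 \<and> (\<forall>c\<in>{oe 0, k, S k, e}. x \<bullet> c = 0)"
    by (rule exists_orthogonal) (auto simp: card_insert_if)
  then obtain x where x: "x \<noteq> 0" "x$0 = 0" "x \<bullet> k = 0" "\<And>c. c \<in> ?B \<Longrightarrow> orthogonal x c"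
    by (auto simp: oct_inner[of _ "oe 0"] orthogonal_def)
  define f1 f2 where "f1 = k /\<^sub>R norm k" and "f2 = x /\<^sub>R norm x"
  have f: "f1$0 = 0" "f2$0 = 0" "f1 \<bullet> f1 = 1" "f2 \<bullet> f2 = 1" "f1 \<bullet> f2 = 0"
    using k x by (auto simp: f1_def f2_def dot_square_norm power2_eq_square inner_commute)
  have "\<exists>x. x \<noteq> 0 \<and> (\<forall>c\<in>{oe 0, f1, f2, f1 \<odot> f2}. x \<bullet> c = 0)"
    by (rule exists_orthogonal) (auto simp: card_insert_if)
  then obtain y where y: "y \<noteq> 0" "y$0 = 0" "y \<bullet> f1 = 0" "y \<bullet> f2 = 0" "y \<bullet> (f1 \<odot> f2) = 0"
    by (auto simp: oct_inner[of _ "oe 0"])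
  define f4 where "f4 = y /\<^sub>R norm y"
  have f4: "f4$0 = 0" "f4 \<bullet> f4 = 1" "f1 \<bullet> f4 = 0" "f2 \<bullet> f4 = 0" "(f1 \<odot> f2) \<bullet> f4 = 0"
    using y by (auto simp: f4_def dot_square_norm power2_eq_square inner_commute)
  obtain g where g: "oct_aut g" "g (oe 1) = f1" "g (oe 2) = f2"
    using adapted_oct_aut[of f1 f2 f4] f f4 by metis
  \<comment> \<open>The derivation with \<open>z1 = 1\<close> maps \<open>oe 1\<close> to
    \<open>oe 2\<close>; its conjugate maps the direction of \<open>k\<close> to one orthogonal to
    the span.\<close>
  let ?X = "conj_aut g (der 0 0 0 0 0 1 0 0)"
  have "inv g f1 = oe 1" using oct_aut_inverse(2)[OF g(1)] g(2) by metis
  then have "blinfun_apply ?X f1 = f2"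
    using g(3) by (simp add: conj_aut_apply[OF g(1)] oe_eq_vv der_vv der_fun_def)
  moreover have "?X \<in> A" using conj_aut_in_g2[OF g(1) der_in_g2] sub by blast
  moreover have "f1 \<in> ?P" by (simp add: f1_def span_scale span_base)
  ultimately have "f2 \<in> ?P" by (auto simp: A_def)
  then have "orthogonal x f2" by (rule orthogonal_to_span) (use x in blast)
  then show False using x by (simp add: f2_def orthogonal_def)
qed

lemma kernel_planeI_fixed:
  assumes "f \<noteq> 0" "f$0 = 0" "blinfun_apply Z f = 0" "blinfun_apply Z (S f) = 0"
  shows "kernel_plane Z"
  unfolding kernel_plane_def using assms by (intro exI[of _ f] exI[of _ 0]) simp

text \<open>A skew operator vanishes on an invariant line.\<close>

lemma kernel_planeI_line:
  assumes Z: "Z \<in> g2" and M: "subspace M" "dim M = 1" "\<And>x. x \<in> M \<Longrightarrow> x$0 = 0"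
    and inv: "\<And>x. x \<in> M \<Longrightarrow> blinfun_apply Z x \<in> M" "\<And>x. x \<in> M \<Longrightarrow> S x \<in> M"
  shows "kernel_plane Z"
proof -
  have Z0: "blinfun_apply Z x = 0" if "x \<in> M" for x
  proof (rule ccontr)
    assume n: "blinfun_apply Z x \<noteq> 0"
    then have "x \<noteq> 0" by (auto simp: blinfun.zero_right)
    then show False
      using dim_orthogonal_pair[OF M(1) that inv(1)[OF that]] n g2_skew[OF Z, of x] M(2)
      by (simp add: inner_commute)
  qed
  have "\<not> M \<subseteq> {0}" using M(2) by (simp flip: dim_eq_0)
  then obtain f where "f \<in> M" "f \<noteq> 0" by blast
  then show ?thesis using Z0 inv M(3) by (intro kernel_planeI_fixed[of f]) auto
qed

lemma assoc_planeD:
  assumes "assoc_plane P"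
  shows "subspace P" "dim P = 3" "x \<in> P \<Longrightarrow> x$0 = 0" "x \<in> P \<Longrightarrow> y \<in> P \<Longrightarrow> x \<bullet> y = 0 \<Longrightarrow> x \<odot> y \<in> P"
  using assms by (auto simp: assoc_plane_def)

lemma assoc_plane_S:
  assumes P: "assoc_plane P"
  shows "assoc_plane (S ` P)"
proof -
  have "inj S" by (metis S_S injI)
  then have "dim (S ` P) = 3"
    using dim_image_eq[OF linear_S, of P] assoc_planeD(2)[OF P] by (metis inj_on_subset subset_UNIV)
  then show ?thesis
    using P by (auto simp: assoc_plane_def linear_subspace_image[OF linear_S] S_real_part S_inner
        S_S simp flip: S_omult)
qed

lemma kernel_planeI_invariant:
  assumes Z: "Z \<in> g2" and P: "assoc_plane P"
    and inv: "\<And>x. x \<in> P \<Longrightarrow> blinfun_apply Z x \<in> P" "\<And>x. x \<in> P \<Longrightarrow> blinfun_apply (conj_S Z) x \<in> P"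
  shows "kernel_plane Z"
proof -
  let ?Z = "blinfun_apply Z" and ?Q = "S ` P"
  have Q: "assoc_plane ?Q" by (rule assoc_plane_S[OF P])
  note PD = assoc_planeD[OF P] and QD = assoc_planeD[OF Q]
  have invQ: "?Z x \<in> ?Q" if x: "x \<in> ?Q" for x
  proof -
    obtain y where "x = S y" "y \<in> P" using x by blast
    then have "?Z x = S (blinfun_apply (conj_S Z) y)" by (simp add: blinfun_apply_conj_S S_S)
    then show ?thesis using inv(2) \<open>y \<in> P\<close> by blast
  qed
  have SPQ: "S x \<in> ?Q" if "x \<in> P" for x using that by blast
  have SQP: "S x \<in> P" if "x \<in> ?Q" for x using that by (auto simp: S_S)
  have I: "subspace (P \<inter> ?Q)" using PD(1) QD(1) by (rule subspace_inter)
  have "dim (P \<inter> ?Q) \<le> 3" using dim_subset[of "P \<inter> ?Q" P] PD(2) by simp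
  then consider "dim (P \<inter> ?Q) = 0" | "dim (P \<inter> ?Q) = 1" | "dim (P \<inter> ?Q) = 2" | "dim (P \<inter> ?Q) = 3"
    by linarith
  then show ?thesis
  proof cases
    case 1
    define T where "T = {x + y |x y. x \<in> P \<and> y \<in> ?Q}"
    have T6: "dim T = 6"
      using dim_sums_Int[OF PD(1) QD(1)] 1 PD(2) QD(2) by (simp add: T_def)
    have T: "subspace T" unfolding T_def by (rule subspace_sums[OF PD(1) QD(1)])
    have T_im: "T \<subseteq> {x. x$0 = 0}" using PD(3) QD(3) by (auto simp: T_def)
    define M where "M = {y \<in> {x. x$0 = 0}. \<forall>x\<in>T. orthogonal x y}"
    have "dim M + dim T = 7"
      unfolding M_def using dim_subspace_orthogonal_to_vectors[OF T subspace_imag T_im] dim_imag by simp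
    then have "dim M = 1" using T6 by simp
    moreover have "subspace M"
      by (auto simp: M_def subspace_def orthogonal_def inner_add_right)
    moreover have "?Z x \<in> M" if "x \<in> M" for x
    proof -
      have "?Z y \<in> T" if y: "y \<in> T" for y
      proof -
        obtain p q where "y = p + q" "p \<in> P" "q \<in> ?Q" using y by (auto simp: T_def)
        then have "?Z y = ?Z p + ?Z q" "?Z p \<in> P" "?Z q \<in> ?Q"
          using inv(1) invQ by (simp_all add: blinfun.add_right)
        then show ?thesis unfolding T_def by blast
      qed
      then show ?thesis
        using that g2_imag[OF Z] g2_adjoint[OF Z] by (auto simp: M_def orthogonal_def) (metis inner_commute neg_0_equal_iff_equal)
    qed
    moreover have "S x \<in> M" if "x \<in> M" for x
    proof -
      have "S y \<in> T" if y: "y \<in> T" for y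
      proof -
        obtain p q where "y = p + q" "p \<in> P" "q \<in> ?Q" using y by (auto simp: T_def)
        then have "S y = S q + S p" "S q \<in> P" "S p \<in> ?Q"
          using SPQ SQP by (auto simp: linear_add[OF linear_S])
        then show ?thesis unfolding T_def by blast
      qed
      then show ?thesis
        using that by (auto simp: M_def orthogonal_def S_real_part simp flip: S_inner(2))
    qed
    moreover have "x$0 = 0" if "x \<in> M" for x using that by (simp add: M_def)
    ultimately show ?thesis by (intro kernel_planeI_line[OF Z, of M]) blast+
  next
    case 2
    then show ?thesis
      using inv(1) invQ SPQ SQP PD(3) by (intro kernel_planeI_line[OF Z I]) auto
  next
    case 3
    obtain B where B: "B \<subseteq> P \<inter> ?Q" "pairwise orthogonal B" "\<And>x. x \<in> B \<Longrightarrow> norm x = 1" "card B = 2"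
      using orthonormal_basis_subspace[OF I] 3 by metis
    then obtain x y where xy: "B = {x, y}" "x \<noteq> y" by (auto simp: card_2_iff)
    have "norm x = 1" "norm y = 1" using B(3) xy by simp_all
    then have xy0: "x \<noteq> 0" "y \<noteq> 0" "x \<bullet> y = 0" "x \<in> P \<inter> ?Q" "y \<in> P \<inter> ?Q"
      using B(1,2) xy by (auto simp: pairwise_def orthogonal_def)
    have im: "x$0 = 0" "y$0 = 0" using xy0 PD(3) by auto
    have "x \<odot> y \<in> P \<inter> ?Q" using xy0 PD(4) QD(4) by blast
    moreover have "(x \<odot> y) \<bullet> (x \<odot> y) \<noteq> 0" using inner_omult(1)[OF im(1)] xy0 by simp
    ultimately have "x \<odot> y \<in> {z \<in> P \<inter> ?Q. z \<bullet> x = 0 \<and> z \<bullet> y = 0}" "x \<odot> y \<noteq> 0"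
      using imag_omult_orthogonal[OF im] by auto
    moreover have "dim {z \<in> P \<inter> ?Q. z \<bullet> x = 0 \<and> z \<bullet> y = 0} = 0"
      using dim_orthogonal_pair[OF I xy0(4,5,1,2,3)] 3 by simp
    ultimately show ?thesis unfolding dim_eq_0 by blast
  next
    case 4
    have "P \<inter> ?Q = P" by (rule subspace_dim_equal[OF I PD(1)]) (simp_all add: 4 PD(2))
    moreover have "P \<inter> ?Q = ?Q" by (rule subspace_dim_equal[OF I QD(1)]) (simp_all add: 4 QD(2))
    ultimately have "P = ?Q" by simp
    then have SP: "S x \<in> P" if "x \<in> P" for x using that SPQ by simp
    have "\<exists>x\<in>P. x \<noteq> 0 \<and> ?Z x = 0"
      using PD inv(1) g2_skew[OF Z] by (intro skew_odd_kernel linear_blinfun_apply) auto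
    then obtain k where k: "k \<in> P" "k \<noteq> 0" "?Z k = 0" by blast
    have k0: "k$0 = 0" "k \<bullet> k \<noteq> 0" using k PD(3) by auto
    \<comment> \<open>The part of \<open>S k\<close> orthogonal to \<open>k\<close>; it has the same
      image under \<open>Z\<close> and the same cross product with \<open>k\<close>.\<close>
    define y where "y = S k - ((k \<bullet> S k) / (k \<bullet> k)) *\<^sub>R k"
    have y: "y \<in> P" "k \<bullet> y = 0"
      using k k0 SP PD(1) by (auto simp: y_def subspace_diff subspace_scale inner_diff_right)
    have Zy: "?Z (S k) = ?Z y" by (simp add: y_def blinfun.bilinear_simps k)
    have ky: "k \<odot> S k + (k \<bullet> S k) *\<^sub>R oe 0 = k \<odot> y"
      using k0 by (simp add: y_def omult_bilinear imag_square)
    show ?thesis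
    proof (cases "y = 0")
      case True
      then show ?thesis using k k0 Zy by (intro kernel_planeI_fixed[of k]) (auto simp: blinfun.zero_right)
    next
      case False
      let ?N = "{z \<in> P. z \<bullet> k = 0 \<and> z \<bullet> y = 0}"
      define e where "e = k \<odot> y"
      have dimN: "dim ?N = 1" using dim_orthogonal_pair[OF PD(1) k(1) y(1) k(2) False y(2)] PD(2) by simp
      have N: "subspace ?N" using PD(1) by (auto simp: subspace_def inner_add_left)
      have eN: "e \<in> ?N"
        using PD(4)[OF k(1) y] imag_omult_orthogonal[OF k0(1) PD(3)[OF y(1)]] by (simp add: e_def)
      have e0: "e \<bullet> e \<noteq> 0" using inner_omult(1)[OF k0(1)] k0 False by (simp add: e_def)
      have vN: "?Z y \<in> ?N"
        using inv(1)[OF y(1)] g2_skew[OF Z] g2_adjoint[OF Z, of y k] k by simp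
      \<comment> \<open>\<open>Z y\<close> lies in the line \<open>?N\<close> spanned by
        \<open>e\<close>, so its component \<open>v\<close> orthogonal to \<open>e\<close>
        vanishes.\<close>
      define v where "v = ?Z y - ((?Z y \<bullet> e) / (e \<bullet> e)) *\<^sub>R e"
      have v: "v \<in> ?N" "v \<bullet> e = 0"
        unfolding v_def using subspace_diff[OF N vN subspace_scale[OF N eN]] e0
        by (auto simp: inner_diff_left)
      have "v = 0"
      proof (rule ccontr)
        assume "v \<noteq> 0"
        then show False using dim_orthogonal_pair[OF N v(1) eN] v(2) e0 dimN by auto
      qed
      then have "?Z (S k) = ((?Z y \<bullet> e) / (e \<bullet> e)) *\<^sub>R (k \<odot> S k + (k \<bullet> S k) *\<^sub>R oe 0)"
        by (simp add: v_def Zy ky e_def)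
      then show ?thesis unfolding kernel_plane_def using k k0 by blast
    qed
  qed
qed

lemma proper_L_of_cases:
  assumes Z: "Z \<in> g2" and proper: "L_of Z \<noteq> g2"
  shows "kernel_plane Z \<or>
    (\<exists>\<alpha> \<beta>. bracket Z (bracket Z (conj_S Z)) = \<alpha> *\<^sub>R Z + \<beta> *\<^sub>R conj_S Z)"
proof (cases "\<exists>X\<in>L_of Z. \<exists>Y\<in>L_of Z. bracket X Y = 0 \<and> X \<noteq> 0 \<and> (\<forall>c. Y \<noteq> c *\<^sub>R X)")
  case True
  note L = L_of_subalgebra[OF Z]
  from True obtain X Y where "X \<in> L_of Z" "Y \<in> L_of Z" "bracket X Y = 0" "X \<noteq> 0" "\<And>c. Y \<noteq> c *\<^sub>R X"
    by blast
  from rank_two_subalgebra[OF L(1) this] proper consider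
      (fixed) f where "f \<noteq> 0" "f$0 = 0" "\<forall>X\<in>L_of Z. blinfun_apply X f = 0"
    | (plane) P where "assoc_plane P" "\<forall>X\<in>L_of Z. \<forall>x\<in>P. blinfun_apply X x \<in> P"
    by blast
  then have "kernel_plane Z"
  proof cases
    case fixed
    have "S (blinfun_apply Z (S f)) = 0"
      using fixed(3) L(3) by (simp flip: blinfun_apply_conj_S)
    then have "blinfun_apply Z (S f) = 0" by (metis S_S linear_0 linear_S)
    then show ?thesis using fixed L by (intro kernel_planeI_fixed[of f]) auto
  next
    case plane
    then show ?thesis using L by (intro kernel_planeI_invariant[OF Z, of P]) auto
  qed
  then show ?thesis ..
next
  case False
  then show ?thesis
    using g2_rank_one_double_bracket[OF L_of_subalgebra(1)[OF Z] _ L_of_subalgebra(2,3)[OF Z]]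
    by blast
qed

section \<open>Elimination of the kernel vector\<close>

text \<open>
  The real form of the condition \<open>kernel_plane\<close> for the elements \<open>Zf a d q p\<close> of \<open>k_A\<close> defined below,
  when \<open>q \<noteq> 0\<close>. A kernel vector must have the coordinates \<open>k = (a c; c q, s q, \<eta> q\<^sup>*\<^sup>2)\<close> with real \<open>c\<close>,
  \<open>s\<close>. Here \<open>u = |q|\<^sup>2\<close>, \<open>\<eta> = h1 + \<i> h2\<close> and \<open>x + \<i> y = \<rho> = p q\<^sup>* / q\<^sup>2\<close>.
\<close>

definition kernel_equations ::
    "real \<Rightarrow> real \<Rightarrow> real \<Rightarrow> real \<Rightarrow> real \<Rightarrow> real \<Rightarrow> real \<Rightarrow> real \<Rightarrow> real \<Rightarrow> real \<Rightarrow> bool" where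
  "kernel_equations a d u x y c s h1 h2 l \<longleftrightarrow> (c \<noteq> 0 \<or> s \<noteq> 0 \<or> h1 \<noteq> 0 \<or> h2 \<noteq> 0)
    \<and> u * (x * h1 - y * h2 - h1) = 0 \<and> (d - a) * s = u * (x * h2 + y * h1 + h2)
    \<and> s * (x - 1) = - (a + d) * h2 \<and> - s * y = (a + d) * h1
    \<and> l * (s + c) * u * h1 = 0 \<and> 2 * a * (s - c) = l * (a * c * (s - c) + (s + c) * u * h2)
    \<and> (d - a) * c + u * (x * h2 + y * h1 + h2) = l * (a * c * (c - s) - (s + c) * u * h2)
    \<and> c * (x - 1) - (a + d) * h2 = l * (2 * a * c * h2 + c\<^sup>2 - s\<^sup>2)
    \<and> - c * y + (a + d) * h1 = - 2 * l * a * c * h1"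

text \<open>The alternatives are conditions (ii) to (vi) in terms of \<rho> = x + iy. If only
  \<open>c\<close> is nonzero, then \<open>a = 0\<close> gives (iv) and \<open>l * c = 2\<close>
  gives (v). Otherwise \<open>a + d = 0\<close> leads to (iii), \<open>a = 0\<close> to (ii), and
  the remaining case to (vi).\<close>

lemma kernel_plane_solution_cases:
  fixes a d u x y c s h1 h2 l :: real
  assumes u: "u > 0" and eqs: "kernel_equations a d u x y c s h1 h2 l"
  shows "(a = 0 \<and> d\<^sup>2 + (x\<^sup>2 + y\<^sup>2) * u = u) \<or> (d = - a \<and> x\<^sup>2 + y\<^sup>2 = 1)
    \<or> (a = 0 \<and> d = 0 \<and> y = 0) \<or> (d = 3 * a \<and> x = 3 \<and> y = 0)
    \<or> (a\<^sup>2 + u = d\<^sup>2 + (x\<^sup>2 + y\<^sup>2) * u \<and> y = 0 \<and> (2 * x\<^sup>2 + 3) * a - 3 * d - (a + d) * x = 0)"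
proof -
  from eqs have nz: "c \<noteq> 0 \<or> s \<noteq> 0 \<or> h1 \<noteq> 0 \<or> h2 \<noteq> 0"
    and E3: "u * (x * h1 - y * h2 - h1) = 0" "(d - a) * s = u * (x * h2 + y * h1 + h2)"
    and E4: "s * (x - 1) = - (a + d) * h2" "- s * y = (a + d) * h1"
    and F1: "l * (s + c) * u * h1 = 0" "2 * a * (s - c) = l * (a * c * (s - c) + (s + c) * u * h2)"
    and F2: "(d - a) * c + u * (x * h2 + y * h1 + h2) = l * (a * c * (c - s) - (s + c) * u * h2)"
    and F3: "c * (x - 1) - (a + d) * h2 = l * (2 * a * c * h2 + c\<^sup>2 - s\<^sup>2)"
      "- c * y + (a + d) * h1 = - 2 * l * a * c * h1"
    unfolding kernel_equations_def by blast+
  show ?thesis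
  proof (cases "s = 0 \<and> h1 = 0 \<and> h2 = 0")
    case True
    then have c: "c \<noteq> 0" using nz by blast
    have "c * (a * (2 - l * c)) = 0" "c * (d - a - l * a * c) = 0" "c * (x - 1 - l * c) = 0" "c * y = 0"
      using F1 F2 F3 True by (auto simp: power2_eq_square algebra_simps)
    then have e: "a * (2 - l * c) = 0" "d - a = l * a * c" "x - 1 = l * c" "y = 0"
      using c by auto
    show ?thesis
    proof (cases "a = 0")
      case False
      then have lc: "l * c = 2" using e(1) by simp
      have "d - a = (l * c) * a" using e(2) by (simp add: mult_ac)
      then show ?thesis using e(3,4) by (simp add: lc)
    qed (use e in simp)
  next
    case n: False
    \<comment> \<open>Adding the second equation of \<open>F1\<close> to \<open>F2\<close> cancels
      both right-hand sides.\<close>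
    have lin: "s * (a + d) = c * (3 * a - d)"
      using F1(2) F2 E3(2) by algebra
    show ?thesis
    proof (cases "a + d = 0")
      case True
      then have sx: "s * (x - 1) = 0" "s * y = 0" using E4 by auto
      \<comment> \<open>If \<open>s\<close> is nonzero, \<rho> = 1. If \<open>s = 0\<close>, then
        \<open>E3\<close> says that \<rho> maps a nonzero \<eta> to its conjugate, so |\<rho>| =
        1.\<close>
      have "x\<^sup>2 + y\<^sup>2 = 1"
      proof (cases "s = 0")
        case True
        then have "x * h1 - y * h2 = h1" "x * h2 + y * h1 = - h2" using E3 u by auto
        note e = this
        have "(x\<^sup>2 + y\<^sup>2 - 1) * h1 = x * (x * h1 - y * h2) + y * (x * h2 + y * h1) - h1"
          "(x\<^sup>2 + y\<^sup>2 - 1) * h2 = x * (x * h2 + y * h1) - y * (x * h1 - y * h2) - h2"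
          by (simp_all add: algebra_simps power2_eq_square)
        then have "(x\<^sup>2 + y\<^sup>2 - 1) * h1 = x * h1 + y * (- h2) - h1"
          "(x\<^sup>2 + y\<^sup>2 - 1) * h2 = x * (- h2) - y * h1 - h2"
          by (simp_all only: e)
        then have "(x\<^sup>2 + y\<^sup>2 - 1) * h1 = 0" "(x\<^sup>2 + y\<^sup>2 - 1) * h2 = 0"
          using e by linarith+
        then show ?thesis using n True by auto
      qed (use sx in auto)
      then show ?thesis using True by auto
    next
      case ad: False
      have s: "s \<noteq> 0" using n E4 ad by auto
      have c: "c \<noteq> 0" using lin s ad by auto
      \<comment> \<open>The second equation of \<open>E3\<close> times \<open>a + d\<close>, with
        \<open>E4\<close> substituted.\<close>
      have "s * ((a - d) * (a + d) - u * (x\<^sup>2 + y\<^sup>2 - 1)) = 0"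
        using E3 E4 by algebra
      then have del: "(a - d) * (a + d) = u * (x\<^sup>2 + y\<^sup>2 - 1)" using s by simp
      then have del': "a\<^sup>2 + u = d\<^sup>2 + (x\<^sup>2 + y\<^sup>2) * u"
        by (simp add: algebra_simps power2_eq_square)
      show ?thesis
      proof (cases "a = 0")
        case True
        then show ?thesis using del' by auto
      next
        case a: False
        \<comment> \<open>Parametrises the solutions of \<open>lin\<close>; then
          \<open>s + c = 4 * a * t\<close> is nonzero.\<close>
        define t where "t = c / (a + d)"
        have t: "c = (a + d) * t" "t \<noteq> 0" using ad c by (auto simp: t_def)
        have st: "s = (3 * a - d) * t" using lin ad by (simp add: t_def field_simps)
        have "(a + d) * ((2 + l * s) * (x - 1) - 4 * l * (d - a) * t) * (2 * a * t) = 0"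
          using F3(1) E4(1) t(1) st by algebra
        then have A2: "(2 + l * s) * (x - 1) = 4 * l * (d - a) * t" using ad a t by simp
        have "a * t * ((a - d) * (a + d) * (2 - l * c) + 2 * l * u * s * (x - 1)) = 0"
          using F1(2) E4(1) t(1) st by algebra
        then have A1: "(a - d) * (a + d) * (2 - l * c) = - 2 * l * u * s * (x - 1)" using a t by simp
        have y: "y = 0"
        proof (cases "l = 0")
          case True
          then have "c * y = (a + d) * h1" using F3 by simp
          moreover have "4 * a * t * y = (s + c) * y" using st t by algebra
          ultimately have "4 * a * t * y = 0" using E4(2) by algebra
          then show ?thesis using a t by simp
        next
          case False
          have "l * u * (4 * a * t * h1) = 0" using F1(1) st t(1) by algebra
          then have "h1 = 0" using False a t u by simp
          then show ?thesis using E4 s by simp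
        qed
        have "(2 * x\<^sup>2 + 3) * a - 3 * d - (a + d) * x = 0"
        proof (cases "x = 1")
          case True
          then have "a = d" using del y ad by simp
          then show ?thesis using True by simp
        next
          case x: False
          have "u * (x - 1) * ((x + 1) * (2 - l * c) + 2 * l * s) = 0"
            using A1 del y by algebra
          then have B: "(x + 1) * (2 - l * c) + 2 * l * s = 0" using u x by simp
          have "l * t \<noteq> 0" using A2 x t(2) by auto
          \<comment> \<open>Cross-multiplying \<open>A2\<close> and \<open>B\<close> eliminates
            their terms without \<open>l\<close>.\<close>
          moreover have "l * t * ((2 * x\<^sup>2 + 3) * a - 3 * d - (a + d) * x) = 0"
            using A2 B t(1) st by algebra
          ultimately show ?thesis by simp
        qed
        then show ?thesis using del' y by blast
      qed
    qed
  qed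
qed

lemma kernel_plane_solution_exists:
  fixes a d u x y :: real
  assumes u: "u > 0" and cond: "(a = 0 \<and> d\<^sup>2 + (x\<^sup>2 + y\<^sup>2) * u = u) \<or> (d = - a \<and> x\<^sup>2 + y\<^sup>2 = 1)
    \<or> (a = 0 \<and> d = 0 \<and> y = 0) \<or> (d = 3 * a \<and> x = 3 \<and> y = 0)
    \<or> (a\<^sup>2 + u = d\<^sup>2 + (x\<^sup>2 + y\<^sup>2) * u \<and> y = 0 \<and> (2 * x\<^sup>2 + 3) * a - 3 * d - (a + d) * x = 0)"
  shows "\<exists>c s h1 h2 l. kernel_equations a d u x y c s h1 h2 l"
    (is "\<exists>c s h1 h2 l. ?P c s h1 h2 l")
proof -
  have iii: ?thesis if "d = - a" "x\<^sup>2 + y\<^sup>2 = 1"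
  proof (cases "x = -1")
    case True
    then have "y = 0" using that by simp
    then have "?P 0 0 0 1 0" using True that by (simp add: kernel_equations_def)
    then show ?thesis by blast
  next
    case False
    \<comment> \<open>\<eta> = 1 + cnj(\<rho>) solves \<rho> \<eta> = cnj(\<eta>) on the unit
      circle. It vanishes only at \<rho> = -1, where \<eta> = i was used instead.\<close>
    have "x * (1 + x) + y * y - (1 + x) = 0" using that(2) by algebra
    moreover have "x * (- y) + y * (1 + x) + - y = 0" by algebra
    ultimately have "?P 0 0 (1 + x) (- y) 0" using False that by (simp add: kernel_equations_def algebra_simps)
    then show ?thesis by blast
  qed
  have ii: ?thesis if a0: "a = 0" and e: "d\<^sup>2 + (x\<^sup>2 + y\<^sup>2) * u = u"
  proof (cases "d = 0")
    case True
    then have "x\<^sup>2 + y\<^sup>2 = 1" using e u by simp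
    then show ?thesis using iii True a0 by simp
  next
    case False
    \<comment> \<open>For \<open>a = 0\<close>, \<open>c = 1\<close>, \<open>s = -1\<close> the
      vector satisfies \<open>S k = - k\<close>, so only \<open>Z k = 0\<close> is left; its last
      complex equation determines \<eta>.\<close>
    define h1 h2 where "h1 = y / d" and "h2 = (x - 1) / d"
    have h: "d * h1 = y" "d * h2 = x - 1" using False by (simp_all add: h1_def h2_def)
    have "d * (x * h1 - y * h2 - h1) = x * (d * h1) - y * (d * h2) - d * h1"
      by (simp add: algebra_simps)
    also have "\<dots> = 0" unfolding h by (simp add: algebra_simps)
    finally have "d * (x * h1 - y * h2 - h1) = 0" .
    then have f1: "x * h1 - y * h2 - h1 = 0" using False by simp
    have "d * (u * (x * h2 + y * h1 + h2) + d) = u * (x * (d * h2) + y * (d * h1) + d * h2) + d\<^sup>2"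
      by (simp add: algebra_simps power2_eq_square)
    also have "\<dots> = 0" unfolding h using e by (simp add: algebra_simps power2_eq_square)
    finally have f2: "u * (x * h2 + y * h1 + h2) = - d" using False by simp
    have "?P 1 (- 1) h1 h2 0" using a0 by (simp add: kernel_equations_def f1 f2 h)
    then show ?thesis by blast
  qed
  have iv: ?thesis if "a = 0" "d = 0" "y = 0"
  proof -
    have "?P 1 0 0 0 (x - 1)" using that by (simp add: kernel_equations_def)
    then show ?thesis by blast
  qed
  have v: ?thesis if "d = 3 * a" "x = 3" "y = 0"
  proof -
    have "?P 1 0 0 0 2" using that by (simp add: kernel_equations_def)
    then show ?thesis by blast
  qed
  have vi: ?thesis
    if del: "a\<^sup>2 + u = d\<^sup>2 + (x\<^sup>2 + y\<^sup>2) * u" and y: "y = 0"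
      and th: "(2 * x\<^sup>2 + 3) * a - 3 * d - (a + d) * x = 0"
  proof -
    consider "a = 0" | "a + d = 0" | "x = 1" "a \<noteq> 0" "a + d \<noteq> 0" | "x \<noteq> 1" "a \<noteq> 0" "a + d \<noteq> 0"
      by blast
    then show ?thesis
    proof cases
      case 1
      then show ?thesis using ii del y by simp
    next
      case 2
      then have d: "d = - a" by simp
      then have "x\<^sup>2 + y\<^sup>2 = 1" using del u by simp
      then show ?thesis using iii d by blast
    next
      case 3
      then have "(a - d) * (a + d) = 0" using del y by (simp add: algebra_simps power2_eq_square)
      \<comment> \<open>Here \<open>a = d\<close>, and the vector (a; q, q, 0) is fixed by
        \<open>S\<close>.\<close>
      then have "?P 1 1 0 0 0" using 3 y by (simp add: kernel_equations_def)
      then show ?thesis by blast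
    next
      case 4
      \<comment> \<open>\<open>c\<close> and \<open>s\<close> solve the linear relation between them
        with \<open>t = 1\<close>, and \<open>h\<close> solves the last equation of
        \<open>Z k = 0\<close>. The value of \<open>l\<close> solves the last equation for
        \<open>Z (S k)\<close>, simplified by \<open>th\<close>.\<close>
      define c s h where "c = a + d" and "s = 3 * a - d" and "h = - (s * (x - 1) / c)"
      define l where "l = 1 / ((x - 1) * a)"
      have c: "c \<noteq> 0" using 4 by (simp add: c_def)
      have hc: "c * h = - s * (x - 1)" using c by (simp add: h_def)
      have l: "l * ((x - 1) * a) = 1" using 4 by (simp add: l_def)
      have "c * ((d - a) * s - u * (x * h + h)) = 0" using hc del y c_def by algebra
      then have e1: "(d - a) * s = u * (x * h + h)" using c by simp
      have "c * (x - 1) * (2 * a * (s - c) - l * (a * c * (s - c) + (s + c) * u * h)) = 0"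
        using hc del y c_def s_def l th by algebra
      then have e2: "2 * a * (s - c) = l * (a * c * (s - c) + (s + c) * u * h)" using c 4 by simp
      have e3: "(d - a) * c + u * (x * h + h) = l * (a * c * (c - s) - (s + c) * u * h)"
        using e1 e2 c_def s_def by algebra
      have "(x - 1) * (c * (x - 1) - (a + d) * h - l * (2 * a * c * h + c\<^sup>2 - s\<^sup>2)) = 0"
        using hc l th c_def s_def by algebra
      then have e4: "c * (x - 1) - (a + d) * h = l * (2 * a * c * h + c\<^sup>2 - s\<^sup>2)" using 4 by simp
      have "s * (x - 1) = (- a - d) * h" using hc by (simp add: c_def algebra_simps)
      then have "?P c s 0 h l" using c e1 e2 e3 e4 y by (simp add: kernel_equations_def c_def)
      then show ?thesis by blast
    qed
  qed
  show ?thesis using cond ii iii iv v vi by blast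
qed

section \<open>Kernel planes for the elements of \<open>k_A\<close>\<close>

definition Zf :: "real \<Rightarrow> real \<Rightarrow> complex \<Rightarrow> complex \<Rightarrow> (oct \<Rightarrow>\<^sub>L oct)" where
  "Zf a d q p = der (2 * a) (d - a) 0 0 (cnj p) (- 2 * \<i> * q) 0 0"

lemma Zf_in_g2: "Zf a d q p \<in> g2"
  by (simp add: Zf_def der_in_g2)

text \<open>On the span of \<open>oe 1\<close>, \<open>oe 2\<close>, \<open>oe 3\<close> this is
  twice the cross product with (a, q); hence the part (ac, cq) of a kernel vector for
  \<open>q \<noteq> 0\<close>.\<close>

lemma Zf_apply:
  "blinfun_apply (Zf a d q p) (vv r w1 w2 w3) =
     vv (2 * Im (cnj q * w1)) (- 2 * \<i> * r * q + 2 * \<i> * a * w1)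
       (\<i> * (d - a) * w2 - p * w3 + cnj q * cnj w3) (cnj p * w2 - \<i> * (a + d) * w3 - cnj q * cnj w2)"
  by (simp add: Zf_def der_vv der_fun_def algebra_simps)

text \<open>The powers of \<open>q\<close> and \<open>cnj q\<close> in \<open>k\<close> are chosen
  so that they factor out of every component, leaving equations in \<open>u\<close> and
  \<rho>.\<close>

lemma kernel_plane_vectors:
  fixes a d c s u l :: real and q \<rho> \<eta> :: complex
  assumes q: "q \<noteq> 0" and p: "p * cnj q = \<rho> * q\<^sup>2" and u: "complex_of_real u = q * cnj q"
  defines "k \<equiv> vv (a * c) (c * q) (s * q) (\<eta> * (cnj q)\<^sup>2)"
  shows "blinfun_apply (Zf a d q p) k = 0 \<longleftrightarrow>
      \<i> * (d - a) * s = u * (\<rho> * \<eta> - cnj \<eta>) \<and> s * (cnj \<rho> - 1) = \<i> * (a + d) * \<eta>"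
    and "blinfun_apply (Zf a d q p) (S k) = l *\<^sub>R (k \<odot> S k + (k \<bullet> S k) *\<^sub>R oe 0) \<longleftrightarrow>
      2 * \<i> * a * (s - c) = l * (\<i> * a * c * (s - c) - (s + c) * u * cnj \<eta>) \<and>
      \<i> * (d - a) * c + u * (\<rho> * \<eta> - cnj \<eta>) = l * (\<i> * a * c * (c - s) + (s + c) * u * cnj \<eta>) \<and>
      c * (cnj \<rho> - 1) + \<i> * (a + d) * \<eta> = l * (- 2 * \<i> * a * c * \<eta> + c\<^sup>2 - s\<^sup>2)"
proof -
  have qq: "Im (cnj q * (x * q)) = 0" for x :: real
    by simp
  have p': "p = \<rho> * q\<^sup>2 / cnj q" using p q by (simp add: field_simps)
  have k0: "blinfun_apply (Zf a d q p) k = vv 0 0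
      (q * (\<i> * (d - a) * s - u * (\<rho> * \<eta> - cnj \<eta>))) ((cnj q)\<^sup>2 * (s * (cnj \<rho> - 1) - \<i> * (a + d) * \<eta>))"
    unfolding k_def Zf_apply vv_eq_iff u p' qq using q
    by (simp add: field_simps power2_eq_square)
  show "blinfun_apply (Zf a d q p) k = 0 \<longleftrightarrow>
      \<i> * (d - a) * s = u * (\<rho> * \<eta> - cnj \<eta>) \<and> s * (cnj \<rho> - 1) = \<i> * (a + d) * \<eta>"
    unfolding k0 vv_eq_0_iff using q by simp
  have k1: "blinfun_apply (Zf a d q p) (S k) = vv 0 (q * (2 * \<i> * a * (s - c)))
      (q * (\<i> * (d - a) * c + u * (\<rho> * \<eta> - cnj \<eta>))) ((cnj q)\<^sup>2 * (c * (cnj \<rho> - 1) + \<i> * (a + d) * \<eta>))"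
    unfolding k_def Zf_apply S_vv vv_eq_iff u p' qq using q
    by (simp add: field_simps power2_eq_square)
  have k2: "k \<odot> S k + (k \<bullet> S k) *\<^sub>R oe 0 = vv 0 (q * (\<i> * a * c * (s - c) - (s + c) * u * cnj \<eta>))
      (q * (\<i> * a * c * (c - s) + (s + c) * u * cnj \<eta>)) ((cnj q)\<^sup>2 * (- 2 * \<i> * a * c * \<eta> + c\<^sup>2 - s\<^sup>2))"
    unfolding k_def S_vv omult_vv inner_vv
    by (simp add: u algebra_simps power2_eq_square)
  have mv: "l * (q * x) = q * (l * x)" "l * ((cnj q)\<^sup>2 * x) = (cnj q)\<^sup>2 * (l * x)" for x
    by (simp_all add: mult_ac)
  show "blinfun_apply (Zf a d q p) (S k) = l *\<^sub>R (k \<odot> S k + (k \<bullet> S k) *\<^sub>R oe 0) \<longleftrightarrow>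
      2 * \<i> * a * (s - c) = l * (\<i> * a * c * (s - c) - (s + c) * u * cnj \<eta>) \<and>
      \<i> * (d - a) * c + u * (\<rho> * \<eta> - cnj \<eta>) = l * (\<i> * a * c * (c - s) + (s + c) * u * cnj \<eta>) \<and>
      c * (cnj \<rho> - 1) + \<i> * (a + d) * \<eta> = l * (- 2 * \<i> * a * c * \<eta> + c\<^sup>2 - s\<^sup>2)"
    unfolding k1 k2 vv_linear vv_eq_iff mv using q by (simp add: mult.assoc)
qed

text \<open>The ansatz for \<open>k\<close> loses nothing: \<open>Z k = 0\<close> forces the first
  two coordinates to be (ac, cq), and the third is a real multiple of \<open>q\<close> by the
  \<open>oe 1\<close>-component of the equation for \<open>Z (S k)\<close>.\<close>

lemma kernel_plane_coordinates:
  fixes a d u :: real and q \<rho> :: complex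
  assumes q: "q \<noteq> 0" and p: "p * cnj q = \<rho> * q\<^sup>2" and u: "complex_of_real u = q * cnj q"
  shows "kernel_plane (Zf a d q p) \<longleftrightarrow> (\<exists>c s h1 h2 l. kernel_equations a d u (Re \<rho>) (Im \<rho>) c s h1 h2 l)"
proof
  assume "kernel_plane (Zf a d q p)"
  then obtain k l where k: "k \<noteq> 0" "k$0 = 0" "blinfun_apply (Zf a d q p) k = 0"
    "blinfun_apply (Zf a d q p) (S k) = l *\<^sub>R (k \<odot> S k + (k \<bullet> S k) *\<^sub>R oe 0)"
    unfolding kernel_plane_def by blast
  obtain r w1 w2 w3 where kv: "k = vv r w1 w2 w3" using imag_eq_vv[OF k(2)] by blast
  have e1: "Im (cnj q * w1) = 0" "\<i> * r * q = \<i> * a * w1"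
    using k(3) unfolding kv Zf_apply vv_eq_0_iff by (auto simp: algebra_simps)
  have real_multiple: "\<exists>c::real. w = c * q" if "Im (cnj q * w) = 0" for w
  proof -
    have "cnj q * w = Re (cnj q * w)" using that by (simp add: complex_eq_iff)
    moreover have "w = (cnj q * w) * q / (q * cnj q)" using q by (simp add: field_simps)
    ultimately have "w = (Re (cnj q * w) / u) * q" using u by simp
    then show ?thesis by blast
  qed
  obtain c :: real where c: "w1 = c * q" using real_multiple e1(1) by blast
  have "complex_of_real r = complex_of_real (a * c)" using e1(2) q by (simp add: c)
  then have r: "r = a * c" by (simp only: of_real_eq_iff)
  \<comment> \<open>The cross product of \<open>k\<close> and \<open>S k\<close> has no
    \<open>oe 1\<close>-component, because \<open>S\<close> exchanges \<open>w1\<close> and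
    \<open>w2\<close>.\<close>
  have "2 * Im (cnj q * w2) = 0"
  proof -
    have "blinfun_apply (Zf a d q p) (S k) $ 1 = (l *\<^sub>R (k \<odot> S k + (k \<bullet> S k) *\<^sub>R oe 0)) $ 1"
      using k(4) by simp
    then show ?thesis
      unfolding kv S_vv Zf_apply omult_vv inner_vv by (simp add: algebra_simps)
  qed
  then obtain s :: real where s: "w2 = s * q" using real_multiple by auto
  define \<eta> where "\<eta> = w3 / (cnj q)\<^sup>2"
  have w3: "w3 = \<eta> * (cnj q)\<^sup>2" using q by (simp add: \<eta>_def)
  have "c \<noteq> 0 \<or> s \<noteq> 0 \<or> Re \<eta> \<noteq> 0 \<or> Im \<eta> \<noteq> 0"
    using k(1) unfolding kv c r s w3 vv_eq_0_iff by (auto simp: complex_eq_iff)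
  moreover note k(3,4)[unfolded kv c r s w3 kernel_plane_vectors[OF q p u]]
  ultimately have "kernel_equations a d u (Re \<rho>) (Im \<rho>) c s (Re \<eta>) (Im \<eta>) l"
    unfolding kernel_equations_def complex_eq_iff by (simp add: algebra_simps power2_eq_square)
  then show "\<exists>c s h1 h2 l. kernel_equations a d u (Re \<rho>) (Im \<rho>) c s h1 h2 l" by blast
next
  have *: "kernel_plane (Zf a d q p)" if P: "kernel_equations a d u (Re \<rho>) (Im \<rho>) c s h1 h2 l" for c s h1 h2 l
  proof -
    let ?\<eta> = "Complex h1 h2"
    let ?k = "vv (a * c) (c * q) (s * q) (?\<eta> * (cnj q)\<^sup>2)"
    have "c \<noteq> 0 \<or> s \<noteq> 0 \<or> ?\<eta> \<noteq> 0"
      using P unfolding kernel_equations_def by (auto simp: complex_eq_iff)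
    then have "?k \<noteq> 0" using q by auto
    moreover have "blinfun_apply (Zf a d q p) ?k = 0"
      unfolding kernel_plane_vectors(1)[OF q p u] complex_eq_iff
      using P unfolding kernel_equations_def by (simp add: algebra_simps)
    moreover have "blinfun_apply (Zf a d q p) (S ?k) = l *\<^sub>R (?k \<odot> S ?k + (?k \<bullet> S ?k) *\<^sub>R oe 0)"
      unfolding kernel_plane_vectors(2)[OF q p u] complex_eq_iff
      using P unfolding kernel_equations_def by (simp add: algebra_simps power2_eq_square)
    ultimately show ?thesis
      unfolding kernel_plane_def by (intro exI[of _ ?k] exI[of _ l]) simp
  qed
  assume "\<exists>c s h1 h2 l. kernel_equations a d u (Re \<rho>) (Im \<rho>) c s h1 h2 l"
  then show "kernel_plane (Zf a d q p)" using * by blast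
qed

text \<open>Translation back from \<rho>: the polynomial for (vi) is \<open>u\<^sup>2\<close> times
  its normalised form as soon as \<open>y = 0\<close>, which (vi) contains.\<close>

lemma kernel_plane_iff:
  fixes a d :: real and q p :: complex
  assumes q: "q \<noteq> 0"
  defines "u \<equiv> (cmod q)\<^sup>2" and "v \<equiv> (cmod p)\<^sup>2"
    and "R \<equiv> Re (p * cnj q ^ 3)" and "I \<equiv> Im (p * cnj q ^ 3)"
  shows "kernel_plane (Zf a d q p) \<longleftrightarrow>
     (a = 0 \<and> d\<^sup>2 + v = u) \<or> (d = - a \<and> v = u) \<or> (a = 0 \<and> d = 0 \<and> I = 0)
     \<or> (d = 3 * a \<and> complex_of_real u * p = 3 * q ^ 3)
     \<or> (a\<^sup>2 + u - d\<^sup>2 - v = 0 \<and> I = 0 \<and> u * ((2 * v + 3 * u) * a - 3 * u * d) - (a + d) * R = 0)"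
proof -
  define \<rho> where "\<rho> = p * cnj q / q\<^sup>2"
  define x y where "x = Re \<rho>" and "y = Im \<rho>"
  have u: "complex_of_real u = q * cnj q" unfolding u_def by (rule complex_norm_square)
  have u0: "u > 0" using q by (simp add: u_def)
  have p: "p * cnj q = \<rho> * q\<^sup>2" using q by (simp add: \<rho>_def)
  have "(cmod (p * cnj q))\<^sup>2 = (cmod (\<rho> * q\<^sup>2))\<^sup>2" by (simp only: p)
  then have "v * u = (cmod \<rho>)\<^sup>2 * u * u"
    by (simp add: norm_mult norm_power u_def v_def power_mult_distrib power2_eq_square mult_ac)
  then have "v * u = (x\<^sup>2 + y\<^sup>2) * u * u"
    by (simp only: cmod_power2 x_def y_def)
  then have v: "v = (x\<^sup>2 + y\<^sup>2) * u" using u0 by simp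
  have "p * cnj q ^ 3 = (p * cnj q) * (cnj q)\<^sup>2" by (simp add: power2_eq_square power3_eq_cube)
  also have "\<dots> = \<rho> * (complex_of_real u)\<^sup>2"
    unfolding p u by (simp add: power2_eq_square)
  also have "\<dots> = of_real (u\<^sup>2) * \<rho>" by simp
  finally have "p * cnj q ^ 3 = of_real (u\<^sup>2) * \<rho>" .
  then have RI: "R = x * u\<^sup>2" "I = y * u\<^sup>2"
    unfolding R_def I_def x_def y_def by (simp_all del: of_real_power)
  have i1: "v = u \<longleftrightarrow> x\<^sup>2 + y\<^sup>2 = 1" using u0 v by auto
  have i2: "I = 0 \<longleftrightarrow> y = 0" using u0 RI by simp
  have i3: "complex_of_real u * p = 3 * q ^ 3 \<longleftrightarrow> x = 3 \<and> y = 0"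
  proof -
    have "complex_of_real u * p = 3 * q ^ 3 \<longleftrightarrow> q * (p * cnj q) = q * (3 * q\<^sup>2)"
      unfolding u by (simp add: power2_eq_square power3_eq_cube mult_ac)
    also have "\<dots> \<longleftrightarrow> \<rho> = 3" unfolding p using q by simp
    finally show ?thesis by (simp add: complex_eq_iff x_def y_def)
  qed
  have i4: "u * ((2 * v + 3 * u) * a - 3 * u * d) - (a + d) * R = 0 \<longleftrightarrow>
      (2 * x\<^sup>2 + 3) * a - 3 * d - (a + d) * x = 0" if "y = 0"
  proof -
    have "u * ((2 * v + 3 * u) * a - 3 * u * d) - (a + d) * R
        = u\<^sup>2 * ((2 * x\<^sup>2 + 3) * a - 3 * d - (a + d) * x)"
      unfolding v RI using that by (simp add: power2_eq_square algebra_simps)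
    then show ?thesis using u0 by simp
  qed
  have i5: "a\<^sup>2 + u - d\<^sup>2 - v = 0 \<longleftrightarrow> a\<^sup>2 + u = d\<^sup>2 + (x\<^sup>2 + y\<^sup>2) * u"
    unfolding v by auto
  have "kernel_plane (Zf a d q p) \<longleftrightarrow>
     (a = 0 \<and> d\<^sup>2 + (x\<^sup>2 + y\<^sup>2) * u = u) \<or> (d = - a \<and> x\<^sup>2 + y\<^sup>2 = 1)
    \<or> (a = 0 \<and> d = 0 \<and> y = 0) \<or> (d = 3 * a \<and> x = 3 \<and> y = 0)
    \<or> (a\<^sup>2 + u = d\<^sup>2 + (x\<^sup>2 + y\<^sup>2) * u \<and> y = 0 \<and> (2 * x\<^sup>2 + 3) * a - 3 * d - (a + d) * x = 0)"
    unfolding kernel_plane_coordinates[OF q p u] x_def[symmetric] y_def[symmetric]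
    using kernel_plane_solution_cases[OF u0] kernel_plane_solution_exists[OF u0] by blast
  then show ?thesis
    unfolding i1 i2 i3 i5 v[symmetric] using i4 by blast
qed

section \<open>The rank one case\<close>

lemma bracket_Zf:
  "bracket (Zf a d q p) (conj_S (Zf a d q p)) =
    der 0 0 (p * cnj p + 3 * q * cnj q) (\<i> * (3 * a + d) * cnj p) (\<i> * (3 * a + d) * cnj p)
      (- 2 * (d - a) * q) (2 * (d - a) * q) (- 4 * \<i> * (cnj p * q + (cnj q)\<^sup>2))"
  unfolding Zf_def conj_S_der bracket_der der_eq_iff
  by (simp add: algebra_simps power2_eq_square)

text \<open>Substituting \<open>d = a * (x\<^sup>2 + 2)\<close> in the first equation gives
  \<open>a\<close> times a cubic whose only real root is -1. There \<open>d = 3 * a\<close>, and the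
  third equation reduces to \<open>a\<^sup>2 = 0\<close>.\<close>

lemma rank_one_equations:
  fixes a d u x :: real
  assumes u: "u > 0" and e1: "(3 * a + d) * x = - 2 * d" and e2: "a * x\<^sup>2 = d - 2 * a"
    and e3: "x * ((3 * a + d)\<^sup>2 + x\<^sup>2 * u + 9 * u) + 6 * u = x * ((d - a)\<^sup>2 + 3 * x\<^sup>2 * u + 7 * u + 6 * x * u)"
  shows "a = 0 \<and> d = 0"
proof -
  have d: "d = a * (x\<^sup>2 + 2)" using e2 by (simp add: algebra_simps)
  have "a = 0"
  proof (rule ccontr)
    assume a: "a \<noteq> 0"
    have "a * ((x + 1) * (x\<^sup>2 + x + 4)) = 0"
      using e1 d by algebra
    then have "x = - 1 \<or> x\<^sup>2 + x + 4 = 0" using a by auto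
    moreover have "x\<^sup>2 + x + 4 > 0"
    proof -
      have "x\<^sup>2 + x + 4 = (x + 1/2)\<^sup>2 + 15/4" by (simp add: power2_eq_square algebra_simps)
      then show ?thesis using zero_le_power2[of "x + 1/2"] by linarith
    qed
    ultimately have "x = - 1" by auto
    then have "a\<^sup>2 = 0" using e3 d by (simp add: power2_eq_square algebra_simps)
    then show False using a by simp
  qed
  then show ?thesis using d by simp
qed

text \<open>Only the entries \<open>A\<close>, \<open>B\<close>, \<open>z2\<close>,
  \<open>z3\<close> are compared. They vanish in \<open>Zf a d q p\<close>, so \<alpha> drops out;
  in its conjugate only \<open>B\<close> and \<open>z2\<close> can be nonzero, which determines
  \<beta>.\<close>

lemma rank_one_Zf:
  assumes q: "q \<noteq> 0"
    and e: "bracket (Zf a d q p) (bracket (Zf a d q p) (conj_S (Zf a d q p))) =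
      \<alpha> *\<^sub>R Zf a d q p + \<beta> *\<^sub>R conj_S (Zf a d q p)"
  shows "a = 0 \<and> d = 0 \<and> Im (p * cnj q ^ 3) = 0"
proof -
  define u where "u = (cmod q)\<^sup>2"
  have u: "complex_of_real u = q * cnj q" unfolding u_def by (rule complex_norm_square)
  have u0: "u > 0" using q by (simp add: u_def)
  define \<rho> where "\<rho> = p * cnj q / q\<^sup>2"
  have p: "p = \<rho> * q\<^sup>2 / cnj q" and p': "cnj p = cnj \<rho> * (cnj q)\<^sup>2 / q"
    using q by (simp_all add: \<rho>_def)
  note E = e[unfolded bracket_Zf, unfolded Zf_def conj_S_der bracket_der der_linear der_eq_iff]
  note E3 = E[THEN conjunct2, THEN conjunct2]
  note E7 = E3[THEN conjunct2, THEN conjunct2, THEN conjunct2, THEN conjunct2]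
  have "\<i> * (6 * (a * (p * cnj p) - q * cnj q * (d - 2 * a))) = 0"
    using E3[THEN conjunct1] by (simp add: algebra_simps)
  then have A: "a * (p * cnj p) = q * cnj q * (d - 2 * a)" by simp
  have B: "cnj p * ((3 * a + d)\<^sup>2 + p * cnj p + 9 * (q * cnj q)) + 6 * (cnj q) ^ 3 = - (\<beta> * cnj p)"
    using E3[THEN conjunct2, THEN conjunct1]
    by (simp add: algebra_simps power2_eq_square power3_eq_cube)
  have "\<i> * (2 * (d - a)\<^sup>2 * q + 6 * (p * cnj p) * q + 14 * (q * cnj q) * q + 12 * p * (cnj q)\<^sup>2
      + 2 * \<beta> * q) = 0"
    using E7[THEN conjunct1] by (simp add: algebra_simps power2_eq_square)
  then have z2: "2 * (d - a)\<^sup>2 * q + 6 * (p * cnj p) * q + 14 * (q * cnj q) * q + 12 * p * (cnj q)\<^sup>2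
      + 2 * \<beta> * q = 0" by simp
  have z3: "- (q * (cnj p * (d * 4))) = q * (cnj p * (a * 12)) + cnj q * (cnj q * (d * 8))"
    using E7[THEN conjunct2] by (simp add: algebra_simps power2_eq_square)
  define x y where "x = Re \<rho>" and "y = Im \<rho>"
  have pq: "p * cnj q = \<rho> * q\<^sup>2" using q by (simp add: \<rho>_def)
  have pq': "cnj p * q = cnj \<rho> * (cnj q)\<^sup>2"
    using arg_cong[OF pq, of cnj] by simp
  have pp: "p * cnj p = of_real ((x\<^sup>2 + y\<^sup>2) * u)"
  proof -
    have "(p * cnj q) * (cnj p * q) = (\<rho> * cnj \<rho>) * (q * cnj q) * (q * cnj q)"
      unfolding pq pq' by (simp add: power2_eq_square mult_ac)
    then have "(q * cnj q) * (p * cnj p) = (q * cnj q) * ((\<rho> * cnj \<rho>) * (q * cnj q))"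
      by (simp add: mult_ac)
    then have "p * cnj p = (\<rho> * cnj \<rho>) * (q * cnj q)" using q by simp
    also have "\<rho> * cnj \<rho> = of_real (x\<^sup>2 + y\<^sup>2)"
      by (simp add: complex_mult_cnj x_def y_def)
    finally show ?thesis by (simp add: u)
  qed
  have "(cnj q)\<^sup>2 * ((3 * a + d) * cnj \<rho> + 2 * d) = ((12 * a + 4 * d) * (cnj p * q) + 8 * d * (cnj q)\<^sup>2) / 4"
    unfolding pq' by (simp add: algebra_simps)
  also have "(12 * a + 4 * d) * (cnj p * q) + 8 * d * (cnj q)\<^sup>2 =
      (q * (cnj p * (a * 12)) + cnj q * (cnj q * (d * 8))) + q * (cnj p * (d * 4))"
    by (simp add: algebra_simps power2_eq_square)
  also have "\<dots> / 4 = 0" unfolding z3[symmetric] by simp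
  finally have "(3 * a + d) * cnj \<rho> + 2 * d = 0" using q by simp
  then have "Re ((3 * a + d) * cnj \<rho> + 2 * d) = 0" by (simp only: zero_complex.simps)
  then have c1: "(3 * a + d) * x = - 2 * d" by (simp add: x_def)
  have c2: "a * (x\<^sup>2 + y\<^sup>2) = d - 2 * a"
  proof -
    have "complex_of_real (a * ((x\<^sup>2 + y\<^sup>2) * u)) = of_real (u * (d - 2 * a))"
      using A unfolding pp by (simp add: u)
    then show ?thesis using u0 unfolding of_real_eq_iff by simp
  qed
  have "q * (2 * (d - a)\<^sup>2 + 6 * ((x\<^sup>2 + y\<^sup>2) * u) + 14 * u + 12 * \<rho> * u + 2 * \<beta>) =
      2 * (d - a)\<^sup>2 * q + 6 * (p * cnj p) * q + 14 * (q * cnj q) * q + 12 * (p * cnj q) * cnj q + 2 * \<beta> * q"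
    unfolding pq pp by (simp add: u algebra_simps power2_eq_square)
  also have "\<dots> = 0" using z2 by (simp add: power2_eq_square mult_ac)
  finally have z: "2 * (d - a)\<^sup>2 + 6 * ((x\<^sup>2 + y\<^sup>2) * u) + 14 * u + 12 * \<rho> * u + 2 * \<beta> = (0 :: complex)"
    using q by simp
  have "Im (2 * (d - a)\<^sup>2 + 6 * ((x\<^sup>2 + y\<^sup>2) * u) + 14 * u + 12 * \<rho> * u + 2 * \<beta>) = 0"
    "Re (2 * (d - a)\<^sup>2 + 6 * ((x\<^sup>2 + y\<^sup>2) * u) + 14 * u + 12 * \<rho> * u + 2 * \<beta>) = 0"
    unfolding z by simp_all
  \<comment> \<open>Every term except \<open>12 * \<rho> * u\<close> is real.\<close>
  then have y: "y = 0" and c4: "(d - a)\<^sup>2 + 3 * ((x\<^sup>2 + y\<^sup>2) * u) + 7 * u + 6 * x * u = - \<beta>"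
    using u0 by (simp_all add: x_def y_def)
  have \<rho>: "\<rho> = of_real x" using y by (simp add: complex_eq_iff x_def y_def)
  have "(cnj q)\<^sup>2 * (cnj \<rho> * ((3 * a + d)\<^sup>2 + (x\<^sup>2 + y\<^sup>2) * u + 9 * u) + 6 * u + \<beta> * cnj \<rho>) =
      (cnj p * q) * ((3 * a + d)\<^sup>2 + p * cnj p + 9 * (q * cnj q)) + 6 * (cnj q)\<^sup>2 * (q * cnj q)
        + \<beta> * (cnj p * q)"
    unfolding pq' pp u[symmetric] by (simp add: algebra_simps)
  also have "\<dots> = q * (cnj p * ((3 * a + d)\<^sup>2 + p * cnj p + 9 * (q * cnj q)) + 6 * (cnj q) ^ 3
      + \<beta> * cnj p)"
    by (simp add: algebra_simps power2_eq_square power3_eq_cube)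
  also have "\<dots> = 0" unfolding B by simp
  finally have "cnj \<rho> * ((3 * a + d)\<^sup>2 + (x\<^sup>2 + y\<^sup>2) * u + 9 * u) + 6 * u + \<beta> * cnj \<rho> = 0"
    using q by simp
  then have "complex_of_real (x * ((3 * a + d)\<^sup>2 + x\<^sup>2 * u + 9 * u) + 6 * u + \<beta> * x) = of_real 0"
    unfolding \<rho> y by simp
  then have c5: "x * ((3 * a + d)\<^sup>2 + x\<^sup>2 * u + 9 * u) + 6 * u + \<beta> * x = 0"
    unfolding of_real_eq_iff .
  have "x * ((3 * a + d)\<^sup>2 + x\<^sup>2 * u + 9 * u) + 6 * u = x * ((d - a)\<^sup>2 + 3 * x\<^sup>2 * u + 7 * u + 6 * x * u)"
    using c5 c4 y by algebra
  then have "a = 0 \<and> d = 0"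
    using rank_one_equations[OF u0 c1] c2 y by simp
  moreover have "Im (p * cnj q ^ 3) = 0"
  proof -
    have "p * cnj q ^ 3 = (p * cnj q) * (cnj q)\<^sup>2" by (simp add: power2_eq_square power3_eq_cube)
    also have "\<dots> = of_real (x * u\<^sup>2)" unfolding pq \<rho> by (simp add: u power2_eq_square)
    finally show ?thesis by (simp only: Im_complex_of_real)
  qed
  ultimately show ?thesis by simp
qed

section \<open>The coordinates on \<open>k_A\<close>\<close>

lemma blinfun_oct_eqI:
  fixes X Y :: "oct \<Rightarrow>\<^sub>L oct"
  assumes "\<forall>i. blinfun_apply X (oe i) = blinfun_apply Y (oe i)"
  shows "X = Y"
proof (rule blinfun_eqI)
  fix x :: oct
  show "blinfun_apply X x = blinfun_apply Y x"
    by (subst (1 2) oct_eq_sum[of x]) (simp only: blinfun.bilinear_simps assms)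
qed

lemma DD_eq_Zf:
  "DD 1 2 = Zf 0 0 (2 * \<i>) 0" "DD 1 3 = Zf 0 0 (- 2) 0" "DD 2 3 = Zf 2 0 0 0"
  "DD 4 5 = Zf (- 1) 3 0 0" "DD 4 6 = Zf 0 0 (- 1) 3" "DD 4 7 = Zf 0 0 (- \<i>) (3 * \<i>)"
proof -
  have DD: "blinfun_apply (DD i j) (oe k) =
      ocomm (ocomm (oe i) (oe j)) (oe k) - 3 *\<^sub>R oassoc (oe i) (oe j) (oe k)" for i j k
    by (simp add: DD_def blinfun_apply_inner_der)
  show "DD 1 2 = Zf 0 0 (2 * \<i>) 0" "DD 1 3 = Zf 0 0 (- 2) 0" "DD 2 3 = Zf 2 0 0 0"
    "DD 4 5 = Zf (- 1) 3 0 0" "DD 4 6 = Zf 0 0 (- 1) 3" "DD 4 7 = Zf 0 0 (- \<i>) (3 * \<i>)"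
    by (rule blinfun_oct_eqI, unfold forall_8 DD ocomm_def oassoc_def,
      simp only: omult_bilinear omult_oe unit_mult_0 unit_mult_table minus_minus,
      simp add: oct_eq_iff Zf_def der_apply der_fun_def)+
qed

lemma Zf_linear:
  "Zf a d q p + Zf a' d' q' p' = Zf (a + a') (d + d') (q + q') (p + p')"
  "c *\<^sub>R Zf a d q p = Zf (c * a) (c * d) (c * q) (c * p)"
  by (simp_all add: Zf_def der_linear algebra_simps)

lemma k_A_elem_eq_Zf: "k_A_elem x = Zf (ca x) (cd x) (cq x) (cp x)"
  unfolding k_A_elem_def DD_eq_Zf Zf_linear
  by (simp add: Zf_def ca_def cd_def cq_def cp_def complex_eq_iff algebra_simps)

text \<open>The images of \<open>oe 1\<close> and \<open>oe 2\<close> have components outside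
  \<open>H_A\<close> given by \<open>z2\<close>, \<open>z3\<close>, \<open>A\<close> and
  \<open>B\<close>; the other six real parameters remain free.\<close>

lemma k_A_cases:
  assumes Z: "Z \<in> k_A"
  obtains a d q p where "Z = Zf a d q p"
proof -
  have g: "Z \<in> g2" and H: "\<And>x. x \<in> H_A \<Longrightarrow> blinfun_apply Z x \<in> H_A"
    using Z by (auto simp: k_A_def)
  have zero: "x $ 4 = 0 \<and> x $ 5 = 0 \<and> x $ 6 = 0 \<and> x $ 7 = 0" if "x \<in> H_A" for x
  proof -
    have "subspace {x :: oct. x $ 4 = 0 \<and> x $ 5 = 0 \<and> x $ 6 = 0 \<and> x $ 7 = 0}"
      by (auto simp: subspace_def)
    then have "H_A \<subseteq> {x. x $ 4 = 0 \<and> x $ 5 = 0 \<and> x $ 6 = 0 \<and> x $ 7 = 0}"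
      unfolding H_A_def by (intro span_minimal) auto
    then show ?thesis using that by blast
  qed
  obtain s t A B C z1 z2 z3 where e: "Z = der s t A B C z1 z2 z3"
    using g2_cases[OF g] by blast
  have "oe 1 \<in> H_A" "oe 2 \<in> H_A" by (auto simp: H_A_def span_base)
  then have "z2 = 0" "z3 = 0" "A = 0" "B = 0"
    using zero[OF H[of "oe 1"]] zero[OF H[of "oe 2"]]
    by (auto simp: e oe_eq_vv der_vv der_fun_def complex_eq_iff)
  then have "Z = Zf (s / 2) (t + s / 2) (\<i> / 2 * z1) (cnj C)"
    by (simp add: e Zf_def)
  then show ?thesis using that by blast
qed

lemma exhaust_6: "i = 0 \<or> i = 1 \<or> i = 2 \<or> i = 3 \<or> i = 4 \<or> i = 5" for i :: 6
proof (induct i)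
  case (of_int z)
  then have "z = 0 \<or> z = 1 \<or> z = 2 \<or> z = 3 \<or> z = 4 \<or> z = 5" by auto
  then show ?case by auto
qed

lemma Zf_eq_iff [simp]: "Zf a d q p = Zf a' d' q' p' \<longleftrightarrow> a = a' \<and> d = d' \<and> q = q' \<and> p = p'"
  by (auto simp: Zf_def)

lemma k_A_elem_coords:
  assumes "Z \<in> k_A"
  shows "Z = k_A_elem (coords Z)"
proof -
  obtain a d q p where Z: "Z = Zf a d q p" using k_A_cases[OF assms] by blast
  \<comment> \<open>The inverse of the linear change of coordinates to (a, d, q, p); the uniqueness
    shown below justifies the description in \<open>coords\<close>.\<close>
  define x :: "real ^ 6" where "x = (\<chi> i. if i = 0 then (Im q + Im p / 3) / 2
    else if i = 1 then - (Re q + Re p / 3) / 2 else if i = 2 then (a + d / 3) / 2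
    else if i = 3 then d / 3 else if i = 4 then Re p / 3 else Im p / 3)"
  have "Z = k_A_elem x"
    by (simp add: Z k_A_elem_eq_Zf ca_def cd_def cq_def cp_def x_def complex_eq_iff field_simps)
  moreover have "y = x" if "Z = k_A_elem y" for y
  proof -
    have "k_A_elem y = k_A_elem x" using that \<open>Z = k_A_elem x\<close> by simp
    then have e: "y$0 = x$0 \<and> y$1 = x$1 \<and> y$2 = x$2 \<and> y$3 = x$3 \<and> y$4 = x$4 \<and> y$5 = x$5"
      by (simp add: k_A_elem_eq_Zf ca_def cd_def cq_def cp_def)
    have "y $ i = x $ i" for i using exhaust_6[of i] e by auto
    then show ?thesis by (simp add: vec_eq_iff)
  qed
  ultimately have "coords Z = x" unfolding coords_def by (intro the_equality)
  then show ?thesis using \<open>Z = k_A_elem x\<close> by simp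
qed

lemma kernel_plane_Zf_0: "kernel_plane (Zf a d 0 p)"
  by (rule kernel_planeI_fixed[of "vv 1 0 0 0"]) (simp_all add: Zf_apply S_vv)

text \<open>The rank one alternative yields condition (iv), which already implies
  \<open>kernel_plane\<close> by \<open>kernel_plane_iff\<close>, so it adds no new case.\<close>

lemma L_of_Zf_iff:
  "L_of (Zf a d q p) \<noteq> g2 \<longleftrightarrow> q = 0 \<or> kernel_plane (Zf a d q p)"
proof
  assume "L_of (Zf a d q p) \<noteq> g2"
  then show "q = 0 \<or> kernel_plane (Zf a d q p)"
    using proper_L_of_cases[OF Zf_in_g2, of a d q p] rank_one_Zf[of q a d p] kernel_plane_iff[of q a d p]
    by blast
next
  assume "q = 0 \<or> kernel_plane (Zf a d q p)"
  then show "L_of (Zf a d q p) \<noteq> g2"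
    using kernel_plane_proper[OF Zf_in_g2] kernel_plane_Zf_0 by blast
qed

section \<open>Polynomial degrees\<close>

lemma poly_fun_sum:
  assumes "finite K" "\<And>k. k \<in> K \<Longrightarrow> poly_fun_degree_le n (f k)"
  shows "poly_fun_degree_le n (\<lambda>x. \<Sum>k\<in>K. f k x)"
proof -
  obtain c where c: "\<And>k x. k \<in> K \<Longrightarrow>
      f k x = (\<Sum>\<alpha> | (\<Sum>i\<in>UNIV. \<alpha> i) \<le> n. c k \<alpha> * (\<Prod>i\<in>UNIV. x $ i ^ \<alpha> i))"
    using assms(2) unfolding poly_fun_degree_le_def by metis
  have "(\<Sum>k\<in>K. f k x) =
      (\<Sum>\<alpha> | (\<Sum>i\<in>UNIV. \<alpha> i) \<le> n. (\<Sum>k\<in>K. c k \<alpha>) * (\<Prod>i\<in>UNIV. x $ i ^ \<alpha> i))" for x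
    unfolding sum_distrib_right by (subst sum.swap) (intro sum.cong refl c)
  then show ?thesis
    unfolding poly_fun_degree_le_def by (intro exI[of _ "\<lambda>\<alpha>. \<Sum>k\<in>K. c k \<alpha>"]) simp
qed

lemma poly_fun_monomial:
  fixes \<alpha> :: "'n::finite \<Rightarrow> nat"
  assumes "(\<Sum>i\<in>UNIV. \<alpha> i) \<le> n"
  shows "poly_fun_degree_le n (\<lambda>x. c * (\<Prod>i\<in>UNIV. x $ i ^ \<alpha> i))"
proof -
  have "c * (\<Prod>i\<in>UNIV. x $ i ^ \<alpha> i) = (\<Sum>\<beta> | (\<Sum>i\<in>UNIV. \<beta> i) \<le> n.
      (if \<beta> = \<alpha> then c else 0) * (\<Prod>i\<in>UNIV. x $ i ^ \<beta> i))" for x :: "real ^ 'n"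
  proof -
    have "(\<Sum>\<beta> | (\<Sum>i\<in>UNIV. \<beta> i) \<le> n. (if \<beta> = \<alpha> then c else 0) * (\<Prod>i\<in>UNIV. x $ i ^ \<beta> i))
        = (\<Sum>\<beta> | (\<Sum>i\<in>UNIV. \<beta> i) \<le> n. if \<beta> = \<alpha> then c * (\<Prod>i\<in>UNIV. x $ i ^ \<alpha> i) else 0)"
      by (intro sum.cong) auto
    then show ?thesis using assms finite_exponents[where 'n = 'n, of n] by simp
  qed
  then show ?thesis
    unfolding poly_fun_degree_le_def by (intro exI[of _ "\<lambda>\<beta>. if \<beta> = \<alpha> then c else 0"]) simp
qed

lemma poly_fun_mult:
  fixes f g :: "real ^ 'n \<Rightarrow> real"
  assumes "poly_fun_degree_le m f" "poly_fun_degree_le n g"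
  shows "poly_fun_degree_le (m + n) (\<lambda>x. f x * g x)"
proof -
  let ?E = "\<lambda>m. {\<alpha> :: 'n \<Rightarrow> nat. (\<Sum>i\<in>UNIV. \<alpha> i) \<le> m}"
  obtain c where c: "\<And>x. f x = (\<Sum>\<alpha>\<in>?E m. c \<alpha> * (\<Prod>i\<in>UNIV. x $ i ^ \<alpha> i))"
    using assms(1) unfolding poly_fun_degree_le_def by blast
  obtain e where e: "\<And>x. g x = (\<Sum>\<alpha>\<in>?E n. e \<alpha> * (\<Prod>i\<in>UNIV. x $ i ^ \<alpha> i))"
    using assms(2) unfolding poly_fun_degree_le_def by blast
  have "(\<lambda>x. f x * g x) = (\<lambda>x. \<Sum>\<alpha>\<in>?E m. \<Sum>\<beta>\<in>?E n. (c \<alpha> * e \<beta>) * (\<Prod>i\<in>UNIV. x $ i ^ (\<alpha> i + \<beta> i)))"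
    unfolding c e sum_product by (simp add: power_add prod.distrib mult_ac)
  moreover have "poly_fun_degree_le (m + n)
      (\<lambda>x. \<Sum>\<alpha>\<in>?E m. \<Sum>\<beta>\<in>?E n. (c \<alpha> * e \<beta>) * (\<Prod>i\<in>UNIV. x $ i ^ (\<alpha> i + \<beta> i)))"
    by (intro poly_fun_sum finite_exponents poly_fun_monomial) (simp add: sum.distrib)
  ultimately show ?thesis by simp
qed

lemma poly_fun_const: "poly_fun_degree_le n (\<lambda>x :: real ^ 'n. c)"
  using poly_fun_monomial[of "\<lambda>_ :: 'n. 0" n c] by simp

text \<open>Multiplication by the constant 1, regarded as a polynomial of degree at most
  \<open>n - m\<close>.\<close>

lemma poly_fun_mono:
  fixes f :: "real ^ 'n \<Rightarrow> real"
  assumes "poly_fun_degree_le m f" "m \<le> n"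
  shows "poly_fun_degree_le n f"
  using poly_fun_mult[OF assms(1) poly_fun_const[of "n - m" 1]] assms(2) by simp

lemma poly_fun_component: "poly_fun_degree_le 1 (\<lambda>x :: real ^ 'n. x $ i)"
proof -
  have "(\<Prod>j\<in>UNIV. x $ j ^ (if j = i then 1 else 0)) = x $ i" for x :: "real ^ 'n"
  proof -
    have "(\<Prod>j\<in>UNIV. x $ j ^ (if j = i then 1 else 0)) = (\<Prod>j\<in>UNIV. if j = i then x $ i else 1)"
      by (intro prod.cong) auto
    then show ?thesis by simp
  qed
  then show ?thesis
    using poly_fun_monomial[of "\<lambda>j. if j = i then 1 else 0" 1 1] by simp
qed

lemma poly_fun_add:
  assumes "poly_fun_degree_le n f" "poly_fun_degree_le n g"
  shows "poly_fun_degree_le n (\<lambda>x. f x + g x)"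
  using poly_fun_sum[of "{True, False}" n "\<lambda>b. if b then f else g"] assms by (simp add: add.commute)

lemma poly_fun_cmult: "poly_fun_degree_le n f \<Longrightarrow> poly_fun_degree_le n (\<lambda>x. c * f x)"
  using poly_fun_mult[OF poly_fun_const[of 0 c]] by simp

lemma poly_fun_diff:
  assumes "poly_fun_degree_le n f" "poly_fun_degree_le n g"
  shows "poly_fun_degree_le n (\<lambda>x. f x - g x)"
  using poly_fun_add[OF assms(1) poly_fun_cmult[OF assms(2), of "-1"]] by simp

lemma poly_fun_coordinates:
  "poly_fun_degree_le 1 ca" "poly_fun_degree_le 1 cd"
  "poly_fun_degree_le 1 (\<lambda>x. Re (cq x))" "poly_fun_degree_le 1 (\<lambda>x. Im (cq x))"
  "poly_fun_degree_le 1 (\<lambda>x. Re (cp x))" "poly_fun_degree_le 1 (\<lambda>x. Im (cp x))"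
  unfolding ca_def[abs_def] cd_def[abs_def] cq_def cp_def complex.sel
  by (intro poly_fun_diff poly_fun_cmult poly_fun_component)+

lemma degree_le_5:
  "\<forall>f\<in>{(\<lambda>x. cu x),
               (\<lambda>x. ca x), (\<lambda>x. (cd x)\<^sup>2 + cv x - cu x),
               (\<lambda>x. cd x - (- ca x)), (\<lambda>x. cv x - cu x),
               (\<lambda>x. cd x), (\<lambda>x. cI x),
               (\<lambda>x. cd x - 3 * ca x),
               (\<lambda>x. Re (complex_of_real (cu x) * cp x - 3 * cq x ^ 3)),
               (\<lambda>x. Im (complex_of_real (cu x) * cp x - 3 * cq x ^ 3)),
               (\<lambda>x. cdelta x), (\<lambda>x. cTheta x)}.
            poly_fun_degree_le 5 f"
proof -
  define q1 q2 p1 p2 where "q1 x = Re (cq x)" and "q2 x = Im (cq x)"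
    and "p1 x = Re (cp x)" and "p2 x = Im (cp x)" for x
  note pc = poly_fun_coordinates[folded q1_def q2_def p1_def p2_def]
  have mult11: "poly_fun_degree_le 2 (\<lambda>x. f x * g x)"
    if "poly_fun_degree_le 1 f" "poly_fun_degree_le 1 g" for f g :: "real ^ 6 \<Rightarrow> real"
    by (rule poly_fun_mono[OF poly_fun_mult[OF that]]) simp
  have mult12: "poly_fun_degree_le 3 (\<lambda>x. f x * g x)"
    if "poly_fun_degree_le 1 f" "poly_fun_degree_le 2 g" for f g :: "real ^ 6 \<Rightarrow> real"
    by (rule poly_fun_mono[OF poly_fun_mult[OF that]]) simp
  have mult13: "poly_fun_degree_le 4 (\<lambda>x. f x * g x)"
    if "poly_fun_degree_le 1 f" "poly_fun_degree_le 3 g" for f g :: "real ^ 6 \<Rightarrow> real"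
    by (rule poly_fun_mono[OF poly_fun_mult[OF that]]) simp
  have mult14: "poly_fun_degree_le 5 (\<lambda>x. f x * g x)"
    if "poly_fun_degree_le 1 f" "poly_fun_degree_le 4 g" for f g :: "real ^ 6 \<Rightarrow> real"
    by (rule poly_fun_mono[OF poly_fun_mult[OF that]]) simp
  have mult23: "poly_fun_degree_le 5 (\<lambda>x. f x * g x)"
    if "poly_fun_degree_le 2 f" "poly_fun_degree_le 3 g" for f g :: "real ^ 6 \<Rightarrow> real"
    by (rule poly_fun_mono[OF poly_fun_mult[OF that]]) simp
  have up: "poly_fun_degree_le 5 f" if "poly_fun_degree_le k f" "k \<le> 5"
    for k and f :: "real ^ 6 \<Rightarrow> real"
    using that by (rule poly_fun_mono)
  have u: "cu x = q1 x * q1 x + q2 x * q2 x" and v: "cv x = p1 x * p1 x + p2 x * p2 x" for x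
    unfolding cu_def cv_def cmod_power2 q1_def q2_def p1_def p2_def by (simp_all add: power2_eq_square)
  \<comment> \<open>The real and imaginary parts of \<open>cnj q ^ 3\<close>.\<close>
  define A B where "A x = q1 x * (q1 x * q1 x) - 3 * (q1 x * (q2 x * q2 x))"
    and "B x = q2 x * (q2 x * q2 x) - 3 * (q1 x * (q1 x * q2 x))" for x
  have R: "cR x = p1 x * A x - p2 x * B x" and I: "cI x = p1 x * B x + p2 x * A x" for x
    by (simp_all add: cR_def cI_def q1_def q2_def p1_def p2_def A_def B_def power3_eq_cube algebra_simps)
  have e: "Re (complex_of_real (cu x) * cp x - 3 * cq x ^ 3) = p1 x * cu x - 3 * A x"
    "Im (complex_of_real (cu x) * cp x - 3 * cq x ^ 3) = p2 x * cu x + 3 * B x" for x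
    by (simp_all add: q1_def q2_def p1_def p2_def A_def B_def power3_eq_cube algebra_simps)
  have du: "poly_fun_degree_le 2 cu" and dv: "poly_fun_degree_le 2 cv"
    unfolding u[abs_def] v[abs_def] by (intro poly_fun_add mult11 pc)+
  have dA: "poly_fun_degree_le 3 A" and dB: "poly_fun_degree_le 3 B"
    unfolding A_def[abs_def] B_def[abs_def] by (intro poly_fun_diff poly_fun_cmult mult12 mult11 pc)+
  have dR: "poly_fun_degree_le 4 cR" and dI: "poly_fun_degree_le 4 cI"
    unfolding R[abs_def] I[abs_def] by (intro poly_fun_diff poly_fun_add mult13 dA dB pc)+
  have "poly_fun_degree_le 2 (\<lambda>x. (cd x)\<^sup>2 + cv x - cu x)" "poly_fun_degree_le 2 (\<lambda>x. cv x - cu x)"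
    "poly_fun_degree_le 2 cdelta"
    unfolding cdelta_def[abs_def] power2_eq_square
    by (intro poly_fun_diff poly_fun_add mult11 pc du dv)+
  moreover have "poly_fun_degree_le 1 (\<lambda>x. cd x - (- ca x))" "poly_fun_degree_le 1 (\<lambda>x. cd x - 3 * ca x)"
    using poly_fun_add[OF pc(2,1)] poly_fun_diff[OF pc(2) poly_fun_cmult[OF pc(1)]] by simp_all
  moreover have "poly_fun_degree_le 3 (\<lambda>x. Re (complex_of_real (cu x) * cp x - 3 * cq x ^ 3))"
    "poly_fun_degree_le 3 (\<lambda>x. Im (complex_of_real (cu x) * cp x - 3 * cq x ^ 3))"
    unfolding e by (intro poly_fun_diff poly_fun_add poly_fun_cmult mult12 pc du dA dB)+
  moreover have "poly_fun_degree_le 5 cTheta"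
  proof -
    \<comment> \<open>Regrouped so that the products have degrees 2 + 3 and 1 + 4.\<close>
    have t: "cTheta x = cu x * (ca x * (2 * cv x + 3 * cu x) - cd x * (3 * cu x)) - (ca x + cd x) * cR x" for x
      by (simp add: cTheta_def algebra_simps)
    show ?thesis
      unfolding t[abs_def]
      by (intro poly_fun_diff mult23 mult14 mult12 poly_fun_add poly_fun_cmult pc du dv dR)
  qed
  ultimately show ?thesis
    using up[OF pc(1)] up[OF pc(2)] up[OF du] up[OF dI] up[where k = 2] up[where k = 1] up[where k = 3]
    by auto
qed

theorem theorem8p2:
  shows "(\<forall>Z\<in>k_A. let x = coords Z; a = ca x; d = cd x; q = cq x; p = cp x;
              u = cu x; v = cv x; I = cI x; \<delta> = cdelta x; \<Theta> = cTheta x in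
            L_of Z \<noteq> g2 \<longleftrightarrow>
              (u = 0) \<or>
              (a = 0 \<and> d\<^sup>2 + v = u) \<or>
              (d = - a \<and> v = u) \<or>
              (a = 0 \<and> d = 0 \<and> I = 0) \<or>
              (d = 3 * a \<and> complex_of_real u * p = 3 * q ^ 3) \<or>
              (\<delta> = 0 \<and> I = 0 \<and> \<Theta> = 0))
       \<and> (\<forall>f\<in>{(\<lambda>x. cu x),
               (\<lambda>x. ca x), (\<lambda>x. (cd x)\<^sup>2 + cv x - cu x),
               (\<lambda>x. cd x - (- ca x)), (\<lambda>x. cv x - cu x),
               (\<lambda>x. cd x), (\<lambda>x. cI x),
               (\<lambda>x. cd x - 3 * ca x),
               (\<lambda>x. Re (complex_of_real (cu x) * cp x - 3 * cq x ^ 3)),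
               (\<lambda>x. Im (complex_of_real (cu x) * cp x - 3 * cq x ^ 3)),
               (\<lambda>x. cdelta x), (\<lambda>x. cTheta x)}.
            poly_fun_degree_le 5 f)"
proof (rule conjI[OF _ degree_le_5], intro ballI)
  fix Z assume Z: "Z \<in> k_A"
  define x where "x = coords Z"
  have "Z = Zf (ca x) (cd x) (cq x) (cp x)"
    unfolding x_def using k_A_elem_coords[OF Z] by (simp add: k_A_elem_eq_Zf)
  then have "L_of Z \<noteq> g2 \<longleftrightarrow> cq x = 0 \<or> kernel_plane (Zf (ca x) (cd x) (cq x) (cp x))"
    by (simp only: L_of_Zf_iff)
  moreover have "cu x = 0 \<longleftrightarrow> cq x = 0" by (simp add: cu_def)
  moreover note kernel_plane_iff[of "cq x" "ca x" "cd x" "cp x"]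
  ultimately show "let x = coords Z; a = ca x; d = cd x; q = cq x; p = cp x;
              u = cu x; v = cv x; I = cI x; \<delta> = cdelta x; \<Theta> = cTheta x in
            L_of Z \<noteq> g2 \<longleftrightarrow>
              (u = 0) \<or>
              (a = 0 \<and> d\<^sup>2 + v = u) \<or>
              (d = - a \<and> v = u) \<or>
              (a = 0 \<and> d = 0 \<and> I = 0) \<or>
              (d = 3 * a \<and> complex_of_real u * p = 3 * q ^ 3) \<or>
              (\<delta> = 0 \<and> I = 0 \<and> \<Theta> = 0)"
    unfolding Let_def x_def[symmetric] cdelta_def cTheta_def cu_def cv_def cR_def cI_def by blast
qed

end
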